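(* Let $y^0\in S^{f^{(2)}}$. Then Pontryagin's maximum principle holds for the problem $(P)^{f^{(2)}}_{y^0}$: if $t^*$ is the optimal time, $u^*$ is an optimal control and $y^*$ is the corresponding optimal state for $(P)^{f^{(2)}}_{y^0}$, then there is a nontrivial (not identically zero) function $\psi\in C([0,t^*];\mathbb R^2)$ satisfying $$\psi(t)=\int_t^{t^*}f^{(2)}_y(y^*(\tau))\psi(\tau)\,d\tau\quad\text{for all }t\in[0,t^* ),\qquad \psi(t^* )=0,$$ and $$\max_{\|u\|\le\rho_0}\langle\psi(t),B(t)u\rangle=\langle\psi(t),B(t)u^*(t)\rangle\quad\text{for a.e. }t\in[0,t^*],$$ where the maximum is over $u\in\mathbb R^2$ with $\|u\|\le\rho_0$. Besides, $$t^*\le\frac{(2K_0+1)(\|y^0\|-1)^2}{2K_0}.$$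
   Context: Notation: $\|\cdot\|$ and $\langle\cdot,\cdot\rangle$ are the Euclidean norm and inner product on $\mathbb R^2$ ($\|\cdot\|$ is also the operator norm for matrices), $R^+=[0,+\infty)$. Fix a nontrivial (not a.e. zero) $B\in L^\infty(0,+\infty;\mathbb R^{2\times2})$ and $\rho_0>0$. Controls: $\mathcal U_{ad}=\{u:R^+\to\mathbb R^2:\ u \text{ Lebesgue measurable},\ \|u(t)\|\le\rho_0\text{ for a.e. }t\in R^+\}$. Put $K_0=\operatorname{ess\,sup}_{s\in R^+}\|B(s)\|\,\rho_0$. Vector field: $f^{(2)}(y)=\left(\frac{y_1}{1-\|y\|},\,\frac{y_2}{1-\|y\|}\right)^T$ for $y=(y_1,y_2)^T$ with $\|y\|\ne1$. Convention for the derivative: for $g=(g_1,g_2)^T$, $g_y=\begin{pmatrix}\partial g_1/\partial y_1&\partial g_2/\partial y_1\\ \partial g_1/\partial y_2&\partial g_2/\partial y_2\end{pmatrix}$. Initial data: $S^{f^{(2)}}=\{z\in\mathbb R^2:\|z\|\in(1-\frac1{2K_0+1},1)\}\cup\{z\in\mathbb R^2:\|z\|\in(1,1+\frac1{2K_0})\}$. For $y^0\in S^{f^{(2)}}$, $u\in\mathcal U_{ad}$, let $y(\cdot\,;f^{(2)},y^0,u)$ be the unique (absolutely continuous, with values in the domain of $f^{(2)}$) solution of $\frac{dy}{dt}=f^{(2)}(y(t))+B(t)u(t)$, $t>0$, $y(0)=y^0$, with maximal interval of existence $[0,T_{max}(f^{(2)},y^0,u))$. For all such $y^0,u$ there is a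 unique time $T_q(f^{(2)},y^0,u)\le T_{max}(f^{(2)},y^0,u)$, the quenching time, such that $0<T_q<+\infty$, $\lim_{t\to T_q}\|f^{(2)}(y(t;f^{(2)},y^0,u))\|=+\infty$, and $\|f^{(2)}(y(t;f^{(2)},y^0,u))\|<+\infty$ for $t\in[0,T_q)$. Problem $(P)^{f^{(2)}}_{y^0}$: $\min_{u\in\mathcal U_{ad}}T_q(f^{(2)},y^0,u)$. The optimal time is $t^*=\inf_{u\in\mathcal U_{ad}}T_q(f^{(2)},y^0,u)$; an optimal control is a $u^*\in\mathcal U_{ad}$ with $T_q(f^{(2)},y^0,u^* )=t^*$; the corresponding optimal state is $y^*(\cdot)=y(\cdot\,;f^{(2)},y^0,u^* )$. *)

theory Defs
  imports "HOL-Analysis.Analysis" "HOL-Probability.Essential_Supremum"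
begin

(* Matrices act on column vectors by *v and are measured by the operator norm (onorm);
   the type class norm on real^2^2 is a different norm and is not used.
   Functions on [0,infinity) are total functions on the reals whose values at negative
   times are irrelevant. *)

abbreviation half_line :: "real measure" where
  "half_line \<equiv> lebesgue_on {0..}"

definition ess_norm :: "(real \<Rightarrow> real^2^2) \<Rightarrow> ereal" where
  "ess_norm B = esssup half_line (\<lambda>s. ereal (onorm ((*v) (B s))))"

definition L_infinity :: "(real \<Rightarrow> real^2^2) set" where
  "L_infinity = {B. B \<in> borel_measurable half_line \<and> ess_norm B < \<infinity>}"

definition U_ad :: "real \<Rightarrow> (real \<Rightarrow> real^2) set" where
  "U_ad \<rho>\<^sub>0 = {u. u \<in> borel_measurable half_line \<and> (AE t in half_line. norm (u t) \<le> \<rho>\<^sub>0)}"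

definition K0 :: "(real \<Rightarrow> real^2^2) \<Rightarrow> real \<Rightarrow> real" where
  "K0 B \<rho>\<^sub>0 = real_of_ereal (ess_norm B) * \<rho>\<^sub>0"

(* Only meaningful for norm y \<noteq> 1; this restriction is imposed explicitly in solves. *)
definition f2 :: "real^2 \<Rightarrow> real^2" where
  "f2 y = (\<chi> i. y $ i / (1 - norm y))"

(* Row i, column j holds the partial derivative of g_j with respect to y_i, so this is the
   transpose of the usual Jacobian matrix. *)
definition deriv_matrix :: "(real^2 \<Rightarrow> real^2) \<Rightarrow> real^2 \<Rightarrow> real^2^2" where
  "deriv_matrix g y = (\<chi> i j. deriv (\<lambda>s. g (y + s *\<^sub>R axis i 1) $ j) 0)"

definition S_f2 :: "(real \<Rightarrow> real^2^2) \<Rightarrow> real \<Rightarrow> (real^2) set" where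
  "S_f2 B \<rho>\<^sub>0 = {z. norm z \<in> {1 - 1 / (2 * K0 B \<rho>\<^sub>0 + 1) <..< 1}}
            \<union> {z. norm z \<in> {1 <..< 1 + 1 / (2 * K0 B \<rho>\<^sub>0)}}"

(* The usual epsilon-delta definition: d ranges over the finite families of nonoverlapping
   compact subintervals of S, and a compact interval k is [Inf k, Sup k]. *)
definition abs_continuous_on :: "real set \<Rightarrow> (real \<Rightarrow> 'a::real_normed_vector) \<Rightarrow> bool" where
  "abs_continuous_on S g \<longleftrightarrow>
     (\<forall>\<epsilon>>0. \<exists>\<delta>>0. \<forall>d. d division_of \<Union>d \<longrightarrow> \<Union>d \<subseteq> S \<longrightarrow> (\<Sum>k\<in>d. Sup k - Inf k) < \<delta> \<longrightarrow>
        (\<Sum>k\<in>d. norm (g (Sup k) - g (Inf k))) < \<epsilon>)"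

(* y is a solution on [0,T) of y' = f2 y + B u, y(0) = y0, with values in the domain of f2.
   Absolute continuity is required on the compact subintervals of [0,T). *)
definition solves ::
  "(real \<Rightarrow> real^2^2) \<Rightarrow> real^2 \<Rightarrow> (real \<Rightarrow> real^2) \<Rightarrow> ereal \<Rightarrow> (real \<Rightarrow> real^2) \<Rightarrow> bool" where
  "solves B y0 u T y \<longleftrightarrow>
     0 < T \<and> y 0 = y0 \<and>
     (\<forall>t\<ge>0. ereal t < T \<longrightarrow> norm (y t) \<noteq> 1) \<and>
     (\<forall>b\<ge>0. ereal b < T \<longrightarrow> abs_continuous_on {0..b} y) \<and>
     (AE t in lebesgue_on {t. 0 < t \<and> ereal t < T}.
        (y has_vector_derivative (f2 (y t) + B t *v u t)) (at t))"

definition T_max :: "(real \<Rightarrow> real^2^2) \<Rightarrow> real^2 \<Rightarrow> (real \<Rightarrow> real^2) \<Rightarrow> ereal" where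
  "T_max B y0 u = Sup {T. \<exists>y. solves B y0 u T y}"

(* Solutions are unique on [0,T_max), so the choice only affects times outside this interval. *)
definition state :: "(real \<Rightarrow> real^2^2) \<Rightarrow> real^2 \<Rightarrow> (real \<Rightarrow> real^2) \<Rightarrow> real \<Rightarrow> real^2" where
  "state B y0 u = (SOME y. solves B y0 u (T_max B y0 u) y)"

(* The condition norm (state B y0 u t) \<noteq> 1 expresses that the norm of f2 (y t) is finite. *)
definition is_quenching_time ::
  "(real \<Rightarrow> real^2^2) \<Rightarrow> real^2 \<Rightarrow> (real \<Rightarrow> real^2) \<Rightarrow> real \<Rightarrow> bool" where
  "is_quenching_time B y0 u T \<longleftrightarrow>
     0 < T \<and> ereal T \<le> T_max B y0 u \<and>
     filterlim (\<lambda>t. norm (f2 (state B y0 u t))) at_top (at_left T) \<and>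
     (\<forall>t\<in>{0..<T}. norm (state B y0 u t) \<noteq> 1)"

definition T_q :: "(real \<Rightarrow> real^2^2) \<Rightarrow> real^2 \<Rightarrow> (real \<Rightarrow> real^2) \<Rightarrow> real" where
  "T_q B y0 u = (THE T. is_quenching_time B y0 u T)"

definition optimal_time :: "(real \<Rightarrow> real^2^2) \<Rightarrow> real \<Rightarrow> real^2 \<Rightarrow> real" where
  "optimal_time B \<rho>\<^sub>0 y0 = (INF u\<in>U_ad \<rho>\<^sub>0. T_q B y0 u)"

definition optimal_control ::
  "(real \<Rightarrow> real^2^2) \<Rightarrow> real \<Rightarrow> real^2 \<Rightarrow> (real \<Rightarrow> real^2) \<Rightarrow> bool" where
  "optimal_control B \<rho>\<^sub>0 y0 u \<longleftrightarrow> u \<in> U_ad \<rho>\<^sub>0 \<and> T_q B y0 u = optimal_time B \<rho>\<^sub>0 y0"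

end

theory Submission
  imports Defs
begin

text \<open>Near the unit circle the field \<open>f2\<close> is radial and points at the circle with strength \<open>norm y / gap y\<close>, where
\<open>gap y = \<bar>1 - norm y\<bar>\<close>. At every point of \<open>S_f2\<close> this strength exceeds \<open>2 * K0\<close>, so no
admissible control can stop the approach: the gap decreases, and its square decreases at least at the rate
\<open>c = 2 * K0 / (2 * K0 + 1)\<close> (\<open>gap_square_decay\<close>). Hence every admissible control quenches, not later than
\<open>(gap y0)\<^sup>2 / c\<close>, which is the bound on the optimal time, and on the way the gap is at least
\<open>sqrt (c * (T - t))\<close>. These facts hold for both sides of the circle at once; the side is recorded by a sign \<open>\<sigma>\<close>.

The maximum principle comes from a first variation. Admissible controls form a convex set, so an optimal control
\<open>u*\<close> and a competitor \<open>u\<close> give admissible controls \<open>u* + \<epsilon> (u - u*)\<close>; by optimality their trajectories \<open>z\<close>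
survive on \<open>[0, T)\<close>, where \<open>T\<close> is the optimal time and \<open>y\<close> is the optimal trajectory. For the adjoint state \<open>\<psi>\<close>,

  \<open>(\<psi> \<bullet> (z - y))' = \<psi> \<bullet> f2_rem y z + \<epsilon> * (\<psi> \<bullet> B (u - u*))\<close>,

where \<open>f2_rem\<close> is the error of the linearization of \<open>f2\<close>. The trajectories are bounded and \<open>\<psi>\<close> vanishes at \<open>T\<close>, so
the left-hand side integrates to 0. If the remainder contributes at least \<open>- const * \<epsilon>\<^sup>2\<close>, division by \<open>\<epsilon>\<close>
gives that the integral of \<open>\<psi> \<bullet> B (u - u*)\<close> is not positive (\<open>first_variation\<close>). Inserting the
control \<open>\<rho>\<^sub>0 * sgn (B\<^sup>T \<psi>)\<close>, for which the integrand is pointwise nonnegative, forces it to vanish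
almost everywhere, and this is the maximum principle (\<open>pontryagin_principle\<close>).

The singularity of \<open>f2\<close> at the circle has to be handled in two places. The Jacobian grows like \<open>1 / gap\<^sup>2\<close>, which is
not integrable in time, so the adjoint equation cannot be solved backwards from \<open>T\<close> directly. With the ansatz
\<open>\<psi> = (1 - norm y) * a * y + q * rot y\<close> the pair \<open>(a, q)\<close> satisfies a linear system with coefficients of order
\<open>1 / gap\<close>, and these are integrable; the terminal values \<open>a = 1\<close> and \<open>q = 0\<close> select a solution that points radially at the
circle and is of the size of the gap (\<open>adjoint_exists\<close>). The remainder is not small near \<open>T\<close> either, but there it has a sign
in the radial direction, because the radial speed \<open>r / (1 - r)\<close> curves in the right way on both sides of the
circle. The angular part may be negative; it is absorbed by a weight \<open>const * sqrt (T - t)\<close> on the angular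
deviation, whose derivative is as singular as the bad term (\<open>f2_rem_lower\<close>, \<open>late_growth\<close>).\<close>

section \<open>Absolutely continuous functions as primitives\<close>

lemma AE_lebesgue_E:
  assumes "AE t in lebesgue. P t"
  obtains N where "negligible N" "\<And>t. t \<notin> N \<Longrightarrow> P t"
proof -
  obtain N where "\<And>t. t \<in> space lebesgue - N \<Longrightarrow> P t" "N \<in> null_sets lebesgue"
    using AE_E3[OF assms] by blast
  thus ?thesis by (intro that[of N]) (simp_all add: negligible_iff_null_sets)
qed

lemma AE_lebesgue_I:
  assumes "negligible N" "\<And>t. t \<notin> N \<Longrightarrow> P t"
  shows "AE t in lebesgue. P t"
proof (rule AE_I')
  show "N \<in> null_sets lebesgue" using assms(1) by (simp add: negligible_iff_null_sets)
  show "{t \<in> space lebesgue. \<not> P t} \<subseteq> N" using assms(2) by blast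
qed

text \<open>The fundamental theorem of calculus for absolutely continuous functions, read off from the definition of the
gauge integral. Outside the exceptional null set the gauge comes from differentiability; on the null set it confines the tagged
intervals to an open set of small measure, so that absolute continuity bounds the total increment over them.\<close>
lemma abs_continuous_primitive:
  fixes g :: "real \<Rightarrow> 'a::banach"
  assumes ab: "a \<le> b" and ac: "abs_continuous_on {a..b} g"
    and der: "AE t in lebesgue. t \<in> {a..b} \<longrightarrow> (g has_vector_derivative g' t) (at t within {a..b})"
  shows "(g' has_integral (g b - g a)) {a..b}"
proof -
  from der obtain N where N: "negligible N"
    and derN: "\<And>t. t \<notin> N \<Longrightarrow> t \<in> {a..b} \<Longrightarrow> (g has_vector_derivative g' t) (at t within {a..b})"
    by (elim AE_lebesgue_E) auto
  define h where "h t = (if t \<in> N then 0 else g' t)" for t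
  have "(h has_integral (g b - g a)) {a..b}"
    unfolding has_integral_real
  proof safe
    fix e :: real
    assume e: "e > 0"
    define e1 where "e1 = e / (2 * (b - a + 1))"
    have e1: "e1 > 0" "e1 * (b - a) < e / 2"
      using e ab by (auto simp: e1_def field_simps)
    obtain \<delta> where \<delta>: "\<delta> > 0" and ac\<delta>: "\<And>d. d division_of \<Union>d \<Longrightarrow> \<Union>d \<subseteq> {a..b} \<Longrightarrow>
        (\<Sum>k\<in>d. Sup k - Inf k) < \<delta> \<Longrightarrow> (\<Sum>k\<in>d. norm (g (Sup k) - g (Inf k))) < e / 2"
      using mp[OF spec[OF ac[unfolded abs_continuous_on_def], of "e / 2"] half_gt_zero[OF e]] by blast
    have Nm: "N \<in> null_sets lebesgue" using N by (simp add: negligible_iff_null_sets)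
    obtain U where U: "open U" "N \<subseteq> U" "U - N \<in> lmeasurable" "emeasure lebesgue (U - N) < ennreal \<delta>"
      using sets_lebesgue_outer_open[OF null_setsD2[OF Nm] \<delta>] by blast
    have Ulm: "U \<in> lmeasurable"
      using U Nm by (metis borel_open measurable_Diff_null_set sets_completionI_sets sets_lborel)
    have Umeas: "measure lebesgue U < \<delta>"
    proof -
      have "measure lebesgue U = measure lebesgue (U - N)"
        using Nm by (simp add: measure_Diff_null_set Ulm fmeasurableD)
      moreover have "ennreal (measure lebesgue (U - N)) < ennreal \<delta>"
        using U(3,4) by (simp add: emeasure_eq_measure2)
      ultimately show ?thesis by (simp add: ennreal_less_iff)
    qed
    have "\<exists>d>0. (t \<in> N \<longrightarrow> ball t d \<subseteq> U) \<and> (t \<notin> N \<longrightarrow> t \<in> {a..b} \<longrightarrow>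
         (\<forall>y\<in>{a..b}. norm (y-t) < d \<longrightarrow> norm (g y - g t - (y-t) *\<^sub>R g' t) \<le> e1 * norm (y-t)))" for t
    proof (cases "t \<in> N")
      case True
      then obtain d where "d > 0" "ball t d \<subseteq> U" using U(1,2) unfolding open_contains_ball by blast
      thus ?thesis using True by blast
    next
      case False
      thus ?thesis
      proof (cases "t \<in> {a..b}")
        case True
        show ?thesis
          using derN[OF False True, unfolded has_vector_derivative_def has_derivative_within_alt] e1(1) False
          by blast
      qed (use False in \<open>auto intro: exI[of _ 1]\<close>)
    qed
    hence "\<forall>t. \<exists>d>0. (t \<in> N \<longrightarrow> ball t d \<subseteq> U) \<and> (t \<notin> N \<longrightarrow> t \<in> {a..b} \<longrightarrow>
         (\<forall>y\<in>{a..b}. norm (y-t) < d \<longrightarrow> norm (g y - g t - (y-t) *\<^sub>R g' t) \<le> e1 * norm (y-t)))"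
      by blast
    from choice[OF this] obtain d where d: "\<And>t. 0 < d t \<and> (t \<in> N \<longrightarrow> ball t (d t) \<subseteq> U) \<and> (t \<notin> N \<longrightarrow> t \<in> {a..b} \<longrightarrow>
         (\<forall>y\<in>{a..b}. norm (y-t) < d t \<longrightarrow> norm (g y - g t - (y-t) *\<^sub>R g' t) \<le> e1 * norm (y-t)))"
      by blast
    have d0: "\<And>t. 0 < d t" and dN: "\<And>t. t \<in> N \<Longrightarrow> ball t (d t) \<subseteq> U"
      and dd: "\<And>t y. \<lbrakk>t \<notin> N; t \<in> {a..b}; y \<in> {a..b}; norm (y-t) < d t\<rbrakk>
                        \<Longrightarrow> norm (g y - g t - (y-t) *\<^sub>R g' t) \<le> e1 * norm (y-t)"
      using d by blast+
    show "\<exists>\<gamma>. gauge \<gamma> \<and> (\<forall>p. p tagged_division_of {a..b} \<and> \<gamma> fine p \<longrightarrow>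
      norm ((\<Sum>(x, k)\<in>p. measure lborel k *\<^sub>R h x) - (g b - g a)) < e)"
    proof (rule exI, safe)
      show "gauge (\<lambda>x. ball x (d x))"
        using d0 gauge_ball_dependent by blast
    next
      fix p
      assume ptag: "p tagged_division_of {a..b}" and finep: "(\<lambda>x. ball x (d x)) fine p"
      have finp: "finite p" using ptag by blast
      define pN where "pN = {q \<in> p. fst q \<in> N}"
      define pG where "pG = p - pN"
      have pu: "p = pN \<union> pG" "pN \<inter> pG = {}" "finite pN" "finite pG"
        using finp by (auto simp: pN_def pG_def)
      have ba: "b - a = (\<Sum>(x,K)\<in>p. Sup K - Inf K)" "g b - g a = (\<Sum>(x,K)\<in>p. g(Sup K) - g(Inf K))"
        using additive_tagged_division_1[where f= "\<lambda>x. x"] additive_tagged_division_1[where f= g]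
          ab ptag by auto
      have interval: "\<exists>u v. K = {u..v} \<and> u \<le> v \<and> x \<in> K \<and> K \<subseteq> {a..b} \<and> K \<subseteq> ball x (d x)" if xK: "(x, K) \<in> p" for x K
      proof -
        have "x \<in> K" "K \<subseteq> {a..b}" using tagged_division_ofD(2,3)[OF ptag xK] by auto
        moreover obtain u v where "K = cbox u v" using tagged_division_ofD(4)[OF ptag xK] by blast
        moreover have "K \<subseteq> ball x (d x)" using finep xK by blast
        ultimately have "K = {u..v} \<and> u \<le> v \<and> x \<in> K \<and> K \<subseteq> {a..b} \<and> K \<subseteq> ball x (d x)" by simp
        thus ?thesis by blast
      qed
      have good: "norm (measure lborel K *\<^sub>R h x - (g (Sup K) - g (Inf K))) \<le> e1 * (Sup K - Inf K)"
        if "(x, K) \<in> pG" for x K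
      proof -
        have "(x, K) \<in> p" and xN: "x \<notin> N" using that by (auto simp: pG_def pN_def)
        then obtain u v where k: "K = {u..v}" "u \<le> v" "x \<in> K" "K \<subseteq> {a..b}" "K \<subseteq> ball x (d x)"
          using interval by blast
        have uvx: "u \<le> x" "x \<le> v" and SI: "Sup K = v" "Inf K = u" using k(1-3) by simp_all
        have "u \<in> K" "v \<in> K" using k(1,2) by simp_all
        hence mem: "x \<in> {a..b}" "u \<in> {a..b}" "v \<in> {a..b}" "u \<in> ball x (d x)" "v \<in> ball x (d x)"
          using k(3-5) by blast+
        have "norm ((v - u) *\<^sub>R g' x - (g v - g u)) = norm (g u - g x - (u - x) *\<^sub>R g' x - (g v - g x - (v - x) *\<^sub>R g' x))"
          by (auto simp: algebra_simps)
        also have "\<dots> \<le> norm (g u - g x - (u - x) *\<^sub>R g' x) + norm (g v - g x - (v - x) *\<^sub>R g' x)"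
          by (rule norm_triangle_ineq4)
        also have "\<dots> \<le> e1 * norm (u - x) + e1 * norm (v - x)"
          using mem by (intro add_mono dd xN) (simp_all add: dist_real_def abs_minus_commute)
        also have "\<dots> \<le> e1 * (Sup K - Inf K)"
          using uvx by (simp add: SI algebra_simps)
        finally show ?thesis
          using xN k(1,2) by (simp add: h_def)
      qed
      have len0: "Sup K - Inf K \<ge> 0" if xK: "(x, K) \<in> p" for x K
      proof -
        obtain u v where "K = {u..v}" "u \<le> v" using interval[OF xK] by blast
        thus ?thesis by simp
      qed
      have G: "norm (\<Sum>(x, K)\<in>pG. measure lborel K *\<^sub>R h x - (g (Sup K) - g (Inf K))) < e / 2"
      proof -
        have "norm (\<Sum>(x, K)\<in>pG. measure lborel K *\<^sub>R h x - (g (Sup K) - g (Inf K))) \<le> (\<Sum>(x, K)\<in>pG. e1 * (Sup K - Inf K))"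
        proof (rule sum_norm_le)
          show "norm (case q of (x, K) \<Rightarrow> measure lborel K *\<^sub>R h x - (g (Sup K) - g (Inf K)))
              \<le> (case q of (x, K) \<Rightarrow> e1 * (Sup K - Inf K))" if "q \<in> pG" for q
            using good[of "fst q" "snd q"] that by (simp add: split_def)
        qed
        also have "\<dots> \<le> (\<Sum>(x, K)\<in>p. e1 * (Sup K - Inf K))"
        proof (rule sum_mono2)
          show "0 \<le> (case q of (x, K) \<Rightarrow> e1 * (Sup K - Inf K))" if "q \<in> p - pG" for q
            using len0[of "fst q" "snd q"] e1(1) that by (simp add: split_def)
        qed (use finp in \<open>auto simp: pG_def\<close>)
        also have "\<dots> = e1 * (b - a)" by (simp add: ba(1) sum_distrib_left split_def)
        finally show ?thesis using e1 by linarith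
      qed
      have part: "pN tagged_partial_division_of {a..b}"
      proof (rule tagged_partial_division_subset)
        show "p tagged_partial_division_of {a..b}" using ptag by (simp add: tagged_division_of_def)
      qed (auto simp: pN_def)
      define D where "D = snd ` pN"
      have Ddiv: "D division_of \<Union>D" unfolding D_def by (rule partial_division_of_tagged_division[OF part])
      have "k \<subseteq> {a..b} \<and> k \<subseteq> U" if k: "k \<in> D" for k
      proof -
        obtain x where "(x, k) \<in> p" "x \<in> N" using k by (auto simp: D_def pN_def)
        thus ?thesis using interval[of x k] dN[of x] by blast
      qed
      hence Dsub: "\<Union>D \<subseteq> {a..b}" "\<Union>D \<subseteq> U" by blast+
      have "(\<Sum>k\<in>D. Sup k - Inf k) = (\<Sum>k\<in>D. measure lebesgue k)"
      proof (rule sum.cong)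
        fix k assume "k \<in> D"
        then obtain x where "(x, k) \<in> p" by (auto simp: D_def pN_def)
        then obtain u v where "k = {u..v}" "u \<le> v" using interval[of x k] by blast
        thus "Sup k - Inf k = measure lebesgue k" by simp
      qed auto
      also have "\<dots> = measure lebesgue (\<Union>D)" by (rule content_division[OF Ddiv])
      also have "\<dots> \<le> measure lebesgue U"
        by (intro measure_mono_fmeasurable Dsub Ulm lmeasurable_division[OF Ddiv] fmeasurableD)
      also have "\<dots> < \<delta>" by (rule Umeas)
      finally have small: "(\<Sum>k\<in>D. norm (g (Sup k) - g (Inf k))) < e / 2"
        using ac\<delta>[OF Ddiv Dsub(1)] by blast
      have sumD: "(\<Sum>(x, K)\<in>pN. norm (g (Sup K) - g (Inf K))) = (\<Sum>k\<in>D. norm (g (Sup k) - g (Inf k)))"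
      proof -
        define w where "w K = (if K = {} then 0 else norm (g (Sup K) - g (Inf K)))" for K
        have "(\<Sum>(x, K)\<in>pN. w K) = sum w (snd ` pN)"
        proof (rule sum.over_tagged_division_lemma[OF tagged_partial_division_of_Union_self[OF part]])
          fix u v :: real assume "box u v = {}"
          hence "v \<le> u" by simp
          thus "w (cbox u v) = 0"
            by (cases "u = v") (simp_all add: w_def)
        qed
        moreover have w: "w K = norm (g (Sup K) - g (Inf K))" if xK: "(x, K) \<in> pN" for x K
          using tagged_division_ofD(2)[OF ptag, of x K] xK by (auto simp: w_def pN_def)
        moreover have "sum w D = (\<Sum>k\<in>D. norm (g (Sup k) - g (Inf k)))"
        proof (rule sum.cong)
          fix K assume "K \<in> D"
          then obtain x where "(x, K) \<in> pN" by (auto simp: D_def)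
          thus "w K = norm (g (Sup K) - g (Inf K))" by (rule w)
        qed simp
        moreover have "(\<Sum>(x, K)\<in>pN. w K) = (\<Sum>(x, K)\<in>pN. norm (g (Sup K) - g (Inf K)))"
          by (rule sum.cong) (use w in auto)
        ultimately show ?thesis by (simp add: D_def)
      qed
      have Nb: "norm (\<Sum>(x, K)\<in>pN. measure lborel K *\<^sub>R h x - (g (Sup K) - g (Inf K))) < e / 2"
      proof -
        have "norm (\<Sum>(x, K)\<in>pN. measure lborel K *\<^sub>R h x - (g (Sup K) - g (Inf K))) \<le> (\<Sum>(x, K)\<in>pN. norm (g (Sup K) - g (Inf K)))"
          by (rule sum_norm_le) (auto simp: pN_def h_def norm_minus_commute)
        also note sumD
        finally show ?thesis using small by linarith
      qed
      have "(\<Sum>(x, k)\<in>p. measure lborel k *\<^sub>R h x) - (g b - g a) = (\<Sum>(x, K)\<in>p. measure lborel K *\<^sub>R h x - (g (Sup K) - g (Inf K)))"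
        by (simp add: ba split_def sum_subtractf)
      also have "\<dots> = (\<Sum>(x, K)\<in>pN. measure lborel K *\<^sub>R h x - (g (Sup K) - g (Inf K))) + (\<Sum>(x, K)\<in>pG. measure lborel K *\<^sub>R h x - (g (Sup K) - g (Inf K)))"
        unfolding pu(1) by (rule sum.union_disjoint) (use pu in auto)
      also have "norm \<dots> < e" by (rule norm_triangle_lt) (use Nb G in linarith)
      finally show "norm ((\<Sum>(x, k)\<in>p. measure lborel k *\<^sub>R h x) - (g b - g a)) < e" .
    qed
  qed
  thus ?thesis
    by (rule has_integral_spike[OF N, rotated]) (auto simp: h_def)
qed

lemma lipschitz_on_imp_abs_continuous_on:
  fixes g :: "real \<Rightarrow> 'a::real_normed_vector"
  assumes "L-lipschitz_on {a..b} g"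
  shows "abs_continuous_on {a..b} g"
  unfolding abs_continuous_on_def
proof (intro allI impI)
  fix e :: real assume e: "e > 0"
  have L: "L \<ge> 0" using assms by (rule lipschitz_on_nonneg)
  show "\<exists>\<delta>>0. \<forall>d. d division_of \<Union>d \<longrightarrow> \<Union>d \<subseteq> {a..b} \<longrightarrow> (\<Sum>k\<in>d. Sup k - Inf k) < \<delta> \<longrightarrow>
        (\<Sum>k\<in>d. norm (g (Sup k) - g (Inf k))) < e"
  proof (intro exI[of _ "e / (L + 1)"] conjI allI impI)
    fix d :: "real set set"
    assume d: "d division_of \<Union>d" "\<Union>d \<subseteq> {a..b}" and s: "(\<Sum>k\<in>d. Sup k - Inf k) < e / (L + 1)"
    have "(\<Sum>k\<in>d. norm (g (Sup k) - g (Inf k))) \<le> (\<Sum>k\<in>d. L * (Sup k - Inf k))"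
    proof (rule sum_mono)
      fix k assume k: "k \<in> d"
      then obtain u v where uv: "k = cbox u v" "k \<noteq> {}" using d(1) by blast
      hence "u \<le> v" "u \<in> k" "v \<in> k" by auto
      moreover have "k \<subseteq> {a..b}" using d(2) k by blast
      ultimately have "u \<le> v" "u \<in> {a..b}" "v \<in> {a..b}" by auto
      thus "norm (g (Sup k) - g (Inf k)) \<le> L * (Sup k - Inf k)"
        using lipschitz_on_normD[OF assms, of v u] uv by auto
    qed
    also have "\<dots> = L * (\<Sum>k\<in>d. Sup k - Inf k)" by (simp add: sum_distrib_left)
    also have "\<dots> \<le> L * (e / (L + 1))" using s L by (intro mult_left_mono) auto
    also have "\<dots> < e" using e L by (simp add: field_simps)
    finally show "(\<Sum>k\<in>d. norm (g (Sup k) - g (Inf k))) < e" .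
  qed (use e L in auto)
qed

lemma continuous_on_Icc_bounded:
  fixes f :: "real \<Rightarrow> 'a::real_normed_vector"
  assumes "continuous_on {a..b} f"
  obtains P where "P > 0" "\<And>t. t \<in> {a..b} \<Longrightarrow> norm (f t) \<le> P"
proof -
  have "bounded (f ` {a..b})" by (intro compact_imp_bounded compact_continuous_image assms compact_Icc)
  thus ?thesis using that unfolding bounded_pos by blast
qed

text \<open>All functions of a trajectory that are differentiated below are Lipschitz on compact time intervals, and this class is stable under
products and smooth compositions. It serves as a calculus of almost everywhere derivatives in which
integration is still allowed.\<close>
definition lip_primitive :: "real \<Rightarrow> real \<Rightarrow> (real \<Rightarrow> 'a::euclidean_space) \<Rightarrow> (real \<Rightarrow> 'a) \<Rightarrow> bool" where
  "lip_primitive a b \<phi> \<phi>' \<longleftrightarrow> (\<exists>L. L-lipschitz_on {a..b} \<phi>) \<and>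
     (AE t in lebesgue. t \<in> {a..b} \<longrightarrow> (\<phi> has_vector_derivative \<phi>' t) (at t within {a..b}))"

lemma lip_primitive_integral:
  assumes "lip_primitive a b \<phi> \<phi>'" "a \<le> b"
  shows "(\<phi>' has_integral (\<phi> b - \<phi> a)) {a..b}"
  using assms lipschitz_on_imp_abs_continuous_on unfolding lip_primitive_def
  by (intro abs_continuous_primitive) blast+

lemma lip_primitive_continuous: "lip_primitive a b \<phi> \<phi>' \<Longrightarrow> continuous_on {a..b} \<phi>"
  unfolding lip_primitive_def using lipschitz_on_continuous_on by blast

lemma lip_primitive_subset:
  assumes "lip_primitive a b \<phi> \<phi>'" "a \<le> c" "d \<le> b"
  shows "lip_primitive c d \<phi> \<phi>'"
proof -
  have s: "{c..d} \<subseteq> {a..b}" using assms by auto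
  show ?thesis using assms(1) unfolding lip_primitive_def
  proof (elim conjE exE, intro conjI)
    fix L assume "L-lipschitz_on {a..b} \<phi>"
    thus "\<exists>L. L-lipschitz_on {c..d} \<phi>" using lipschitz_on_subset s by blast
  next
    assume "AE t in lebesgue. t \<in> {a..b} \<longrightarrow> (\<phi> has_vector_derivative \<phi>' t) (at t within {a..b})"
    thus "AE t in lebesgue. t \<in> {c..d} \<longrightarrow> (\<phi> has_vector_derivative \<phi>' t) (at t within {c..d})"
      by eventually_elim (use s in \<open>auto intro: has_vector_derivative_within_subset\<close>)
  qed
qed

lemma lip_primitive_cong:
  assumes "lip_primitive a b \<phi> \<phi>'" "\<And>t. t \<in> {a..b} \<Longrightarrow> \<phi> t = \<xi> t"
    "\<And>t. t \<in> {a..b} \<Longrightarrow> \<phi>' t = \<xi>' t"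
  shows "lip_primitive a b \<xi> \<xi>'"
  using assms(1) unfolding lip_primitive_def
proof (elim conjE exE, intro conjI)
  fix L assume "L-lipschitz_on {a..b} \<phi>"
  hence "L-lipschitz_on {a..b} \<xi>" by (rule lipschitz_on_transform) (simp add: assms(2))
  thus "\<exists>L. L-lipschitz_on {a..b} \<xi>" ..
next
  assume "AE t in lebesgue. t \<in> {a..b} \<longrightarrow> (\<phi> has_vector_derivative \<phi>' t) (at t within {a..b})"
  thus "AE t in lebesgue. t \<in> {a..b} \<longrightarrow> (\<xi> has_vector_derivative \<xi>' t) (at t within {a..b})"
  proof eventually_elim
    case (elim t)
    show ?case
    proof
      assume t: "t \<in> {a..b}"
      show "(\<xi> has_vector_derivative \<xi>' t) (at t within {a..b})"
        by (rule has_vector_derivative_transform[OF t, where f = \<phi>]) (use assms(2,3) elim t in auto)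
    qed
  qed
qed

lemma lip_primitive_const [intro]: "lip_primitive a b (\<lambda>_. c) (\<lambda>_. 0)"
  unfolding lip_primitive_def by (auto intro: lipschitz_on_constant)

lemma lip_primitive_add:
  assumes "lip_primitive a b \<phi> \<phi>'" "lip_primitive a b \<xi> \<xi>'"
  shows "lip_primitive a b (\<lambda>t. \<phi> t + \<xi> t) (\<lambda>t. \<phi>' t + \<xi>' t)"
  using assms unfolding lip_primitive_def
proof (elim conjE exE, intro conjI)
  fix L M assume "L-lipschitz_on {a..b} \<phi>" "M-lipschitz_on {a..b} \<xi>"
  thus "\<exists>L. L-lipschitz_on {a..b} (\<lambda>t. \<phi> t + \<xi> t)" by (blast intro: lipschitz_on_add)
next
  assume "AE t in lebesgue. t \<in> {a..b} \<longrightarrow> (\<phi> has_vector_derivative \<phi>' t) (at t within {a..b})"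
    "AE t in lebesgue. t \<in> {a..b} \<longrightarrow> (\<xi> has_vector_derivative \<xi>' t) (at t within {a..b})"
  thus "AE t in lebesgue. t \<in> {a..b} \<longrightarrow> ((\<lambda>t. \<phi> t + \<xi> t) has_vector_derivative \<phi>' t + \<xi>' t) (at t within {a..b})"
    by eventually_elim (auto intro: has_vector_derivative_add)
qed

lemma lip_primitive_compose:
  assumes "lip_primitive a b \<phi> \<phi>'" "\<exists>L. L-lipschitz_on (\<phi> ` {a..b}) g"
    "\<And>t. t \<in> {a..b} \<Longrightarrow> (g has_derivative G t) (at (\<phi> t))"
  shows "lip_primitive a b (\<lambda>t. g (\<phi> t)) (\<lambda>t. G t (\<phi>' t))"
  using assms(1,2) unfolding lip_primitive_def
proof (elim conjE exE, intro conjI)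
  fix L M assume "L-lipschitz_on {a..b} \<phi>" "M-lipschitz_on (\<phi> ` {a..b}) g"
  thus "\<exists>L. L-lipschitz_on {a..b} (\<lambda>t. g (\<phi> t))" by (blast intro: lipschitz_on_compose2)
next
  assume "AE t in lebesgue. t \<in> {a..b} \<longrightarrow> (\<phi> has_vector_derivative \<phi>' t) (at t within {a..b})"
  thus "AE t in lebesgue. t \<in> {a..b} \<longrightarrow> ((\<lambda>t. g (\<phi> t)) has_vector_derivative G t (\<phi>' t)) (at t within {a..b})"
  proof eventually_elim
    case (elim t)
    show ?case
    proof
      assume t: "t \<in> {a..b}"
      have D: "((\<lambda>s. g (\<phi> s)) has_derivative (\<lambda>h. G t (h *\<^sub>R \<phi>' t))) (at t within {a..b})"
        using elim t assms(3)[OF t] unfolding has_vector_derivative_def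
        by (auto intro: has_derivative_compose)
      have "linear (G t)" using assms(3)[OF t] by (simp add: has_derivative_linear)
      thus "((\<lambda>t. g (\<phi> t)) has_vector_derivative G t (\<phi>' t)) (at t within {a..b})"
        using D unfolding has_vector_derivative_def by (simp add: linear_cmul)
    qed
  qed
qed

lemma lip_primitive_linear:
  assumes "lip_primitive a b \<phi> \<phi>'" "bounded_linear f"
  shows "lip_primitive a b (\<lambda>t. f (\<phi> t)) (\<lambda>t. f (\<phi>' t))"
proof (rule lip_primitive_compose[OF assms(1)])
  interpret bounded_linear f by fact
  show "\<exists>L. L-lipschitz_on (\<phi> ` {a..b}) f"
    using lipschitz_boundE by blast
  show "(f has_derivative f) (at (\<phi> t))" for t by (rule bounded_linear_imp_has_derivative) fact
qed

lemma lip_primitive_uminus: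
  "lip_primitive a b \<phi> \<phi>' \<Longrightarrow> lip_primitive a b (\<lambda>t. - \<phi> t) (\<lambda>t. - \<phi>' t)"
  by (erule lip_primitive_linear) (intro bounded_linear_minus bounded_linear_ident)

lemma lip_primitive_cmult:
  "lip_primitive a b \<phi> \<phi>' \<Longrightarrow> lip_primitive a b (\<lambda>t. c *\<^sub>R \<phi> t) (\<lambda>t. c *\<^sub>R \<phi>' t)"
  by (erule lip_primitive_linear) (intro bounded_linear_intros)

lemma lip_primitive_diff:
  assumes "lip_primitive a b \<phi> \<phi>'" "lip_primitive a b \<xi> \<xi>'"
  shows "lip_primitive a b (\<lambda>t. \<phi> t - \<xi> t) (\<lambda>t. \<phi>' t - \<xi>' t)"
  using lip_primitive_add[OF assms(1) lip_primitive_uminus[OF assms(2)]] by simp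

lemma lip_primitive_bilinear:
  assumes "bounded_bilinear f" "lip_primitive a b \<phi> \<phi>'" "lip_primitive a b \<xi> \<xi>'"
  shows "lip_primitive a b (\<lambda>t. f (\<phi> t) (\<xi> t)) (\<lambda>t. f (\<phi> t) (\<xi>' t) + f (\<phi>' t) (\<xi> t))"
proof -
  interpret bounded_bilinear f by fact
  obtain K where K: "K > 0" "\<And>x y. norm (f x y) \<le> norm x * norm y * K" using pos_bounded by blast
  obtain P where P: "P > 0" "\<And>t. t \<in> {a..b} \<Longrightarrow> norm (\<phi> t) \<le> P"
    using continuous_on_Icc_bounded[OF lip_primitive_continuous[OF assms(2)]] by blast
  obtain Q where Q: "Q > 0" "\<And>t. t \<in> {a..b} \<Longrightarrow> norm (\<xi> t) \<le> Q"
    using continuous_on_Icc_bounded[OF lip_primitive_continuous[OF assms(3)]] by blast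
  show ?thesis using assms(2,3) unfolding lip_primitive_def
  proof (elim conjE exE, intro conjI)
    fix L M assume L: "L-lipschitz_on {a..b} \<phi>" and M: "M-lipschitz_on {a..b} \<xi>"
    have "(P * M * K + L * Q * K)-lipschitz_on {a..b} (\<lambda>t. f (\<phi> t) (\<xi> t))"
    proof (rule lipschitz_onI)
      show "0 \<le> P * M * K + L * Q * K"
        using P Q K lipschitz_on_nonneg[OF L] lipschitz_on_nonneg[OF M] by simp
      fix s t assume st: "s \<in> {a..b}" "t \<in> {a..b}"
      have "f (\<phi> s) (\<xi> s) - f (\<phi> t) (\<xi> t) = f (\<phi> s) (\<xi> s - \<xi> t) + f (\<phi> s - \<phi> t) (\<xi> t)"
        by (simp add: diff_left diff_right)
      also have "norm \<dots> \<le> norm (\<phi> s) * norm (\<xi> s - \<xi> t) * K + norm (\<phi> s - \<phi> t) * norm (\<xi> t) * K"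
        using K(2) by (intro norm_triangle_mono)
      also have "\<dots> \<le> P * (M * dist s t) * K + (L * dist s t) * Q * K"
        using P Q K st lipschitz_onD[OF L st] lipschitz_onD[OF M st] lipschitz_on_nonneg[OF L] lipschitz_on_nonneg[OF M]
        by (intro add_mono mult_mono mult_nonneg_nonneg) (auto simp: dist_norm)
      finally show "dist (f (\<phi> s) (\<xi> s)) (f (\<phi> t) (\<xi> t)) \<le> (P * M * K + L * Q * K) * dist s t"
        by (simp add: dist_norm algebra_simps)
    qed
    thus "\<exists>L. L-lipschitz_on {a..b} (\<lambda>t. f (\<phi> t) (\<xi> t))" ..
  next
    assume "AE t in lebesgue. t \<in> {a..b} \<longrightarrow> (\<phi> has_vector_derivative \<phi>' t) (at t within {a..b})"
      "AE t in lebesgue. t \<in> {a..b} \<longrightarrow> (\<xi> has_vector_derivative \<xi>' t) (at t within {a..b})"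
    thus "AE t in lebesgue. t \<in> {a..b} \<longrightarrow>
      ((\<lambda>t. f (\<phi> t) (\<xi> t)) has_vector_derivative f (\<phi> t) (\<xi>' t) + f (\<phi>' t) (\<xi> t)) (at t within {a..b})"
      by eventually_elim (auto intro: has_vector_derivative)
  qed
qed

lemmas lip_primitive_inner = lip_primitive_bilinear[OF bounded_bilinear_inner]
lemmas lip_primitive_scaleR = lip_primitive_bilinear[OF bounded_bilinear_scaleR]
lemmas lip_primitive_mult = lip_primitive_bilinear[OF bounded_bilinear_mult]

lemma lip_primitive_C1:
  assumes der: "\<And>t. t \<in> {a..b} \<Longrightarrow> (\<phi> has_vector_derivative \<phi>' t) (at t within {a..b})"
    and cont: "continuous_on {a..b} \<phi>'"
  shows "lip_primitive a b \<phi> \<phi>'"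
proof -
  obtain P where P: "P > 0" "\<And>t. t \<in> {a..b} \<Longrightarrow> norm (\<phi>' t) \<le> P"
    using continuous_on_Icc_bounded[OF cont] by blast
  have "P-lipschitz_on {a..b} \<phi>"
  proof (rule bounded_derivative_imp_lipschitz)
    show "(\<phi> has_derivative (\<lambda>h. h *\<^sub>R \<phi>' t)) (at t within {a..b})" if "t \<in> {a..b}" for t
      using der[OF that] by (simp add: has_vector_derivative_def)
    show "onorm (\<lambda>h. h *\<^sub>R \<phi>' t) \<le> P" if "t \<in> {a..b}" for t
    proof (rule onorm_le)
      fix x :: real
      show "norm (x *\<^sub>R \<phi>' t) \<le> P * norm x"
        using mult_left_mono[OF P(2)[OF that], of "norm x"] by (simp add: mult.commute)
    qed
  qed (use P in auto)
  thus ?thesis unfolding lip_primitive_def using der by auto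
qed

lemma lip_primitive_norm:
  fixes \<phi> :: "real \<Rightarrow> 'a::euclidean_space"
  assumes "lip_primitive a b \<phi> \<phi>'" "\<And>t. t \<in> {a..b} \<Longrightarrow> \<phi> t \<noteq> 0"
  shows "lip_primitive a b (\<lambda>t. norm (\<phi> t)) (\<lambda>t. (\<phi> t \<bullet> \<phi>' t) / norm (\<phi> t))"
proof -
  have "lip_primitive a b (\<lambda>t. norm (\<phi> t)) (\<lambda>t. (\<lambda>h. h \<bullet> sgn (\<phi> t)) (\<phi>' t))"
  proof (rule lip_primitive_compose[OF assms(1)])
    have "1-lipschitz_on (\<phi> ` {a..b}) norm"
      by (rule lipschitz_onI) (auto simp: dist_norm norm_triangle_ineq3)
    thus "\<exists>L. L-lipschitz_on (\<phi> ` {a..b}) norm" ..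
  qed (use assms(2) in \<open>auto intro: has_derivative_norm\<close>)
  thus ?thesis
    by (rule lip_primitive_cong) (auto simp: sgn_div_norm inner_commute field_simps)
qed

lemma lip_primitive_inverse:
  fixes \<phi> :: "real \<Rightarrow> real"
  assumes "lip_primitive a b \<phi> \<phi>'" "\<And>t. t \<in> {a..b} \<Longrightarrow> \<phi> t \<noteq> 0"
  shows "lip_primitive a b (\<lambda>t. 1 / \<phi> t) (\<lambda>t. - \<phi>' t / (\<phi> t)\<^sup>2)"
proof -
  have "lip_primitive a b (\<lambda>t. inverse (\<phi> t)) (\<lambda>t. (\<lambda>h. - (inverse (\<phi> t) * h * inverse (\<phi> t))) (\<phi>' t))"
  proof (rule lip_primitive_compose[OF assms(1)])
    have c: "continuous_on {a..b} (\<lambda>t. inverse (\<phi> t))"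
      using lip_primitive_continuous[OF assms(1)] assms(2) by (intro continuous_intros) auto
    obtain P where P: "P > 0" "\<And>t. t \<in> {a..b} \<Longrightarrow> \<bar>inverse (\<phi> t)\<bar> \<le> P"
      using continuous_on_Icc_bounded[OF c] by auto
    have "(P * P)-lipschitz_on (\<phi> ` {a..b}) inverse"
    proof (rule lipschitz_onI, clarify)
      fix s t assume st: "s \<in> {a..b}" "t \<in> {a..b}"
      have "dist (inverse (\<phi> s)) (inverse (\<phi> t)) = \<bar>inverse (\<phi> s)\<bar> * \<bar>inverse (\<phi> t)\<bar> * dist (\<phi> s) (\<phi> t)"
        using assms(2)[OF st(1)] assms(2)[OF st(2)]
        by (simp add: dist_real_def field_simps flip: abs_mult)
      also have "\<dots> \<le> P * P * dist (\<phi> s) (\<phi> t)"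
        using P st by (intro mult_right_mono mult_mono) auto
      finally show "dist (inverse (\<phi> s)) (inverse (\<phi> t)) \<le> P * P * dist (\<phi> s) (\<phi> t)" .
    qed (use P in auto)
    thus "\<exists>L. L-lipschitz_on (\<phi> ` {a..b}) inverse" ..
  qed (use assms(2) in \<open>auto intro!: has_derivative_inverse'\<close>)
  thus ?thesis
    by (rule lip_primitive_cong) (auto simp: field_simps power2_eq_square)
qed

lemma lip_primitive_integral_le:
  fixes \<phi> :: "real \<Rightarrow> real"
  assumes "lip_primitive a b \<phi> \<phi>'" "a \<le> b" "h integrable_on {a..b}" "\<And>t. t \<in> {a..b} \<Longrightarrow> h t \<le> \<phi>' t"
  shows "integral {a..b} h \<le> \<phi> b - \<phi> a"
  using has_integral_le[OF integrable_integral[OF assms(3)] lip_primitive_integral[OF assms(1,2)] assms(4)] .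

lemma lip_primitive_le:
  fixes \<phi> :: "real \<Rightarrow> real"
  assumes "lip_primitive a b \<phi> \<phi>'" "a \<le> b" "\<And>t. t \<in> {a..b} \<Longrightarrow> \<phi>' t \<le> C"
  shows "\<phi> b \<le> \<phi> a + C * (b - a)"
  using has_integral_le[OF lip_primitive_integral[OF assms(1,2)] has_integral_const_real[of C] assms(3)] assms(2)
  by (simp add: mult.commute)

section \<open>Differential inequalities and Caratheodory solutions\<close>

text \<open>Lebesgue's differentiation theorem on the line. The proposition \<open>integrable_ccontinuous_explicit\<close> gives the right derivative
almost everywhere; applied to the reflected function it gives the left derivative.\<close>
lemma lip_primitive_indefinite_integral:
  fixes f :: "real \<Rightarrow> 'a::euclidean_space"
  assumes int: "f integrable_on {a..b}" and bd: "\<And>t. t \<in> {a..b} \<Longrightarrow> norm (f t) \<le> C"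
    and x: "\<And>t. t \<in> {a..b} \<Longrightarrow> x t = x a + integral {a..t} f"
  shows "lip_primitive a b x f"
  unfolding lip_primitive_def
proof
  have incr: "x t - x s = integral {s..t} f" if st: "s \<in> {a..b}" "t \<in> {a..b}" "s \<le> t" for s t
  proof -
    have "integral {a..s} f + integral {s..t} f = integral {a..t} f"
      using st by (intro Henstock_Kurzweil_Integration.integral_combine integrable_on_subinterval[OF int]) auto
    thus ?thesis unfolding x[OF st(1)] x[OF st(2)] by (simp add: algebra_simps)
  qed
  show "\<exists>L. L-lipschitz_on {a..b} x"
  proof (intro exI lipschitz_on_leI)
    fix s t assume st: "s \<in> {a..b}" "t \<in> {a..b}" "s \<le> t"
    have "(f has_integral integral {s..t} f) {s..t}"
      using st by (intro integrable_integral integrable_on_subinterval[OF int]) auto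
    hence "norm (integral {s..t} f) \<le> max C 0 * measure lborel {s..t}"
      by (rule has_integral_bound_real[of _ "{}", rotated 2]) (use bd st in \<open>auto intro: max.coboundedI1\<close>)
    thus "dist (x s) (x t) \<le> max C 0 * dist s t"
      using st incr[OF st] by (simp add: dist_norm norm_minus_commute[of "x s"])
  qed simp
next
  define f0 where "f0 t = (if t \<in> {a..b} then f t else 0)" for t
  have f0: "f0 integrable_on UNIV"
    unfolding f0_def using int by (simp only: integrable_restrict_UNIV)
  have f0c: "f0 integrable_on cbox u v" for u v
    by (rule integrable_on_subcbox[OF f0]) simp
  have f0r: "(\<lambda>t. f0 (- t)) integrable_on cbox u v" for u v
    using f0c[of "- v" "- u"] integrable_reflect[of f0 "- u" "- v"] by simp
  obtain N1 where N1: "negligible N1" "\<And>x e. \<lbrakk>x \<notin> N1; 0 < e\<rbrakk> \<Longrightarrow> \<exists>d>0. \<forall>h. 0 < h \<and> h < d \<longrightarrow>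
      norm (integral (cbox x (x + h *\<^sub>R One)) f0 /\<^sub>R h ^ DIM(real) - f0 x) < e"
    using integrable_ccontinuous_explicit[OF f0c] by blast
  obtain N2 where N2: "negligible N2" "\<And>x e. \<lbrakk>x \<notin> N2; 0 < e\<rbrakk> \<Longrightarrow> \<exists>d>0. \<forall>h. 0 < h \<and> h < d \<longrightarrow>
      norm (integral (cbox x (x + h *\<^sub>R One)) (\<lambda>t. f0 (- t)) /\<^sub>R h ^ DIM(real) - f0 (- x)) < e"
    using integrable_ccontinuous_explicit[OF f0r] by blast
  have incr: "x t - x s = integral {s..t} f0" if st: "s \<in> {a..b}" "t \<in> {a..b}" "s \<le> t" for s t
  proof -
    have "integral {a..s} f + integral {s..t} f = integral {a..t} f"
      using st by (intro Henstock_Kurzweil_Integration.integral_combine integrable_on_subinterval[OF int]) auto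
    moreover have "integral {s..t} f = integral {s..t} f0"
      by (rule integral_cong) (use st in \<open>auto simp: f0_def\<close>)
    ultimately show ?thesis unfolding x[OF st(1)] x[OF st(2)] by (simp add: algebra_simps)
  qed
  show "AE t in lebesgue. t \<in> {a..b} \<longrightarrow> (x has_vector_derivative f t) (at t within {a..b})"
  proof (rule AE_lebesgue_I)
    show "negligible (N1 \<union> uminus ` N2)"
      using N1(1) N2(1)
      by (intro negligible_Un negligible_differentiable_image_negligible)
        (auto intro!: differentiable_on_minus differentiable_on_ident)
    fix t assume tN: "t \<notin> N1 \<union> uminus ` N2"
    hence t1: "t \<notin> N1" and t2: "- t \<notin> N2" by (auto simp: image_iff)
    show "t \<in> {a..b} \<longrightarrow> (x has_vector_derivative f t) (at t within {a..b})"
      unfolding has_vector_derivative_def has_derivative_within_alt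
    proof (intro impI conjI allI)
      show "bounded_linear (\<lambda>h. h *\<^sub>R f t)" by (rule bounded_linear_scaleR_left)
      fix e :: real assume t: "t \<in> {a..b}" and e: "e > 0"
      obtain d1 where d1: "d1 > 0" "\<And>h. 0 < h \<Longrightarrow> h < d1 \<Longrightarrow> norm (integral {t..t + h} f0 /\<^sub>R h - f t) < e"
        using N1(2)[OF t1 e] t by (auto simp: f0_def)
      obtain d2 where d2: "d2 > 0" "\<And>h. 0 < h \<Longrightarrow> h < d2 \<Longrightarrow> norm (integral {- t..- t + h} (\<lambda>t. f0 (- t)) /\<^sub>R h - f t) < e"
        using N2(2)[OF t2 e] t by (auto simp: f0_def)
      have scale: "norm (I - h *\<^sub>R f t) \<le> e * h" if h: "h > 0" and I: "norm (I /\<^sub>R h - f t) < e" for I h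
      proof -
        have "I - h *\<^sub>R f t = h *\<^sub>R (I /\<^sub>R h - f t)" using h by (simp add: algebra_simps)
        also have "norm \<dots> = h * norm (I /\<^sub>R h - f t)" using h by simp
        also have "\<dots> \<le> h * e" using h I by (intro mult_left_mono) auto
        finally show ?thesis by (simp add: mult.commute)
      qed
      show "\<exists>d>0. \<forall>y\<in>{a..b}. norm (y - t) < d \<longrightarrow> norm (x y - x t - (y - t) *\<^sub>R f t) \<le> e * norm (y - t)"
      proof (intro exI[of _ "min d1 d2"] conjI ballI impI)
        fix y assume y: "y \<in> {a..b}" and yd: "norm (y - t) < min d1 d2"
        consider "y = t" | "y > t" | "y < t" by linarith
        thus "norm (x y - x t - (y - t) *\<^sub>R f t) \<le> e * norm (y - t)"
        proof cases
          case 2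
          thus ?thesis using scale[OF _ d1(2)[of "y - t"]] yd incr[OF t y] by simp
        next
          case 3
          have "integral {- t..- t + (t - y)} (\<lambda>t. f0 (- t)) = x t - x y"
            using integral_reflect_real[of t y f0] incr[OF y t] 3 by simp
          hence "norm (x t - x y - (t - y) *\<^sub>R f t) \<le> e * (t - y)"
            using scale[OF _ d2(2)[of "t - y"]] yd 3 by simp
          moreover have "x y - x t - (y - t) *\<^sub>R f t = - (x t - x y - (t - y) *\<^sub>R f t)"
            by (simp add: algebra_simps)
          ultimately show ?thesis using 3 by (metis abs_of_pos diff_gt_0_iff_gt norm_minus_commute norm_minus_cancel real_norm_def)
        qed simp
      qed (use d1 d2 in simp)
    qed
  qed
qed

text \<open>A bound that improves itself cannot be violated: at the first time at which the value \<open>q\<close> is attained the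
weak inequality holds up to that time, hence the strict one holds there too.\<close>
lemma continuous_bootstrap:
  fixes \<phi> :: "real \<Rightarrow> real"
  assumes cont: "continuous_on {0..b} \<phi>" and start: "\<phi> 0 < q"
    and step: "\<And>t. t \<in> {0..b} \<Longrightarrow> (\<And>s. s \<in> {0..t} \<Longrightarrow> \<phi> s \<le> q) \<Longrightarrow> \<phi> t < q"
    and t: "t \<in> {0..b}"
  shows "\<phi> t < q"
proof (rule ccontr)
  assume "\<not> \<phi> t < q"
  hence tq: "\<phi> t \<ge> q" by simp
  define S where "S = {s \<in> {0..t}. \<phi> s = q}"
  have hit: "\<exists>s\<in>{0..r}. \<phi> s = q" if r: "r \<in> {0..b}" "\<phi> r \<ge> q" for r
  proof -
    have "continuous_on {0..r} \<phi>" using cont by (rule continuous_on_subset) (use r in auto)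
    from IVT'[OF less_imp_le[OF start] r(2) _ this] r(1) show ?thesis by auto
  qed
  have "closed S" unfolding S_def
    by (rule continuous_closed_preimage_constant) (use t in \<open>auto intro: continuous_on_subset[OF cont]\<close>)
  moreover have ne: "S \<noteq> {}" using hit[OF t tq] by (auto simp: S_def)
  moreover have bd: "bdd_below S" by (auto simp: S_def)
  ultimately have "Inf S \<in> S" by (intro closed_contains_Inf)
  hence I: "Inf S \<in> {0..t}" "\<phi> (Inf S) = q" by (auto simp: S_def)
  have "\<phi> s \<le> q" if s: "s \<in> {0..Inf S}" for s
  proof (rule ccontr)
    assume "\<not> \<phi> s \<le> q"
    hence sq: "q < \<phi> s" by simp
    then obtain r where r: "r \<in> {0..s}" "\<phi> r = q" using hit[of s] s I t by auto
    hence "r \<in> S" using s I by (auto simp: S_def)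
    hence "Inf S \<le> r" using bd by (rule cInf_lower)
    hence "r = s" using r s by auto
    thus False using r sq by simp
  qed
  hence "\<phi> (Inf S) < q" by (intro step) (use I t in auto)
  thus False using I by simp
qed

text \<open>The square of the norm is used because it is differentiable also where \<open>e\<close> vanishes.\<close>
lemma gronwall:
  assumes e: "lip_primitive a b e e'" and L: "L \<ge> 0" "c \<ge> 0"
    and bd: "\<And>t. t \<in> {a..b} \<Longrightarrow> norm (e' t) \<le> L * norm (e t) + c"
    and t: "t \<in> {a..b}"
  shows "(norm (e t))\<^sup>2 \<le> exp ((2 * L + 1) * (t - a)) * ((norm (e a))\<^sup>2 + c\<^sup>2 * (t - a))"
proof -
  define M where "M = 2 * L + 1"
  define w where "w s = exp (- (M * (s - a)))" for s
  have w: "lip_primitive a b w (\<lambda>s. - M * w s)"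
    unfolding w_def by (rule lip_primitive_C1) (auto intro!: continuous_intros derivative_eq_intros simp flip: has_real_derivative_iff_has_vector_derivative)
  have P: "lip_primitive a b (\<lambda>s. w s * (e s \<bullet> e s)) (\<lambda>s. w s * (e s \<bullet> e' s + e' s \<bullet> e s) + (- M * w s) * (e s \<bullet> e s))"
    by (rule lip_primitive_mult[OF w lip_primitive_inner[OF e e]])
  have ae: "w s * (e s \<bullet> e' s + e' s \<bullet> e s) + (- M * w s) * (e s \<bullet> e s) \<le> c\<^sup>2" if s: "s \<in> {a..t}" for s
  proof -
    have sb: "norm (e' s) \<le> L * norm (e s) + c" using bd s t by auto
    have M: "M \<ge> 0" using L by (simp add: M_def)
    have w1: "0 < w s" "w s \<le> 1" using s M by (auto simp: w_def)
    have "e s \<bullet> e' s \<le> norm (e s) * norm (e' s)" by (rule norm_cauchy_schwarz)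
    also have "\<dots> \<le> norm (e s) * (L * norm (e s) + c)" using sb by (intro mult_left_mono) auto
    finally have A: "e s \<bullet> e' s \<le> L * (norm (e s))\<^sup>2 + norm (e s) * c" by (simp add: power2_eq_square algebra_simps)
    have "2 * (norm (e s) * c) \<le> (norm (e s))\<^sup>2 + c\<^sup>2" using sum_squares_bound[of "norm (e s)" c] by simp
    hence "2 * (e s \<bullet> e' s) \<le> M * (norm (e s))\<^sup>2 + c\<^sup>2" using A by (simp add: M_def algebra_simps)
    hence "w s * (2 * (e s \<bullet> e' s) - M * (norm (e s))\<^sup>2) \<le> w s * c\<^sup>2"
      using w1 by (intro mult_left_mono) auto
    also have "\<dots> \<le> c\<^sup>2" using w1 by (simp add: mult_left_le_one_le)
    finally show ?thesis
      by (simp add: power2_norm_eq_inner inner_commute algebra_simps)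
  qed
  have "w t * (e t \<bullet> e t) \<le> w a * (e a \<bullet> e a) + c\<^sup>2 * (t - a)"
    by (rule lip_primitive_le[OF lip_primitive_subset[OF P] _ ae]) (use t in auto)
  hence "exp (M * (t - a)) * (w t * (e t \<bullet> e t)) \<le> exp (M * (t - a)) * ((e a \<bullet> e a) + c\<^sup>2 * (t - a))"
    by (intro mult_left_mono) (auto simp: w_def)
  moreover have "exp (M * (t - a)) * w t = 1" by (simp add: w_def flip: exp_add)
  ultimately have "e t \<bullet> e t \<le> exp (M * (t - a)) * ((e a \<bullet> e a) + c\<^sup>2 * (t - a))"
    by (simp flip: mult.assoc)
  thus ?thesis by (simp add: M_def power2_norm_eq_inner)
qed

text \<open>The Lipschitz rate \<open>m\<close> may be unbounded near the end points, only its primitive \<open>M\<close> has to be continuous; this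
covers the rate \<open>1 / sqrt s\<close> of the adjoint system. The weight \<open>exp (2 * M)\<close> makes
the integral operator a contraction on the whole interval at once.\<close>
lemma caratheodory_existence:
  fixes F :: "real \<Rightarrow> 'a::euclidean_space \<Rightarrow> 'a"
  assumes T: "0 \<le> T" and x0: "continuous_on {0..T} x0"
    and int: "\<And>x. continuous_on {0..T} x \<Longrightarrow> (\<lambda>s. F s (x s)) integrable_on {0..T}"
    and lip: "\<And>s x y. s \<in> {0..T} \<Longrightarrow> norm (F s x - F s y) \<le> m s * norm (x - y)"
    and m: "\<And>s. s \<in> {0..T} \<Longrightarrow> 0 \<le> m s"
    and M: "continuous_on {0..T} M" "\<And>s. s \<in> {0<..<T} \<Longrightarrow> (M has_real_derivative m s) (at s)"
  obtains x where "continuous_on {0..T} x"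
    "\<And>t. t \<in> {0..T} \<Longrightarrow> x t = x0 t + integral {0..t} (\<lambda>s. F s (x s))"
proof -
  define cl where "cl t = max 0 (min T t)" for t
  have cl: "cl t \<in> {0..T}" "continuous_on UNIV cl" for t
    using T by (auto simp: cl_def intro!: continuous_intros)
  have cl_id: "cl t = t" if "t \<in> {0..T}" for t using that by (auto simp: cl_def)
  define E where "E t = exp (2 * M t)" for t
  have E: "continuous_on {0..T} E" "\<And>t. E t > 0" using M(1) by (auto simp: E_def intro!: continuous_intros)
  define X where "X z s = E s *\<^sub>R apply_bcontfun z s" for z :: "real \<Rightarrow>\<^sub>C 'a" and s
  have X: "continuous_on {0..T} (X z)" for z
    unfolding X_def by (intro continuous_intros E continuous_on_apply_bcontfun)
  have FX: "(\<lambda>s. F s (X z s)) integrable_on {0..t}" if "t \<in> {0..T}" for z t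
    by (rule integrable_on_subinterval[OF int[OF X]]) (use that in auto)
  define \<Phi> where "\<Phi> z t = inverse (E t) *\<^sub>R (x0 t + integral {0..t} (\<lambda>s. F s (X z s)))" for z t
  have cont: "continuous_on {0..T} (\<Phi> z)" for z
    unfolding \<Phi>_def using E(2)
    by (intro continuous_intros E x0 indefinite_integral_continuous_1 int X) (simp add: less_imp_neq[symmetric])
  have "(\<lambda>t. \<Phi> z (cl t)) \<in> bcontfun" for z
    unfolding bcontfun_def
  proof safe
    show "continuous_on UNIV (\<lambda>t. \<Phi> z (cl t))"
      by (rule continuous_on_compose2[OF cont cl(2)]) (use cl(1) in auto)
    have "bounded (\<Phi> z ` {0..T})" by (intro compact_imp_bounded compact_continuous_image cont compact_Icc)
    thus "bounded (range (\<lambda>t. \<Phi> z (cl t)))" by (rule bounded_subset) (use cl(1) in auto)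
  qed
  hence opz: "apply_bcontfun (Bcontfun (\<lambda>t. \<Phi> z (cl t))) t = \<Phi> z (cl t)" for z t
    by (simp add: Bcontfun_inverse)
  have "\<exists>!z. Bcontfun (\<lambda>t. \<Phi> z (cl t)) = z"
  proof (rule banach_fix_type)
    show "\<forall>z z'. dist (Bcontfun (\<lambda>t. \<Phi> z (cl t))) (Bcontfun (\<lambda>t. \<Phi> z' (cl t))) \<le> 1 / 2 * dist z z'"
    proof (intro allI dist_bound)
      fix z z' :: "real \<Rightarrow>\<^sub>C 'a" and u
      define t where "t = cl u"
      have t: "t \<in> {0..T}" using cl(1) by (simp add: t_def)
      define D where "D = dist z z'"
      have D0: "D \<ge> 0" by (simp add: D_def)
      have dE: "((\<lambda>s. D * E s / 2) has_vector_derivative m s * (E s * D)) (at s)" if "s \<in> {0<..<t}" for s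
        unfolding E_def has_real_derivative_iff_has_vector_derivative[symmetric] using t that
        by (auto intro!: derivative_eq_intros M(2))
      have I: "((\<lambda>s. m s * (E s * D)) has_integral D * E t / 2 - D * E 0 / 2) {0..t}"
        using t by (intro fundamental_theorem_of_calculus_interior dE)
          (auto intro!: continuous_intros continuous_on_subset[OF E(1)])
      have "norm (integral {0..t} (\<lambda>s. F s (X z s) - F s (X z' s))) \<le> integral {0..t} (\<lambda>s. m s * (E s * D))"
      proof (rule integral_norm_bound_integral)
        show "(\<lambda>s. F s (X z s) - F s (X z' s)) integrable_on {0..t}"
          using FX[OF t] FX[OF t] by (rule integrable_diff)
        fix s assume "s \<in> {0..t}"
        hence s: "s \<in> {0..T}" using t by auto
        have "norm (F s (X z s) - F s (X z' s)) \<le> m s * norm (X z s - X z' s)" by (rule lip[OF s])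
        also have "norm (X z s - X z' s) = E s * dist (apply_bcontfun z s) (apply_bcontfun z' s)"
          using E(2)[of s] by (simp add: X_def dist_norm flip: scaleR_diff_right)
        also have "m s * \<dots> \<le> m s * (E s * D)"
          using m[OF s] less_imp_le[OF E(2)[of s]] dist_bounded[of z s z'] by (intro mult_left_mono) (auto simp: D_def)
        finally show "norm (F s (X z s) - F s (X z' s)) \<le> m s * (E s * D)" .
      qed (use I in blast)
      also have "\<dots> = D * E t / 2 - D * E 0 / 2" using I by (rule integral_unique)
      also have "\<dots> \<le> E t * (D / 2)" using D0 E(2)[of 0] by simp
      finally have "norm (integral {0..t} (\<lambda>s. F s (X z s)) - integral {0..t} (\<lambda>s. F s (X z' s))) \<le> E t * (D / 2)"
        by (simp add: integral_diff[OF FX[OF t] FX[OF t]])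
      hence "inverse (E t) * norm (integral {0..t} (\<lambda>s. F s (X z s)) - integral {0..t} (\<lambda>s. F s (X z' s))) \<le> D / 2"
        using E(2)[of t] by (simp add: field_simps)
      moreover have "dist (\<Phi> z t) (\<Phi> z' t) = inverse (E t) * norm (integral {0..t} (\<lambda>s. F s (X z s)) - integral {0..t} (\<lambda>s. F s (X z' s)))"
        using E(2)[of t] by (simp add: \<Phi>_def dist_norm flip: scaleR_diff_right)
      ultimately show "dist (apply_bcontfun (Bcontfun (\<lambda>t. \<Phi> z (cl t))) u) (apply_bcontfun (Bcontfun (\<lambda>t. \<Phi> z' (cl t))) u) \<le> 1 / 2 * dist z z'"
        unfolding opz t_def[symmetric] D_def by simp
    qed
  qed auto
  then obtain z where z: "Bcontfun (\<lambda>t. \<Phi> z (cl t)) = z" by blast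
  have "X z t = x0 t + integral {0..t} (\<lambda>s. F s (X z s))" if t: "t \<in> {0..T}" for t
  proof -
    have "apply_bcontfun z t = \<Phi> z t" using opz[of z t] z cl_id[OF t] by simp
    thus ?thesis using E(2)[of t] by (simp add: X_def \<Phi>_def)
  qed
  thus ?thesis using X that by blast
qed

section \<open>The radial vector field and its first-order remainder\<close>

lemma f2_eq: "f2 y = (1 / (1 - norm y)) *\<^sub>R y"
  by (simp add: f2_def vec_eq_iff)

text \<open>The Jacobian of \<open>f2\<close>, applied to a vector. It is symmetric since \<open>f2\<close> is the gradient of a radial function, so
\<open>deriv_matrix\<close> and its transpose agree.\<close>
definition f2_jac :: "real^2 \<Rightarrow> real^2 \<Rightarrow> real^2" where
  "f2_jac y h = (1 / (1 - norm y)) *\<^sub>R h + ((y \<bullet> h) / (norm y * (1 - norm y)\<^sup>2)) *\<^sub>R y"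

lemma deriv_matrix_f2:
  assumes "norm y \<noteq> 1" "y \<noteq> 0"
  shows "deriv_matrix f2 y *v h = f2_jac y h"
proof -
  define r where "r = norm y"
  have r: "r \<noteq> 0" "1 - r \<noteq> 0" using assms by (auto simp: r_def)
  have D: "deriv_matrix f2 y $ i $ j = (if i = j then 1 else 0) / (1 - r) + y $ i * y $ j / (r * (1 - r)\<^sup>2)" for i j
  proof -
    have n: "((\<lambda>s. norm (y + s *\<^sub>R axis i 1)) has_real_derivative (y $ i / r)) (at 0)"
    proof -
      have "((\<lambda>s. y + s *\<^sub>R axis i (1::real)) has_derivative (\<lambda>s. s *\<^sub>R axis i 1)) (at 0)"
        by (auto intro!: derivative_eq_intros)
      moreover have "(norm has_derivative (\<lambda>h. h \<bullet> sgn y)) (at (y + 0 *\<^sub>R axis i (1::real)))"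
        using has_derivative_norm[OF assms(2)] by simp
      ultimately have "((\<lambda>s. norm (y + s *\<^sub>R axis i (1::real))) has_derivative (\<lambda>s. (s *\<^sub>R axis i 1) \<bullet> sgn y)) (at 0)"
        by (rule has_derivative_compose)
      moreover have "(\<lambda>s. (s *\<^sub>R axis i 1) \<bullet> sgn y) = (*) (y $ i / r)"
        by (auto simp: fun_eq_iff sgn_div_norm inner_axis' r_def field_simps)
      ultimately show ?thesis unfolding has_field_derivative_def by simp
    qed
    have c: "((\<lambda>s. (y + s *\<^sub>R axis i 1) $ j) has_real_derivative (if i = j then 1 else 0)) (at 0)"
      by (cases "i = j") (auto simp: axis_def intro!: derivative_eq_intros)
    have "((\<lambda>s. f2 (y + s *\<^sub>R axis i 1) $ j) has_real_derivative
        ((if i = j then 1 else 0) * (1 - r) - y $ j * (0 - y $ i / r)) / ((1 - r) * (1 - r))) (at 0)"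
      unfolding f2_def vec_lambda_beta
      using DERIV_divide[OF c DERIV_diff[OF DERIV_const[of 1] n]] r by (simp add: r_def)
    hence "deriv_matrix f2 y $ i $ j = ((if i = j then 1 else 0) * (1 - r) - y $ j * (0 - y $ i / r)) / ((1 - r) * (1 - r))"
      by (simp add: deriv_matrix_def DERIV_imp_deriv)
    also have "\<dots> = (if i = j then 1 else 0) / (1 - r) + y $ i * y $ j / (r * (1 - r)\<^sup>2)"
      using r by (auto simp: divide_simps power2_eq_square)
    finally show ?thesis .
  qed
  have "(deriv_matrix f2 y *v h) $ i = f2_jac y h $ i" for i
  proof -
    have "(deriv_matrix f2 y *v h) $ i = (\<Sum>j\<in>UNIV. (if i = j then h $ j / (1 - r) else 0) + (y $ j * h $ j) * (y $ i / (r * (1 - r)\<^sup>2)))"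
      unfolding matrix_vector_mult_def vec_lambda_beta D
      by (rule sum.cong) (auto simp: algebra_simps)
    also have "\<dots> = h $ i / (1 - r) + (y \<bullet> h) * (y $ i / (r * (1 - r)\<^sup>2))"
      by (simp add: sum.distrib inner_vec_def sum_distrib_right sum_divide_distrib)
    finally show ?thesis by (simp add: f2_jac_def r_def)
  qed
  thus ?thesis by (simp add: vec_eq_iff)
qed

lemma f2_lipschitz:
  assumes "\<delta> > 0" "\<delta> \<le> \<bar>1 - norm y\<bar>" "\<delta> \<le> \<bar>1 - norm z\<bar>" "norm y \<le> R"
  shows "norm (f2 z - f2 y) \<le> (1 / \<delta> + R / \<delta>\<^sup>2) * norm (z - y)"
proof -
  define r s where "r = norm y" and "s = norm z"
  have nz: "1 - r \<noteq> 0" "1 - s \<noteq> 0" using assms by (auto simp: r_def s_def)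
  have "f2 z - f2 y = (1 / (1 - s)) *\<^sub>R (z - y) + ((s - r) / ((1 - s) * (1 - r))) *\<^sub>R y"
  proof -
    have "(s - r) / ((1 - s) * (1 - r)) = 1 / (1 - s) - 1 / (1 - r)" using nz by (simp add: field_simps)
    thus ?thesis by (simp add: f2_eq scaleR_diff_left scaleR_diff_right flip: r_def s_def)
  qed
  also have "norm \<dots> \<le> \<bar>1 / (1 - s)\<bar> * norm (z - y) + \<bar>(s - r) / ((1 - s) * (1 - r))\<bar> * r"
    by (rule norm_triangle_le) (simp add: r_def)
  also have "\<dots> \<le> (1 / \<delta>) * norm (z - y) + (norm (z - y) / \<delta>\<^sup>2) * R"
  proof (intro add_mono mult_right_mono mult_mono)
    show "\<bar>1 / (1 - s)\<bar> \<le> 1 / \<delta>" using assms by (simp add: s_def frac_le)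
    have "\<bar>s - r\<bar> \<le> norm (z - y)" unfolding r_def s_def by (rule norm_triangle_ineq3)
    moreover have "\<delta>\<^sup>2 \<le> \<bar>1 - s\<bar> * \<bar>1 - r\<bar>"
      unfolding power2_eq_square using assms by (intro mult_mono) (auto simp: r_def s_def)
    ultimately show "\<bar>(s - r) / ((1 - s) * (1 - r))\<bar> \<le> norm (z - y) / \<delta>\<^sup>2"
      using assms by (simp add: abs_mult frac_le)
  qed (use assms in \<open>auto simp: r_def\<close>)
  finally show ?thesis by (simp add: field_simps)
qed

text \<open>A globally Lipschitz field that agrees with \<open>f2\<close> where the distance to the circle, measured on the side \<open>\<sigma>\<close>, is at
least \<open>\<delta>\<close>. It provides global solutions from which the trajectories are cut out.\<close>
definition f2_cut :: "real \<Rightarrow> real \<Rightarrow> real^2 \<Rightarrow> real^2" where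
  "f2_cut \<sigma> \<delta> y = (\<sigma> / max \<delta> (\<sigma> * (1 - norm y))) *\<^sub>R y"

lemma f2_cut_eq:
  assumes "\<sigma> \<in> {-1, 1}" "\<delta> > 0" "\<delta> \<le> \<sigma> * (1 - norm y)"
  shows "f2_cut \<sigma> \<delta> y = f2 y"
  using assms by (auto simp: f2_cut_def f2_eq max_absorb2 minus_divide_right)

text \<open>The increment of the scalar factor is multiplied by the smaller of the two norms. Where this factor
varies, that norm is at most \<open>1\<close> plus the denominator; elsewhere the factor is constant.\<close>
lemma f2_cut_lipschitz:
  assumes \<sigma>: "\<sigma> \<in> {-1, 1}" and \<delta>: "\<delta> > 0"
  shows "norm (f2_cut \<sigma> \<delta> z - f2_cut \<sigma> \<delta> y) \<le> (2 / \<delta> + 1 / \<delta>\<^sup>2) * norm (z - y)"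
proof -
  have main: "norm (f2_cut \<sigma> \<delta> z - f2_cut \<sigma> \<delta> y) \<le> (2 / \<delta> + 1 / \<delta>\<^sup>2) * norm (z - y)"
    if le: "norm y \<le> norm z" for y z
  proof -
    define m where "m x = max \<delta> (\<sigma> * (1 - norm x))" for x :: "real^2"
    have m: "\<delta> \<le> m x" "m x > 0" for x using \<delta> by (auto simp: m_def)
    have m_lip: "\<bar>m y - m z\<bar> \<le> norm (z - y)"
      using \<sigma> norm_triangle_ineq3[of z y] by (auto simp: m_def max_def abs_if split: if_splits)
    have grow: "norm y \<le> 1 + m y" if "m y \<noteq> m z"
      using \<sigma> \<delta> le that by (auto simp: m_def max_def split: if_splits)
    have key: "norm y * \<bar>m y - m z\<bar> \<le> (1 + m y) * norm (z - y)"
    proof (cases "m y = m z")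
      case True thus ?thesis using m(2)[of y] by simp
    next
      case False
      thus ?thesis using grow m_lip m(2)[of y] by (intro mult_mono) auto
    qed
    have "f2_cut \<sigma> \<delta> z - f2_cut \<sigma> \<delta> y = (\<sigma> / m z) *\<^sub>R (z - y) + (\<sigma> * (m y - m z) / (m y * m z)) *\<^sub>R y"
    proof -
      have "\<sigma> * (m y - m z) / (m y * m z) = \<sigma> / m z - \<sigma> / m y" using m(2)[of y] m(2)[of z] by (simp add: field_simps)
      thus ?thesis unfolding f2_cut_def m_def[symmetric] by (simp add: scaleR_diff_left scaleR_diff_right)
    qed
    also have "norm \<dots> \<le> \<bar>\<sigma> / m z\<bar> * norm (z - y) + \<bar>\<sigma> * (m y - m z) / (m y * m z)\<bar> * norm y"
      by (rule norm_triangle_le) simp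
    also have "\<dots> = norm (z - y) / m z + (norm y * \<bar>m y - m z\<bar>) / (m y * m z)"
      using \<sigma> m(2)[of y] m(2)[of z] by (auto simp: abs_mult)
    also have "\<dots> \<le> norm (z - y) / m z + ((1 + m y) * norm (z - y)) / (m y * m z)"
      using key m(2)[of y] m(2)[of z] by (intro add_left_mono divide_right_mono) auto
    also have "\<dots> = (2 / m z + 1 / (m y * m z)) * norm (z - y)"
      using m(2)[of y] m(2)[of z] by (simp add: field_simps)
    also have "\<dots> \<le> (2 / \<delta> + 1 / \<delta>\<^sup>2) * norm (z - y)"
      unfolding power2_eq_square using m \<delta>
      by (intro mult_right_mono add_mono frac_le mult_mono) (auto intro: less_imp_le)
    finally show ?thesis .
  qed
  show ?thesis
  proof (cases "norm y \<le> norm z")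
    case True
    thus ?thesis by (rule main)
  next
    case False
    thus ?thesis using main[of z y] by (simp add: norm_minus_commute)
  qed
qed

definition f2_rem :: "real^2 \<Rightarrow> real^2 \<Rightarrow> real^2" where
  "f2_rem y z = f2 z - f2 y - f2_jac y (z - y)"

text \<open>The remainder in exact form. Every term on the right is of second order: the last one measures the angle
between \<open>y\<close> and \<open>z\<close>, since \<open>norm z - (y \<bullet> z) / norm y\<close> is \<open>norm z\<close> times one minus the cosine.\<close>
lemma f2_rem_identity:
  assumes "y \<noteq> 0" "norm y \<noteq> 1" "norm z \<noteq> 1"
  shows "(1 - norm y)\<^sup>2 * (\<psi> \<bullet> f2_rem y z) =
    (\<psi> \<bullet> z) * (norm z - norm y)\<^sup>2 / (1 - norm z) + (\<psi> \<bullet> (z - y)) * (norm z - norm y)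
      + (\<psi> \<bullet> y) * (norm z - (y \<bullet> z) / norm y)"
proof -
  define r a b where "r = norm y" and "a = 1 - norm y" and "b = 1 - norm z"
  have nz: "r \<noteq> 0" "a \<noteq> 0" "b \<noteq> 0" using assms by (auto simp: r_def a_def b_def)
  have rel: "r = 1 - a" "norm z = 1 - b" "norm z - norm y = a - b" by (auto simp: r_def a_def b_def)
  have yy: "y \<bullet> y = r * r" by (simp add: r_def dot_square_norm power2_eq_square)
  define p w c where "p = \<psi> \<bullet> z" and "w = \<psi> \<bullet> y" and "c = y \<bullet> z"
  have "\<psi> \<bullet> f2_rem y z = p / b - w / a - ((p - w) / a + (c - r * r) / (r * a\<^sup>2) * w)"
    unfolding f2_rem_def f2_eq f2_jac_def a_def[symmetric] b_def[symmetric]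
    unfolding r_def[symmetric]
    by (simp add: inner_diff_right inner_scaleR_right inner_add_right yy p_def w_def c_def)
  also have "a\<^sup>2 * \<dots> = p * (a - b)\<^sup>2 / b + (p - w) * (a - b) + w * ((1 - b) - c / r)"
  proof -
    have "a\<^sup>2 * (p / b - w / a - ((p - w) / a + (c - r * r) / (r * a\<^sup>2) * w))
        = p * (a * a / b) - p * a - (c / r - r) * w"
      using nz by (simp add: field_simps power2_eq_square)
    also have "a * a / b = (a - b)\<^sup>2 / b + 2 * a - b" using nz by (simp add: field_simps power2_eq_square)
    finally show ?thesis unfolding rel(1) by (simp add: algebra_simps)
  qed
  finally show ?thesis
    unfolding rel a_def[symmetric] b_def[symmetric] p_def w_def c_def r_def[symmetric]
    by (simp add: inner_diff_right rel)
qed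

lemma f2_rem_quadratic:
  assumes "y \<noteq> 0" "\<delta> > 0" "\<delta> \<le> \<bar>1 - norm y\<bar>" "\<delta> \<le> \<bar>1 - norm z\<bar>" "norm z \<le> R"
  shows "\<bar>\<psi> \<bullet> f2_rem y z\<bar> \<le> (R / \<delta> + 2) / \<delta>\<^sup>2 * norm \<psi> * (norm (z - y))\<^sup>2"
proof -
  define e where "e = norm (z - y)"
  define T where "T = (\<psi> \<bullet> z) * (norm z - norm y)\<^sup>2 / (1 - norm z) + (\<psi> \<bullet> (z - y)) * (norm z - norm y)
      + (\<psi> \<bullet> y) * (norm z - (y \<bullet> z) / norm y)"
  have y0: "norm y > 0" using assms by simp
  have R0: "R \<ge> 0" using assms(5) norm_ge_zero[of z] by linarith
  have X: "\<bar>norm z - norm y\<bar> \<le> e" unfolding e_def by (rule norm_triangle_ineq3)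
  have X2: "(norm z - norm y)\<^sup>2 \<le> e\<^sup>2" using X by (simp add: abs_le_square_iff[symmetric] e_def)
  have T1: "\<bar>(\<psi> \<bullet> z) * (norm z - norm y)\<^sup>2 / (1 - norm z)\<bar> \<le> (norm \<psi> * R) * e\<^sup>2 / \<delta>"
  proof -
    have "\<bar>\<psi> \<bullet> z\<bar> \<le> norm \<psi> * R"
      using Cauchy_Schwarz_ineq2[of \<psi> z] mult_left_mono[OF assms(5) norm_ge_zero[of \<psi>]] by linarith
    hence "\<bar>\<psi> \<bullet> z\<bar> * (norm z - norm y)\<^sup>2 \<le> (norm \<psi> * R) * e\<^sup>2"
      using X2 by (intro mult_mono) auto
    hence "\<bar>\<psi> \<bullet> z\<bar> * (norm z - norm y)\<^sup>2 / \<bar>1 - norm z\<bar> \<le> (norm \<psi> * R) * e\<^sup>2 / \<delta>"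
      using assms R0 by (intro frac_le) auto
    thus ?thesis by (simp add: abs_mult)
  qed
  have T2: "\<bar>(\<psi> \<bullet> (z - y)) * (norm z - norm y)\<bar> \<le> (norm \<psi> * e) * e"
    unfolding abs_mult using X Cauchy_Schwarz_ineq2[of \<psi> "z - y"]
    by (intro mult_mono) (auto simp: e_def)
  have T3: "\<bar>(\<psi> \<bullet> y) * (norm z - (y \<bullet> z) / norm y)\<bar> \<le> norm \<psi> * e\<^sup>2"
  proof -
    have ge: "0 \<le> norm z - (y \<bullet> z) / norm y"
      using norm_cauchy_schwarz[of y z] y0 by (simp add: divide_le_eq mult.commute)
    have "e\<^sup>2 = (norm z)\<^sup>2 + (norm y)\<^sup>2 - 2 * (y \<bullet> z)"
      unfolding e_def power2_norm_eq_inner by (simp add: inner_simps inner_commute)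
    moreover have "0 \<le> (norm z - norm y)\<^sup>2" by simp
    ultimately have le: "norm y * norm z - y \<bullet> z \<le> e\<^sup>2" 
      using norm_cauchy_schwarz[of y z] by (simp add: power2_diff algebra_simps)
    have "\<bar>(\<psi> \<bullet> y) * (norm z - (y \<bullet> z) / norm y)\<bar> \<le> (norm \<psi> * norm y) * (norm z - (y \<bullet> z) / norm y)"
      unfolding abs_mult using ge Cauchy_Schwarz_ineq2[of \<psi> y] by (intro mult_mono) auto
    also have "\<dots> = norm \<psi> * (norm y * norm z - y \<bullet> z)" using y0 by (simp add: field_simps)
    also have "\<dots> \<le> norm \<psi> * e\<^sup>2" using le by (intro mult_left_mono) auto
    finally show ?thesis .
  qed
  have "\<bar>T\<bar> \<le> (norm \<psi> * R) * e\<^sup>2 / \<delta> + norm \<psi> * e * e + norm \<psi> * e\<^sup>2"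
    unfolding T_def using T1 T2 T3 by linarith
  also have "\<dots> = (R / \<delta> + 2) * norm \<psi> * e\<^sup>2" using assms by (simp add: field_simps power2_eq_square)
  finally have T: "\<bar>T\<bar> \<le> (R / \<delta> + 2) * norm \<psi> * e\<^sup>2" .
  have id: "(1 - norm y)\<^sup>2 * (\<psi> \<bullet> f2_rem y z) = T"
    unfolding T_def by (rule f2_rem_identity) (use assms in auto)
  have d2: "\<delta>\<^sup>2 \<le> (1 - norm y)\<^sup>2" using assms by (simp add: abs_le_square_iff[symmetric])
  have "\<delta>\<^sup>2 * \<bar>\<psi> \<bullet> f2_rem y z\<bar> \<le> (1 - norm y)\<^sup>2 * \<bar>\<psi> \<bullet> f2_rem y z\<bar>"
    using d2 by (intro mult_right_mono) auto
  also have "\<dots> = \<bar>T\<bar>" unfolding id[symmetric] by (simp add: abs_mult)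
  finally have "\<delta>\<^sup>2 * \<bar>\<psi> \<bullet> f2_rem y z\<bar> \<le> (R / \<delta> + 2) * norm \<psi> * e\<^sup>2" using T by linarith
  thus ?thesis using assms(2) by (simp add: field_simps e_def)
qed

text \<open>One minus the cosine of the angle between \<open>y\<close> and \<open>z\<close>; in contrast to the angle it is a smooth function of
both arguments also where they are parallel.\<close>
definition angle_defect :: "real^2 \<Rightarrow> real^2 \<Rightarrow> real" where
  "angle_defect y z = 1 - (y \<bullet> z) / (norm y * norm z)"

lemma angle_defect_nonneg:
  assumes "y \<noteq> 0" "z \<noteq> 0"
  shows "0 \<le> angle_defect y z" "angle_defect y z \<le> 2"
proof -
  have "\<bar>(y \<bullet> z) / (norm y * norm z)\<bar> \<le> 1"
    using Cauchy_Schwarz_ineq2[of y z] assms by (simp add: abs_mult)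
  hence "(y \<bullet> z) / (norm y * norm z) \<le> 1" "- 1 \<le> (y \<bullet> z) / (norm y * norm z)" by linarith+
  thus "0 \<le> angle_defect y z" "angle_defect y z \<le> 2" by (auto simp: angle_defect_def)
qed

lemma norm_sgn_diff:
  assumes "y \<noteq> 0" "z \<noteq> 0"
  shows "(norm (sgn z - sgn y))\<^sup>2 = 2 * angle_defect y z"
proof -
  have "(norm (sgn z - sgn y))\<^sup>2 = (norm (sgn z))\<^sup>2 + (norm (sgn y))\<^sup>2 - 2 * (sgn y \<bullet> sgn z)"
    unfolding power2_norm_eq_inner by (simp add: inner_simps inner_commute)
  thus ?thesis using assms by (simp add: norm_sgn angle_defect_def sgn_div_norm field_simps)
qed

text \<open>If \<open>\<psi>\<close> is of the size of the gap and points at the circle as seen from \<open>z\<close>, then the radial second-order term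
\<open>(\<psi> \<bullet> sgn z) * (norm z - norm y)\<^sup>2 / (1 - norm z)\<close> is positive on both sides of the circle, because numerator and
denominator change sign together. Half of it absorbs the mixed term by Young's inequality; what is left
over is a multiple of the angular deviation.\<close>
lemma f2_rem_lower:
  assumes \<sigma>: "\<sigma> \<in> {-1, 1}" and nz: "y \<noteq> 0" "z \<noteq> 0"
    and d: "d = \<sigma> * (1 - norm y)" "0 < d" and a: "0 < \<sigma> * (1 - norm z)" "\<sigma> * (1 - norm z) \<le> D"
    and R: "norm y \<le> R" "norm z \<le> R"
    and \<psi>: "norm \<psi> \<le> c2 * d" and k: "c1 * d \<le> \<sigma> * (\<psi> \<bullet> sgn z)" and c1: "c1 > 0"
  shows "(c1 / (2 * D) * (norm z - norm y)\<^sup>2 - (R\<^sup>2 * c2\<^sup>2 * D / c1 + R\<^sup>2 * c2) * angle_defect y z) / d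
     \<le> \<psi> \<bullet> f2_rem y z"
proof -
  define r s X q where "r = norm y" and "s = norm z" and "X = norm z - norm y" and "q = angle_defect y z"
  have rs: "r > 0" "s > 0" using nz by (auto simp: r_def s_def)
  have ne: "norm y \<noteq> 1" "norm z \<noteq> 1" using d a by auto
  have D: "D > 0" using a by linarith
  have q: "0 \<le> q" using angle_defect_nonneg[OF nz] by (simp add: q_def)
  have c2d: "0 \<le> c2 * d" using \<psi> norm_ge_zero order_trans by blast
  hence c2: "0 \<le> c2" using d(2) by (simp add: zero_le_mult_iff)
  have R0: "R \<ge> 0" using R(1) norm_ge_zero order_trans by blast
  have sk: "z = s *\<^sub>R sgn z" and rn: "y = r *\<^sub>R sgn y" using nz by (auto simp: s_def r_def sgn_div_norm)
  have pz: "\<psi> \<bullet> z = s * (\<psi> \<bullet> sgn z)" and py: "\<psi> \<bullet> y = r * (\<psi> \<bullet> sgn y)"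
    by (subst sk, simp) (subst rn, simp)
  have qq: "s - (y \<bullet> z) / r = s * q" using rs by (simp add: q_def angle_defect_def r_def s_def field_simps)
  have s1: "1 - s \<noteq> 0" using ne by (simp add: s_def)
  have id: "d\<^sup>2 * (\<psi> \<bullet> f2_rem y z) = (\<psi> \<bullet> sgn z) * X\<^sup>2 / (1 - s) + r * X * (\<psi> \<bullet> (sgn z - sgn y)) + r * s * (\<psi> \<bullet> sgn y) * q"
  proof -
    have "d\<^sup>2 = (1 - norm y)\<^sup>2" unfolding d(1) using \<sigma> by (auto simp: power_mult_distrib)
    hence "d\<^sup>2 * (\<psi> \<bullet> f2_rem y z) = (s * (\<psi> \<bullet> sgn z)) * X\<^sup>2 / (1 - s) + (s * (\<psi> \<bullet> sgn z) - r * (\<psi> \<bullet> sgn y)) * X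
      + (r * (\<psi> \<bullet> sgn y)) * (s * q)"
      using f2_rem_identity[OF nz(1) ne, of \<psi>]
      unfolding inner_diff_right pz py X_def[symmetric]
      unfolding r_def[symmetric] s_def[symmetric] qq by simp
    also have "(s * (\<psi> \<bullet> sgn z)) * X\<^sup>2 / (1 - s) = (\<psi> \<bullet> sgn z) * X\<^sup>2 / (1 - s) - (\<psi> \<bullet> sgn z) * X\<^sup>2"
      using s1 by (simp add: field_simps)
    also have "X\<^sup>2 = X * (s - r)" by (simp add: X_def s_def r_def power2_eq_square)
    finally show ?thesis
      by (simp add: inner_diff_right algebra_simps X_def s_def r_def power2_eq_square)
  qed
  have T1: "c1 * d * X\<^sup>2 / D \<le> (\<psi> \<bullet> sgn z) * X\<^sup>2 / (1 - s)"
  proof -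
    have "(\<psi> \<bullet> sgn z) * X\<^sup>2 / (1 - s) = (\<sigma> * (\<psi> \<bullet> sgn z)) * X\<^sup>2 / (\<sigma> * (1 - s))"
      using \<sigma> by auto
    moreover have "c1 * d * X\<^sup>2 / D \<le> (\<sigma> * (\<psi> \<bullet> sgn z)) * X\<^sup>2 / (\<sigma> * (1 - s))"
    proof (rule frac_le)
      show "c1 * d * X\<^sup>2 \<le> \<sigma> * (\<psi> \<bullet> sgn z) * X\<^sup>2" using k by (intro mult_right_mono) auto
      have "0 \<le> c1 * d" using c1 d by simp
      hence "0 \<le> \<sigma> * (\<psi> \<bullet> sgn z)" using k by linarith
      thus "0 \<le> \<sigma> * (\<psi> \<bullet> sgn z) * X\<^sup>2" by (rule mult_nonneg_nonneg) simp
    qed (use a in \<open>auto simp: s_def\<close>)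
    ultimately show ?thesis by simp
  qed
  define Y where "Y = norm (sgn z - sgn y)"
  have Y: "Y\<^sup>2 = 2 * q" "Y \<ge> 0" using norm_sgn_diff[OF nz] by (auto simp: Y_def q_def)
  have T2: "- (d * (c1 / (2 * D) * X\<^sup>2 + R\<^sup>2 * c2\<^sup>2 * D / c1 * q)) \<le> r * X * (\<psi> \<bullet> (sgn z - sgn y))"
  proof -
    have "\<bar>r * X * (\<psi> \<bullet> (sgn z - sgn y))\<bar> \<le> R * \<bar>X\<bar> * (c2 * d * Y)"
      unfolding abs_mult
    proof (intro mult_mono)
      show "\<bar>\<psi> \<bullet> (sgn z - sgn y)\<bar> \<le> c2 * d * Y"
        using Cauchy_Schwarz_ineq2[of \<psi> "sgn z - sgn y"] mult_right_mono[OF \<psi> Y(2)] unfolding Y_def by linarith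
    qed (use R R0 rs in \<open>auto simp: r_def\<close>)
    also have "\<dots> = d * (\<bar>X\<bar> * (R * c2 * Y))" by simp
    also have "\<dots> \<le> d * (c1 / (2 * D) * X\<^sup>2 + R\<^sup>2 * c2\<^sup>2 * D / c1 * q)"
    proof (intro mult_left_mono)
      define A where "A = c1 / D"
      have A: "A > 0" using c1 D by (simp add: A_def)
      have "0 \<le> (A * \<bar>X\<bar> - R * c2 * Y)\<^sup>2" by simp
      also have "\<dots> = A * (A * X\<^sup>2 - 2 * (\<bar>X\<bar> * (R * c2 * Y)) + (R * c2 * Y)\<^sup>2 / A)"
        using A by (simp add: power2_diff field_simps power_mult_distrib) (simp add: power2_eq_square)
      finally have "0 \<le> A * X\<^sup>2 - 2 * (\<bar>X\<bar> * (R * c2 * Y)) + (R * c2 * Y)\<^sup>2 / A"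
        using A by (simp add: zero_le_mult_iff)
      hence "\<bar>X\<bar> * (R * c2 * Y) \<le> A / 2 * X\<^sup>2 + (R * c2 * Y)\<^sup>2 / (2 * A)" by (simp add: field_simps)
      also have "(R * c2 * Y)\<^sup>2 / (2 * A) = R\<^sup>2 * c2\<^sup>2 * D / c1 * q"
        using c1 D by (simp add: power_mult_distrib Y A_def field_simps)
      finally show "\<bar>X\<bar> * (R * c2 * Y) \<le> c1 / (2 * D) * X\<^sup>2 + R\<^sup>2 * c2\<^sup>2 * D / c1 * q"
        by (simp add: A_def)
    qed (use d in simp)
    finally show ?thesis by linarith
  qed
  have T3: "- (d * (R\<^sup>2 * c2 * q)) \<le> r * s * (\<psi> \<bullet> sgn y) * q"
  proof -
    have "\<bar>\<psi> \<bullet> sgn y\<bar> \<le> c2 * d"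
      using Cauchy_Schwarz_ineq2[of \<psi> "sgn y"] \<psi> nz by (simp add: norm_sgn)
    moreover have "r * s \<le> R * R" using R rs R0 by (intro mult_mono) (auto simp: r_def s_def)
    ultimately have "r * s * \<bar>\<psi> \<bullet> sgn y\<bar> * q \<le> R * R * (c2 * d) * q"
      using rs q R0 by (intro mult_right_mono[of _ _ q] mult_mono[of "r * s"]) auto
    moreover have "\<bar>r * s * (\<psi> \<bullet> sgn y) * q\<bar> = r * s * \<bar>\<psi> \<bullet> sgn y\<bar> * q" using rs q by (simp add: abs_mult)
    moreover have "R * R * (c2 * d) * q = d * (R\<^sup>2 * c2 * q)" by (simp add: power2_eq_square)
    ultimately show ?thesis by linarith
  qed
  have "d * (c1 / (2 * D) * X\<^sup>2 - (R\<^sup>2 * c2\<^sup>2 * D / c1 + R\<^sup>2 * c2) * q) \<le> d\<^sup>2 * (\<psi> \<bullet> f2_rem y z)"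
  proof -
    have "d * (c1 / (2 * D) * X\<^sup>2 - (R\<^sup>2 * c2\<^sup>2 * D / c1 + R\<^sup>2 * c2) * q)
        = c1 * d * X\<^sup>2 / D - d * (c1 / (2 * D) * X\<^sup>2 + R\<^sup>2 * c2\<^sup>2 * D / c1 * q) - d * (R\<^sup>2 * c2 * q)"
      using c1 D by (simp add: field_simps)
    also have "\<dots> \<le> (\<psi> \<bullet> sgn z) * X\<^sup>2 / (1 - s) + r * X * (\<psi> \<bullet> (sgn z - sgn y)) + r * s * (\<psi> \<bullet> sgn y) * q"
    proof -
      have sub: "A - B - C \<le> A' + B' + C'" if "A \<le> A'" "- B \<le> B'" "- C \<le> C'" for A B C A' B' C' :: real
        using that by linarith
      show ?thesis by (rule sub[OF T1 T2 T3])
    qed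
    finally show ?thesis unfolding id .
  qed
  hence "d * (c1 / (2 * D) * X\<^sup>2 - (R\<^sup>2 * c2\<^sup>2 * D / c1 + R\<^sup>2 * c2) * q) \<le> d * (d * (\<psi> \<bullet> f2_rem y z))"
    by (simp add: power2_eq_square mult.assoc)
  hence "c1 / (2 * D) * X\<^sup>2 - (R\<^sup>2 * c2\<^sup>2 * D / c1 + R\<^sup>2 * c2) * q \<le> d * (\<psi> \<bullet> f2_rem y z)"
    using d(2) by (rule mult_left_le_imp_le)
  thus ?thesis using d(2) by (simp add: divide_le_eq mult.commute X_def q_def)
qed


text \<open>The expression on the left is the time derivative of the cosine of the angle between two trajectories with forcing terms
\<open>v\<close> and \<open>w\<close>. The singular field has dropped out, as a radial field does not turn a point around the origin.
What remains is a turning speed of the form \<open>tangential forcing / norm\<close>, which depends smoothly on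
the position, and every contribution contains a factor of the order of the angle.\<close>
lemma angle_defect_rate:
  assumes nz: "y \<noteq> 0" "z \<noteq> 0" and c: "0 < c" "c \<le> norm y" "c \<le> norm z"
    and v: "norm v \<le> K" "norm w \<le> K" "norm (w - v) \<le> 2 * K * \<epsilon>" and \<epsilon>: "\<epsilon> \<ge> 0"
  shows "\<bar>(y \<bullet> w + v \<bullet> z - (y \<bullet> z) * ((z \<bullet> w) / (norm z)\<^sup>2 + (y \<bullet> v) / (norm y)\<^sup>2)) / (norm y * norm z)\<bar>
    \<le> (K / c\<^sup>2 + 4 * K / c) * ((norm z - norm y)\<^sup>2 + angle_defect y z + \<epsilon>\<^sup>2)" (is "\<bar>?D\<bar> \<le> _")
proof -
  define r s X q where "r = norm y" and "s = norm z" and "X = norm z - norm y" and "q = angle_defect y z"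
  define n k where "n = sgn y" and "k = sgn z"
  have rs: "r > 0" "s > 0" "c \<le> r" "c \<le> s" using nz c by (auto simp: r_def s_def)
  have q: "0 \<le> q" using angle_defect_nonneg[OF nz] by (simp add: q_def)
  have K: "K \<ge> 0" using v(1) norm_ge_zero order_trans by blast
  have yn: "y = r *\<^sub>R n" and zk: "z = s *\<^sub>R k" using nz by (auto simp: s_def r_def n_def k_def sgn_div_norm)
  have nn: "n \<bullet> n = 1" "k \<bullet> k = 1" "norm n = 1" "norm k = 1"
    using nz by (simp_all add: n_def k_def norm_sgn dot_square_norm)
  define \<kappa> where "\<kappa> = n \<bullet> k"
  have \<kappa>: "\<kappa> = 1 - q" using rs by (simp add: \<kappa>_def q_def angle_defect_def n_def k_def sgn_div_norm r_def s_def field_simps)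
  have D: "?D = v \<bullet> (k - \<kappa> *\<^sub>R n) * (1 / r - 1 / s) + v \<bullet> ((1 - \<kappa>) *\<^sub>R (k + n)) / s + (w - v) \<bullet> (n - \<kappa> *\<^sub>R k) / s"
  proof -
    have "?D = (r * (n \<bullet> w) + s * (v \<bullet> k) - r * s * \<kappa> * ((k \<bullet> w) / s + (n \<bullet> v) / r)) / (r * s)"
      unfolding r_def[symmetric] s_def[symmetric]
      by (simp add: yn zk \<kappa>_def inner_commute power2_eq_square)
    also have "\<dots> = (n \<bullet> w - \<kappa> * (k \<bullet> w)) / s + (v \<bullet> k - \<kappa> * (n \<bullet> v)) / r"
      using rs by (simp add: field_simps)
    also have "\<dots> = v \<bullet> (k - \<kappa> *\<^sub>R n) * (1 / r - 1 / s) + v \<bullet> ((1 - \<kappa>) *\<^sub>R (k + n)) / s + (w - v) \<bullet> (n - \<kappa> *\<^sub>R k) / s"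
      unfolding inner_diff_left inner_diff_right inner_add_right inner_scaleR_right divide_inverse
        inner_commute[of n w] inner_commute[of k w] inner_commute[of n v] by (simp add: algebra_simps)
    finally show ?thesis .
  qed
  define Y where "Y = sqrt (2 * q)"
  have Y: "Y \<ge> 0" "Y\<^sup>2 = 2 * q" using q by (auto simp: Y_def)
  have perp: "norm (k - \<kappa> *\<^sub>R n) \<le> Y" "norm (n - \<kappa> *\<^sub>R k) \<le> Y"
  proof -
    have "(norm (k - \<kappa> *\<^sub>R n))\<^sup>2 = 1 - \<kappa>\<^sup>2" "(norm (n - \<kappa> *\<^sub>R k))\<^sup>2 = 1 - \<kappa>\<^sup>2"
      unfolding power2_norm_eq_inner
      by (simp_all add: inner_diff_left inner_diff_right nn inner_commute \<kappa>_def[symmetric] power2_eq_square)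
        (simp_all add: \<kappa>_def inner_commute power2_eq_square)
    moreover have "1 - \<kappa>\<^sup>2 \<le> Y\<^sup>2" unfolding Y \<kappa> by (simp add: power2_eq_square algebra_simps)
    ultimately have "(norm (k - \<kappa> *\<^sub>R n))\<^sup>2 \<le> Y\<^sup>2" "(norm (n - \<kappa> *\<^sub>R k))\<^sup>2 \<le> Y\<^sup>2" by linarith+
    thus "norm (k - \<kappa> *\<^sub>R n) \<le> Y" "norm (n - \<kappa> *\<^sub>R k) \<le> Y"
      using Y(1) power2_le_imp_le by blast+
  qed
  have half: "Y * \<bar>X\<bar> \<le> q + X\<^sup>2" "Y * \<epsilon> \<le> q + \<epsilon>\<^sup>2"
  proof -
    have "2 * (Y * \<bar>X\<bar>) \<le> Y\<^sup>2 + X\<^sup>2" using sum_squares_bound[of Y "\<bar>X\<bar>"] by simp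
    thus "Y * \<bar>X\<bar> \<le> q + X\<^sup>2" unfolding Y(2) using zero_le_power2[of X] by linarith
    have "2 * (Y * \<epsilon>) \<le> Y\<^sup>2 + \<epsilon>\<^sup>2" using sum_squares_bound[of Y \<epsilon>] by simp
    thus "Y * \<epsilon> \<le> q + \<epsilon>\<^sup>2" unfolding Y(2) using zero_le_power2[of \<epsilon>] by linarith
  qed
  have T1: "\<bar>v \<bullet> (k - \<kappa> *\<^sub>R n) * (1 / r - 1 / s)\<bar> \<le> K / c\<^sup>2 * (q + X\<^sup>2)"
  proof -
    have "\<bar>1 / r - 1 / s\<bar> = \<bar>X\<bar> / (r * s)" using rs by (simp add: X_def r_def s_def field_simps abs_mult)
    also have "\<dots> \<le> \<bar>X\<bar> / c\<^sup>2"
      unfolding power2_eq_square using rs c by (intro divide_left_mono mult_mono) auto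
    finally have A: "\<bar>1 / r - 1 / s\<bar> \<le> \<bar>X\<bar> / c\<^sup>2" .
    have "\<bar>v \<bullet> (k - \<kappa> *\<^sub>R n)\<bar> \<le> norm v * norm (k - \<kappa> *\<^sub>R n)" by (rule Cauchy_Schwarz_ineq2)
    also have "\<dots> \<le> K * Y" using v perp K by (intro mult_mono) auto
    finally have "\<bar>v \<bullet> (k - \<kappa> *\<^sub>R n) * (1 / r - 1 / s)\<bar> \<le> (K * Y) * (\<bar>X\<bar> / c\<^sup>2)"
      unfolding abs_mult using A K Y(1) by (intro mult_mono) auto
    also have "\<dots> = K / c\<^sup>2 * (Y * \<bar>X\<bar>)" by simp
    also have "\<dots> \<le> K / c\<^sup>2 * (q + X\<^sup>2)" using half K by (intro mult_left_mono) auto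
    finally show ?thesis .
  qed
  have T2: "\<bar>v \<bullet> ((1 - \<kappa>) *\<^sub>R (k + n)) / s\<bar> \<le> 2 * K / c * q"
  proof -
    have "norm (k + n) \<le> 2" using norm_triangle_ineq[of k n] nn by simp
    hence "norm ((1 - \<kappa>) *\<^sub>R (k + n)) \<le> q * 2" using q by (simp add: \<kappa> mult_left_mono)
    hence "\<bar>v \<bullet> ((1 - \<kappa>) *\<^sub>R (k + n))\<bar> \<le> K * (q * 2)"
      using Cauchy_Schwarz_ineq2[of v "(1 - \<kappa>) *\<^sub>R (k + n)"] v K q
        mult_mono[of "norm v" K "norm ((1 - \<kappa>) *\<^sub>R (k + n))" "q * 2"] by auto
    hence "\<bar>v \<bullet> ((1 - \<kappa>) *\<^sub>R (k + n))\<bar> / s \<le> K * (q * 2) / c" using rs c K q by (intro frac_le) auto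
    thus ?thesis using rs by (simp add: abs_div_pos[symmetric] mult_ac)
  qed
  have T3: "\<bar>(w - v) \<bullet> (n - \<kappa> *\<^sub>R k) / s\<bar> \<le> 2 * K / c * (q + \<epsilon>\<^sup>2)"
  proof -
    have "\<bar>(w - v) \<bullet> (n - \<kappa> *\<^sub>R k)\<bar> \<le> norm (w - v) * norm (n - \<kappa> *\<^sub>R k)" by (rule Cauchy_Schwarz_ineq2)
    also have "\<dots> \<le> (2 * K * \<epsilon>) * Y" using v(3) perp K \<epsilon> by (intro mult_mono) auto
    finally have "\<bar>(w - v) \<bullet> (n - \<kappa> *\<^sub>R k)\<bar> / s \<le> (2 * K * \<epsilon>) * Y / c"
      using rs c K \<epsilon> Y(1) by (intro frac_le) auto
    also have "\<dots> = 2 * K / c * (Y * \<epsilon>)" by simp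
    also have "\<dots> \<le> 2 * K / c * (q + \<epsilon>\<^sup>2)" using half K c by (intro mult_left_mono) auto
    finally show ?thesis using rs by (simp add: abs_div_pos[symmetric])
  qed
  have "\<bar>?D\<bar> \<le> K / c\<^sup>2 * (q + X\<^sup>2) + 2 * K / c * q + 2 * K / c * (q + \<epsilon>\<^sup>2)"
    unfolding D using T1 T2 T3 by linarith
  also have "\<dots> \<le> (K / c\<^sup>2 + 4 * K / c) * (X\<^sup>2 + q + \<epsilon>\<^sup>2)"
  proof -
    define \<alpha> \<beta> where "\<alpha> = K / c\<^sup>2" and "\<beta> = K / c"
    have "0 \<le> \<alpha> * \<epsilon>\<^sup>2" "0 \<le> \<beta> * X\<^sup>2" "0 \<le> \<beta> * \<epsilon>\<^sup>2" using K c by (auto simp: \<alpha>_def \<beta>_def)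
    hence "\<alpha> * (q + X\<^sup>2) + 2 * \<beta> * q + 2 * \<beta> * (q + \<epsilon>\<^sup>2) \<le> (\<alpha> + 4 * \<beta>) * (X\<^sup>2 + q + \<epsilon>\<^sup>2)"
      by (simp add: algebra_simps)
    thus ?thesis by (simp add: \<alpha>_def \<beta>_def)
  qed
  finally show ?thesis by (simp add: X_def q_def)
qed

text \<open>The coefficients \<open>g\<close> and \<open>h\<close> of the radial parts cancel.\<close>
lemma lip_primitive_angle_defect:
  assumes y: "lip_primitive a b y (\<lambda>t. g t *\<^sub>R y t + v t)" and z: "lip_primitive a b z (\<lambda>t. h t *\<^sub>R z t + w t)"
    and nz: "\<And>t. t \<in> {a..b} \<Longrightarrow> y t \<noteq> 0" "\<And>t. t \<in> {a..b} \<Longrightarrow> z t \<noteq> 0"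
  shows "lip_primitive a b (\<lambda>t. angle_defect (y t) (z t))
    (\<lambda>t. - ((y t \<bullet> w t + v t \<bullet> z t - (y t \<bullet> z t) * ((z t \<bullet> w t) / (norm (z t))\<^sup>2 + (y t \<bullet> v t) / (norm (y t))\<^sup>2))
          / (norm (y t) * norm (z t))))"
proof -
  note ny = lip_primitive_norm[OF y nz(1)] and nz' = lip_primitive_norm[OF z nz(2)]
  have "lip_primitive a b (\<lambda>t. 1 / (norm (y t) * norm (z t)))
    (\<lambda>t. - (norm (y t) * ((z t \<bullet> (h t *\<^sub>R z t + w t)) / norm (z t)) + (y t \<bullet> (g t *\<^sub>R y t + v t)) / norm (y t) * norm (z t)) / (norm (y t) * norm (z t))\<^sup>2)"
    by (rule lip_primitive_inverse[OF lip_primitive_mult[OF ny nz']]) (use nz in auto)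
  from lip_primitive_diff[OF lip_primitive_const[of a b "1::real"] lip_primitive_mult[OF lip_primitive_inner[OF y z] this]]
  show ?thesis
  proof (rule lip_primitive_cong, goal_cases)
    case (1 t)
    show ?case by (simp add: angle_defect_def)
  next
    case (2 t)
    define r s where "r = norm (y t)" and "s = norm (z t)"
    have rs: "r \<noteq> 0" "s \<noteq> 0" using nz[OF 2] by (auto simp: r_def s_def)
    have yy: "y t \<bullet> y t = r * r" "z t \<bullet> z t = s * s" by (simp_all add: r_def s_def dot_square_norm power2_eq_square)
    show ?case
      unfolding r_def[symmetric] s_def[symmetric] inner_add_left inner_add_right inner_scaleR_left inner_scaleR_right yy
      using rs by (simp add: field_simps power2_eq_square)
  qed
qed

section \<open>Forced trajectories and their gap to the unit circle\<close>

text \<open>The forcing term \<open>B u\<close> is only bounded almost everywhere. A representative that is bounded at every nonnegative time keeps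
exceptional sets out of all estimates below.\<close>
definition bounded_forcing :: "real \<Rightarrow> (real \<Rightarrow> real^2) \<Rightarrow> bool" where
  "bounded_forcing K v \<longleftrightarrow> v \<in> borel_measurable half_line \<and> (\<forall>t\<ge>0. norm (v t) \<le> K)"

lemma bounded_forcing_integrable:
  assumes "bounded_forcing K v" "0 \<le> a"
  shows "v absolutely_integrable_on {a..b}" "v integrable_on {a..b}"
proof -
  have "{a..b} \<subseteq> {0..}" using assms(2) by auto
  hence "v \<in> borel_measurable (lebesgue_on {a..b})"
    using assms(1) measurable_restrict_mono unfolding bounded_forcing_def by blast
  thus "v absolutely_integrable_on {a..b}"
    by (rule measurable_bounded_by_integrable_imp_absolutely_integrable[where g = "\<lambda>_. K"])
      (use assms in \<open>auto simp: bounded_forcing_def\<close>)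
  thus "v integrable_on {a..b}" by (rule set_lebesgue_integral_eq_integral(1))
qed

definition forced_solution :: "(real \<Rightarrow> real^2) \<Rightarrow> real^2 \<Rightarrow> real \<Rightarrow> (real \<Rightarrow> real^2) \<Rightarrow> bool" where
  "forced_solution v y0 T y \<longleftrightarrow> 0 < T \<and> y 0 = y0 \<and> (\<forall>t\<in>{0..<T}. norm (y t) \<noteq> 1) \<and>
     (\<forall>b\<in>{0<..<T}. lip_primitive 0 b y (\<lambda>t. f2 (y t) + v t))"

lemma f2_continuous_on:
  assumes "continuous_on S y" "\<And>t. t \<in> S \<Longrightarrow> norm (y t) \<noteq> 1"
  shows "continuous_on S (\<lambda>t. f2 (y t))"
  unfolding f2_eq using assms by (intro continuous_intros) auto

lemma forced_solution_mono:
  "forced_solution v y0 T y \<Longrightarrow> 0 < T' \<Longrightarrow> T' \<le> T \<Longrightarrow> forced_solution v y0 T' y"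
  unfolding forced_solution_def by auto

lemma forced_solution_lip:
  assumes "forced_solution v y0 T y" "0 \<le> a" "b < T"
  shows "lip_primitive a b y (\<lambda>t. f2 (y t) + v t)"
proof -
  define b' where "b' = max b (T / 2)"
  have "0 < T" using assms by (simp add: forced_solution_def)
  hence "b' \<in> {0<..<T}" "b \<le> b'" using assms by (auto simp: b'_def)
  thus ?thesis using assms lip_primitive_subset[of 0 b' y _ a b] unfolding forced_solution_def by blast
qed

text \<open>The sign \<open>\<sigma>\<close> is \<open>1\<close> inside and \<open>-1\<close> outside the circle. The last assumption is equivalent to the conditions that define
\<open>S_f2\<close> for points inside and implied by them for points outside; it says that the radial speed
\<open>norm y0 / gap y0\<close> exceeds \<open>2 * K\<close>.\<close>
locale quench_data =
  fixes K \<sigma> :: real and y0 :: "real^2"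
  assumes K: "K > 0" and \<sigma>: "\<sigma> \<in> {-1, 1}"
    and gap0: "0 < \<sigma> * (1 - norm y0)" and drift0: "2 * K * (\<sigma> * (1 - norm y0)) < norm y0"
begin

text \<open>The distance to the unit circle, with positive sign on the side of \<open>y0\<close>.\<close>
definition gap :: "real^2 \<Rightarrow> real" where "gap y = \<sigma> * (1 - norm y)"

text \<open>Plays two roles: a lower bound for \<open>norm y\<close> along all trajectories and the guaranteed rate of decay of \<open>(gap y)\<^sup>2\<close>.\<close>
definition c where "c = 2 * K / (2 * K + 1)"

lemma norm_gap: "norm y = 1 - \<sigma> * gap y"
  using \<sigma> by (auto simp: gap_def)

lemma abs_gap: "\<bar>1 - norm y\<bar> = \<bar>gap y\<bar>"
  using \<sigma> by (auto simp: gap_def)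

lemma c_pos: "0 < c" "c < 1" using K by (auto simp: c_def)

lemma gap0_pos: "0 < gap y0" using gap0 by (simp add: gap_def)

lemma drift0': "2 * K * gap y0 < 1 - \<sigma> * gap y0"
proof -
  have "2 * K * gap y0 < norm y0" using drift0 by (simp add: gap_def)
  thus ?thesis using norm_gap[of y0] by linarith
qed

text \<open>The condition on the initial point is inherited by all points of the same side that are nearer to the circle.\<close>
lemma norm_lower:
  assumes "0 \<le> gap y" "gap y \<le> gap y0"
  shows "2 * K * gap y \<le> norm y" "c \<le> norm y"
proof -
  have "2 * K * gap y \<le> 1 - \<sigma> * gap y \<and> c \<le> 1 - \<sigma> * gap y"
  proof (cases "\<sigma> = 1")
    case True
    have "(2 * K + 1) * gap y \<le> (2 * K + 1) * gap y0" using assms K by (intro mult_left_mono) auto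
    hence 1: "(2 * K + 1) * gap y \<le> 1" using drift0' True by (simp add: algebra_simps)
    hence "gap y \<le> 1 / (2 * K + 1)" using K by (simp add: field_simps)
    moreover have "1 - 1 / (2 * K + 1) = c" using K by (simp add: c_def field_simps)
    ultimately show ?thesis using 1 True by (auto simp: algebra_simps)
  next
    case False
    hence s: "\<sigma> = -1" using \<sigma> by auto
    have "2 * K * gap y \<le> 1 + gap y"
    proof (cases "2 * K \<le> 1")
      case True
      hence "2 * K * gap y \<le> 1 * gap y" using assms by (intro mult_right_mono) auto
      thus ?thesis by simp
    next
      case False
      hence "(2 * K - 1) * gap y \<le> (2 * K - 1) * gap y0" using assms by (intro mult_left_mono) auto
      thus ?thesis using drift0' s by (simp add: algebra_simps)
    qed
    thus ?thesis using s assms c_pos by auto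
  qed
  thus "2 * K * gap y \<le> norm y" "c \<le> norm y" unfolding norm_gap[of y] by auto
qed

lemma norm_upper: "gap y \<le> gap y0 \<Longrightarrow> 0 \<le> gap y \<Longrightarrow> norm y \<le> 1 + gap y0"
  using \<sigma> norm_gap[of y] by auto

lemma inner_f2: "y \<bullet> f2 y = \<sigma> * (norm y)\<^sup>2 / gap y"
proof -
  have "y \<bullet> f2 y = (norm y)\<^sup>2 / (1 - norm y)" by (simp add: f2_eq dot_square_norm)
  also have "\<dots> = \<sigma> * (norm y)\<^sup>2 / gap y" using \<sigma> by (auto simp: gap_def)
  finally show ?thesis .
qed

lemma lip_primitive_gap:
  assumes y: "lip_primitive a b y (\<lambda>t. f2 (y t) + v t)" and nz: "\<And>t. t \<in> {a..b} \<Longrightarrow> y t \<noteq> 0"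
  shows "lip_primitive a b (\<lambda>t. gap (y t)) (\<lambda>t. - (norm (y t) / gap (y t)) - \<sigma> * (y t \<bullet> v t) / norm (y t))"
proof -
  have "lip_primitive a b (\<lambda>t. \<sigma> *\<^sub>R (1 - norm (y t))) (\<lambda>t. \<sigma> *\<^sub>R (0 - (y t \<bullet> (f2 (y t) + v t)) / norm (y t)))"
    by (intro lip_primitive_cmult lip_primitive_diff lip_primitive_const lip_primitive_norm y nz)
  thus ?thesis
  proof (rule lip_primitive_cong, goal_cases)
    case (2 t)
    hence n: "norm (y t) \<noteq> 0" using nz by simp
    have "\<sigma> * \<sigma> = 1" using \<sigma> by auto
    have "(y t \<bullet> (f2 (y t) + v t)) / norm (y t) = \<sigma> * (norm (y t) / gap (y t)) + (y t \<bullet> v t) / norm (y t)"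
      using n by (simp add: inner_add_right inner_f2 add_divide_distrib power2_eq_square)
    hence "\<sigma> *\<^sub>R (0 - (y t \<bullet> (f2 (y t) + v t)) / norm (y t))
        = - ((\<sigma> * \<sigma>) * (norm (y t) / gap (y t))) - \<sigma> * (y t \<bullet> v t) / norm (y t)"
      by (simp add: algebra_simps)
    thus ?case using \<open>\<sigma> * \<sigma> = 1\<close> by simp
  qed (simp add: gap_def)
qed

lemma forced_solution_gap_pos:
  assumes y: "forced_solution v y0 T y" and t: "t \<in> {0..<T}"
  shows "0 < gap (y t)"
proof (rule ccontr)
  assume n: "\<not> 0 < gap (y t)"
  have "continuous_on {0..t} y"
    by (rule lip_primitive_continuous[OF forced_solution_lip[OF y]]) (use t in auto)
  hence "continuous_on {0..t} (\<lambda>t. gap (y t))" unfolding gap_def by (intro continuous_intros)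
  moreover have "0 \<le> gap (y 0)" using y gap0_pos by (simp add: forced_solution_def)
  ultimately obtain s where "s \<in> {0..t}" "gap (y s) = 0"
    using IVT2'[of "\<lambda>t. gap (y t)" t 0 0] n t by auto
  hence "norm (y s) = 1" "s \<in> {0..<T}" using norm_gap[of "y s"] t by auto
  thus False using y by (auto simp: forced_solution_def)
qed

lemma radial_forcing_le:
  assumes v: "bounded_forcing K v" and t: "0 \<le> t" and x: "x \<noteq> 0"
  shows "- (\<sigma> * (x \<bullet> v t)) / norm x \<le> K"
proof -
  have n: "0 < norm x" using x by simp
  have "\<bar>\<sigma> * (x \<bullet> v t)\<bar> = \<bar>x \<bullet> v t\<bar>" using \<sigma> by auto
  also have "\<dots> \<le> norm x * norm (v t)" by (rule Cauchy_Schwarz_ineq2)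
  also have "\<dots> \<le> norm x * K" using v t by (intro mult_left_mono) (auto simp: bounded_forcing_def)
  finally show ?thesis by (subst pos_divide_le_eq[OF n], subst mult.commute) linarith
qed

text \<open>As long as the gap stays below a level \<open>D\<close> at which the field still dominates the forcing, the gap decreases.\<close>
lemma gap_decreasing_raw:
  assumes y: "forced_solution v y0 T y" and v: "bounded_forcing K v" and ab: "0 \<le> a" "a \<le> b" "b < T"
    and D: "2 * K * D \<le> 1 - \<sigma> * D" "\<And>s. s \<in> {a..b} \<Longrightarrow> gap (y s) \<le> D"
  shows "gap (y b) \<le> gap (y a)"
proof -
  have pos: "0 < gap (y s)" if "s \<in> {a..b}" for s using forced_solution_gap_pos[OF y] ab that by auto
  have D0: "D > 0" using pos[of a] D(2)[of a] ab by auto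
  have low: "2 * K * gap (y s) \<le> norm (y s)" if s: "s \<in> {a..b}" for s
  proof -
    have "2 * K * gap (y s) \<le> 1 - \<sigma> * gap (y s)"
    proof (cases "2 * K + \<sigma> \<ge> 0")
      case True
      hence "(2 * K + \<sigma>) * gap (y s) \<le> (2 * K + \<sigma>) * D" using D(2)[OF s] by (intro mult_left_mono) auto
      thus ?thesis using D(1) by (simp add: algebra_simps)
    next
      case False
      hence "(2 * K + \<sigma>) * gap (y s) \<le> 0" using pos[OF s] by (simp add: mult_nonpos_nonneg)
      thus ?thesis by (simp add: algebra_simps)
    qed
    thus ?thesis using norm_gap[of "y s"] by simp
  qed
  have nz: "y s \<noteq> 0" if s: "s \<in> {a..b}" for s
  proof -
    have "0 < 2 * K * gap (y s)" using pos[OF s] K by simp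
    thus ?thesis using low[OF s] by auto
  qed
  have "gap (y b) \<le> gap (y a) + 0 * (b - a)"
  proof (rule lip_primitive_le[OF lip_primitive_gap[OF forced_solution_lip[OF y]] ab(2)])
    fix t assume t: "t \<in> {a..b}"
    have "- (\<sigma> * (y t \<bullet> v t)) / norm (y t) \<le> K"
      by (rule radial_forcing_le[OF v _ nz[OF t]]) (use t ab in auto)
    moreover have "2 * K \<le> norm (y t) / gap (y t)" using low[OF t] pos[OF t] by (simp add: le_divide_eq)
    ultimately show "- (norm (y t) / gap (y t)) - \<sigma> * (y t \<bullet> v t) / norm (y t) \<le> 0" using K by simp
  qed (use ab nz in auto)
  thus ?thesis by simp
qed

text \<open>The strict inequality at the initial point leaves room for a level \<open>D\<close> above the initial gap. Staying below \<open>D\<close>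
forces the gap to decrease, hence to stay below its initial value, and the bound by \<open>D\<close> is never used up.\<close>
lemma gap_le_gap0:
  assumes y: "forced_solution v y0 T y" and v: "bounded_forcing K v" and t: "t \<in> {0..<T}"
  shows "gap (y t) \<le> gap y0"
proof -
  define g where "g = 1 - \<sigma> * gap y0 - 2 * K * gap y0"
  have g: "g > 0" using drift0' by (simp add: g_def)
  \<comment> \<open>Half of the slack \<open>g\<close> in the condition on \<open>y0\<close> is spent on raising the level.\<close>
  define D where "D = gap y0 + g / (2 * (2 * K + 1))"
  have D0: "gap y0 < D" using g K by (simp add: D_def)
  have "(2 * K + \<sigma>) * (D - gap y0) \<le> (2 * K + 1) * (D - gap y0)" using \<sigma> D0 by (intro mult_right_mono) auto
  also have "\<dots> = g / 2" using K by (simp add: D_def field_simps)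
  also have "\<dots> < g" using g by simp
  finally have D: "2 * K * D \<le> 1 - \<sigma> * D" by (simp add: g_def algebra_simps)
  have y00: "y 0 = y0" using y by (simp add: forced_solution_def)
  have "gap (y s) < D" if s: "s \<in> {0..t}" for s
  proof (rule continuous_bootstrap[OF _ _ _ s])
    have "continuous_on {0..t} y"
      by (rule lip_primitive_continuous[OF forced_solution_lip[OF y]]) (use t in auto)
    thus "continuous_on {0..t} (\<lambda>t. gap (y t))" unfolding gap_def by (intro continuous_intros)
    show "gap (y 0) < D" using D0 y00 by simp
    fix r assume r: "r \<in> {0..t}" and *: "\<And>s. s \<in> {0..r} \<Longrightarrow> gap (y s) \<le> D"
    have "gap (y r) \<le> gap (y 0)" by (rule gap_decreasing_raw[OF y v _ _ _ D *]) (use r t in auto)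
    thus "gap (y r) < D" using D0 y00 by simp
  qed
  hence "gap (y t) \<le> gap (y 0)" using t by (intro gap_decreasing_raw[OF y v _ _ _ D]) (auto intro: less_imp_le)
  thus ?thesis using y00 by simp
qed

lemma forced_solution_bounds:
  assumes y: "forced_solution v y0 T y" and v: "bounded_forcing K v" and t: "t \<in> {0..<T}"
  shows "0 < gap (y t)" "gap (y t) \<le> gap y0" "c \<le> norm (y t)" "norm (y t) \<le> 1 + gap y0"
    "2 * K * gap (y t) \<le> norm (y t)" "y t \<noteq> 0"
proof -
  show 1: "0 < gap (y t)" "gap (y t) \<le> gap y0"
    using forced_solution_gap_pos[OF y t] gap_le_gap0[OF y v t] by auto
  show 2: "c \<le> norm (y t)" "norm (y t) \<le> 1 + gap y0" "2 * K * gap (y t) \<le> norm (y t)"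
    using 1 norm_lower norm_upper by auto
  show "y t \<noteq> 0" using 2 c_pos by auto
qed

text \<open>The product of the gap and its derivative is free of the singularity: it is \<open>- norm y\<close> plus a term of size
\<open>K * gap\<close>, and the latter is at most half of the former.\<close>
lemma gap_square_decay:
  assumes y: "forced_solution v y0 T y" and v: "bounded_forcing K v" and st: "0 \<le> s" "s \<le> t" "t < T"
  shows "(gap (y t))\<^sup>2 + c * (t - s) \<le> (gap (y s))\<^sup>2"
proof -
  note b = forced_solution_bounds[OF y v]
  have L: "lip_primitive s t (\<lambda>t. gap (y t)) (\<lambda>t. - (norm (y t) / gap (y t)) - \<sigma> * (y t \<bullet> v t) / norm (y t))"
    by (rule lip_primitive_gap[OF forced_solution_lip[OF y]]) (use st b(6) in auto)
  have "gap (y t) * gap (y t) \<le> gap (y s) * gap (y s) + (- c) * (t - s)"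
  proof (rule lip_primitive_le[OF lip_primitive_mult[OF L L] st(2)])
    fix r assume "r \<in> {s..t}"
    hence r: "r \<in> {0..<T}" using st by auto
    define X where "X = \<sigma> * (y r \<bullet> v r) / norm (y r)"
    have X: "- X \<le> K" using radial_forcing_le[OF v _ b(6)[OF r]] r by (simp add: X_def)
    have "gap (y r) * (- (norm (y r) / gap (y r)) - X) = - norm (y r) + gap (y r) * (- X)"
      using b(1)[OF r] by (simp add: field_simps)
    also have "\<dots> \<le> - norm (y r) + gap (y r) * K" using X b(1)[OF r] by (intro add_left_mono mult_left_mono) auto
    also have "\<dots> \<le> - norm (y r) / 2" using b(5)[OF r] by (simp add: algebra_simps)
    also have "\<dots> \<le> - c / 2" using b(3)[OF r] by simp
    finally show "gap (y r) * (- (norm (y r) / gap (y r)) - \<sigma> * (y r \<bullet> v r) / norm (y r))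
        + (- (norm (y r) / gap (y r)) - \<sigma> * (y r \<bullet> v r) / norm (y r)) * gap (y r) \<le> - c"
      unfolding X_def by (simp add: mult.commute)
  qed
  thus ?thesis by (simp add: power2_eq_square)
qed

lemma gap_antimono:
  assumes "forced_solution v y0 T y" "bounded_forcing K v" "0 \<le> s" "s \<le> t" "t < T"
  shows "gap (y t) \<le> gap (y s)"
proof -
  have "(gap (y t))\<^sup>2 \<le> (gap (y s))\<^sup>2"
    using gap_square_decay[OF assms] c_pos assms(4) mult_nonneg_nonneg[of c "t - s"] by linarith
  thus ?thesis using forced_solution_gap_pos[OF assms(1), of s] assms(3-5) by (auto intro: power2_le_imp_le less_imp_le)
qed

lemma forced_solution_time_bound:
  assumes y: "forced_solution v y0 T y" and v: "bounded_forcing K v"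
  shows "T \<le> (gap y0)\<^sup>2 / c"
proof (rule dense_le)
  fix t assume t: "t < T"
  show "t \<le> (gap y0)\<^sup>2 / c"
  proof (cases "t \<ge> 0")
    case True
    have "(gap (y t))\<^sup>2 + c * (t - 0) \<le> (gap (y 0))\<^sup>2" by (rule gap_square_decay[OF y v]) (use t True in auto)
    moreover have "y 0 = y0" using y by (simp add: forced_solution_def)
    ultimately have "(gap (y t))\<^sup>2 + c * t \<le> (gap y0)\<^sup>2" by simp
    hence "c * t \<le> (gap y0)\<^sup>2" using zero_le_power2[of "gap (y t)"] by linarith
    thus ?thesis using c_pos by (simp add: le_divide_eq mult.commute)
  next
    case False
    have "0 \<le> (gap y0)\<^sup>2 / c" using c_pos by simp
    thus ?thesis using False by linarith
  qed
qed

lemma forced_solution_unique: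
  assumes y: "forced_solution v y0 T y" and z: "forced_solution v y0 T' z" and v: "bounded_forcing K v"
    and t: "0 \<le> t" "t < T" "t < T'"
  shows "y t = z t"
proof -
  \<comment> \<open>Both gaps decrease, so up to time \<open>t\<close> they are at least their minimum at \<open>t\<close>.\<close>
  define \<delta> where "\<delta> = min (gap (y t)) (gap (z t))"
  have \<delta>: "\<delta> > 0" using forced_solution_bounds(1)[OF y v, of t] forced_solution_bounds(1)[OF z v, of t] t by (simp add: \<delta>_def)
  define L where "L = 1 / \<delta> + (1 + gap y0) / \<delta>\<^sup>2"
  have L: "L \<ge> 0" using \<delta> gap0_pos by (simp add: L_def)
  have P: "lip_primitive 0 t (\<lambda>s. z s - y s) (\<lambda>s. (f2 (z s) + v s) - (f2 (y s) + v s))"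
    by (intro lip_primitive_diff forced_solution_lip[OF y] forced_solution_lip[OF z]) (use t in auto)
  have "(norm (z t - y t))\<^sup>2 \<le> exp ((2 * L + 1) * (t - 0)) * ((norm (z 0 - y 0))\<^sup>2 + 0\<^sup>2 * (t - 0))"
  proof (rule gronwall[OF P L])
    fix s assume s: "s \<in> {0..t}"
    have "\<delta> \<le> gap (y s)" "\<delta> \<le> gap (z s)" "norm (y s) \<le> 1 + gap y0"
      using gap_antimono[OF y v, of s t] gap_antimono[OF z v, of s t] s t forced_solution_bounds(4)[OF y v, of s]
      by (auto simp: \<delta>_def)
    hence "norm (f2 (z s) - f2 (y s)) \<le> L * norm (z s - y s)"
      unfolding L_def by (intro f2_lipschitz \<delta>) (auto simp: abs_gap)
    thus "norm (f2 (z s) + v s - (f2 (y s) + v s)) \<le> L * norm (z s - y s) + 0" by simp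
  qed (use t in auto)
  moreover have "y 0 = z 0" using y z by (simp add: forced_solution_def)
  ultimately show ?thesis by simp
qed

lemma cutoff_solution:
  assumes v: "bounded_forcing K v" and \<delta>: "\<delta> > 0" and b: "b > 0"
  obtains x where "x 0 = y0" "lip_primitive 0 b x (\<lambda>t. f2_cut \<sigma> \<delta> (x t) + v t)"
proof -
  define L where "L = 2 / \<delta> + 1 / \<delta>\<^sup>2"
  have L: "L \<ge> 0" using \<delta> by (simp add: L_def)
  have lip: "norm (f2_cut \<sigma> \<delta> x - f2_cut \<sigma> \<delta> y) \<le> L * norm (x - y)" for x y
    unfolding L_def by (rule f2_cut_lipschitz[OF \<sigma> \<delta>])
  have "L-lipschitz_on UNIV (f2_cut \<sigma> \<delta>)" by (rule lipschitz_onI) (use lip L in \<open>auto simp: dist_norm\<close>)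
  hence cont: "continuous_on UNIV (f2_cut \<sigma> \<delta>)" by (rule lipschitz_on_continuous_on)
  have comp: "continuous_on {0..b} (\<lambda>s. f2_cut \<sigma> \<delta> (x s))" if "continuous_on {0..b} x" for x
    by (rule continuous_on_compose2[OF cont that]) auto
  have vint: "v integrable_on {0..b}" by (rule bounded_forcing_integrable[OF v]) simp
  obtain x where x: "continuous_on {0..b} x"
    "\<And>t. t \<in> {0..b} \<Longrightarrow> x t = (y0 + integral {0..t} v) + integral {0..t} (\<lambda>s. f2_cut \<sigma> \<delta> (x s))"
  proof (rule caratheodory_existence[of b "\<lambda>t. y0 + integral {0..t} v" "\<lambda>_. f2_cut \<sigma> \<delta>" "\<lambda>_. L" "\<lambda>t. L * t"])
    show "continuous_on {0..b} (\<lambda>t. y0 + integral {0..t} v)"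
      by (intro continuous_intros indefinite_integral_continuous_1 vint)
    show "(\<lambda>s. f2_cut \<sigma> \<delta> (x s)) integrable_on {0..b}" if "continuous_on {0..b} x" for x
      by (rule integrable_continuous_real[OF comp[OF that]])
  qed (use b L lip in \<open>auto intro!: continuous_intros derivative_eq_intros\<close>)
  have x0: "x 0 = y0" using x(2)[of 0] b by simp
  obtain P where P: "P > 0" "\<And>t. t \<in> {0..b} \<Longrightarrow> norm (f2_cut \<sigma> \<delta> (x t)) \<le> P"
    using continuous_on_Icc_bounded[OF comp[OF x(1)]] by blast
  have "lip_primitive 0 b x (\<lambda>t. f2_cut \<sigma> \<delta> (x t) + v t)"
  proof (rule lip_primitive_indefinite_integral)
    show "(\<lambda>t. f2_cut \<sigma> \<delta> (x t) + v t) integrable_on {0..b}"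
      by (intro integrable_add integrable_continuous_real comp x(1) vint)
    show "norm (f2_cut \<sigma> \<delta> (x t) + v t) \<le> P + K" if "t \<in> {0..b}" for t
      using P(2)[OF that] v that by (intro norm_triangle_le add_mono) (auto simp: bounded_forcing_def)
    fix t assume t: "t \<in> {0..b}"
    have "continuous_on {0..t} (\<lambda>s. f2_cut \<sigma> \<delta> (x s))" by (rule continuous_on_subset[OF comp[OF x(1)]]) (use t in auto)
    hence "integral {0..t} (\<lambda>s. f2_cut \<sigma> \<delta> (x s) + v s) = integral {0..t} (\<lambda>s. f2_cut \<sigma> \<delta> (x s)) + integral {0..t} v"
      by (intro integral_add integrable_continuous_real bounded_forcing_integrable(2)[OF v]) auto
    thus "x t = x 0 + integral {0..t} (\<lambda>t. f2_cut \<sigma> \<delta> (x t) + v t)"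
      using x(2)[OF t] x0 by simp
  qed
  thus ?thesis using x0 that by blast
qed

lemma cutoff_solution_extends:
  assumes x: "x 0 = y0" "lip_primitive 0 b x (\<lambda>t. f2_cut \<sigma> \<delta> (x t) + v t)" and \<delta>: "\<delta> > 0"
    and T: "0 \<le> T" "T < b" and far: "\<And>t. t \<in> {0..T} \<Longrightarrow> 2 * \<delta> \<le> gap (x t)"
  obtains T' where "T' > T" "forced_solution v y0 T' x"
proof -
  have cont: "continuous_on {0..b} (\<lambda>t. gap (x t))"
    unfolding gap_def by (intro continuous_intros lip_primitive_continuous[OF x(2)])
  have "\<exists>d>0. \<forall>t\<in>{0..b}. dist t T < d \<longrightarrow> dist (gap (x t)) (gap (x T)) < \<delta>"
    using cont[unfolded continuous_on_iff] T \<delta> by auto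
  then obtain d where d: "d > 0" "\<And>t. t \<in> {0..b} \<Longrightarrow> dist t T < d \<Longrightarrow> dist (gap (x t)) (gap (x T)) < \<delta>" by blast
  define T' where "T' = min b (T + d)"
  have T': "T < T'" "T' \<le> b" "T' > 0" using T d by (auto simp: T'_def)
  have near: "\<delta> \<le> gap (x t)" if t: "t \<in> {0..<T'}" for t
  proof (cases "t \<le> T")
    case True
    thus ?thesis using far[of t] t \<delta> by auto
  next
    case False
    hence "dist (gap (x t)) (gap (x T)) < \<delta>" using t by (intro d(2)) (auto simp: T'_def dist_real_def)
    thus ?thesis using far[of T] T by (auto simp: dist_real_def)
  qed
  have "forced_solution v y0 T' x"
    unfolding forced_solution_def
  proof (intro conjI ballI)
    show "norm (x t) \<noteq> 1" if "t \<in> {0..<T'}" for t using near[OF that] \<delta> by (auto simp: gap_def)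
    fix r assume r: "r \<in> {0<..<T'}"
    show "lip_primitive 0 r x (\<lambda>t. f2 (x t) + v t)"
    proof (rule lip_primitive_cong[OF lip_primitive_subset[OF x(2)]])
      show "f2_cut \<sigma> \<delta> (x t) + v t = f2 (x t) + v t" if "t \<in> {0..r}" for t
        using f2_cut_eq[OF \<sigma> \<delta>] near[of t] r that by (auto simp: gap_def)
    qed (use r T' in auto)
  qed (use T' x(1) in auto)
  thus ?thesis using that T'(1) by blast
qed

text \<open>A trajectory that keeps a positive distance from the circle solves the cut-off equation, whose solution goes on beyond \<open>T\<close> and
is not yet affected by the cut-off for a short time.\<close>
lemma forced_solution_continuation:
  assumes y: "forced_solution v y0 T y" and v: "bounded_forcing K v" and \<delta>: "\<delta> > 0"
    and far: "\<And>t. t \<in> {0..<T} \<Longrightarrow> 2 * \<delta> \<le> gap (y t)"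
  shows "\<exists>T' x. T' > T \<and> forced_solution v y0 T' x"
proof -
  have T0: "T > 0" using y by (simp add: forced_solution_def)
  obtain x where x: "x 0 = y0" "lip_primitive 0 (T + 1) x (\<lambda>t. f2_cut \<sigma> \<delta> (x t) + v t)"
    using cutoff_solution[OF v \<delta>, of "T + 1"] T0 by auto
  define L where "L = 2 / \<delta> + 1 / \<delta>\<^sup>2"
  have L: "L \<ge> 0" using \<delta> by (simp add: L_def)
  have eq: "x t = y t" if t: "t \<in> {0..<T}" for t
  proof -
    have P: "lip_primitive 0 t (\<lambda>s. x s - y s) (\<lambda>s. (f2_cut \<sigma> \<delta> (x s) + v s) - (f2 (y s) + v s))"
      by (intro lip_primitive_diff forced_solution_lip[OF y] lip_primitive_subset[OF x(2)]) (use t in auto)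
    have "(norm (x t - y t))\<^sup>2 \<le> exp ((2 * L + 1) * (t - 0)) * ((norm (x 0 - y 0))\<^sup>2 + 0\<^sup>2 * (t - 0))"
    proof (rule gronwall[OF P L])
      fix s assume s: "s \<in> {0..t}"
      have "f2 (y s) = f2_cut \<sigma> \<delta> (y s)" using far[of s] s t \<delta> by (intro f2_cut_eq[symmetric] \<sigma>) (auto simp: gap_def)
      thus "norm (f2_cut \<sigma> \<delta> (x s) + v s - (f2 (y s) + v s)) \<le> L * norm (x s - y s) + 0"
        using f2_cut_lipschitz[OF \<sigma> \<delta>, of "x s" "y s"] by (simp add: L_def)
    qed (use t in auto)
    thus ?thesis using x y by (simp add: forced_solution_def)
  qed
  have far': "2 * \<delta> \<le> gap (x t)" if t: "t \<in> {0..T}" for t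
  proof (cases "t < T")
    case True thus ?thesis using far[of t] eq[of t] t by auto
  next
    case False
    have cont: "continuous_on {0..T} (\<lambda>t. gap (x t))"
      unfolding gap_def by (intro continuous_intros lip_primitive_continuous[OF lip_primitive_subset[OF x(2)]]) auto
    have "((\<lambda>t. gap (x t)) \<longlongrightarrow> gap (x T)) (at_left T)"
      by (rule continuous_on_Icc_at_leftD[OF cont T0])
    moreover have "\<forall>\<^sub>F t in at_left T. 2 * \<delta> \<le> gap (x t)"
      using eventually_at_left_real[OF T0] by eventually_elim (use far eq in auto)
    ultimately have "2 * \<delta> \<le> gap (x T)" by (rule tendsto_lowerbound) simp
    thus ?thesis using False t by auto
  qed
  obtain T' where "T' > T" "forced_solution v y0 T' x"
    by (rule cutoff_solution_extends[OF x \<delta> _ _ far', of T]) (use T0 in auto)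
  thus ?thesis by blast
qed

text \<open>Lifetimes are bounded by \<open>gap_square_decay\<close>, so there is a supremum; by uniqueness all trajectories fit together, and by
continuation the gap cannot stay away from zero.\<close>
lemma maximal_solution:
  assumes v: "bounded_forcing K v"
  obtains T y where "forced_solution v y0 T y" "\<And>\<epsilon>. \<epsilon> > 0 \<Longrightarrow> \<exists>t\<in>{0..<T}. gap (y t) < \<epsilon>"
    "\<And>T' y'. forced_solution v y0 T' y' \<Longrightarrow> T' \<le> T"
proof -
  define \<T> where "\<T> = {T. \<exists>y. forced_solution v y0 T y}"
  define T where "T = Sup \<T>"
  have bdd: "bdd_above \<T>"
    by (rule bdd_aboveI[of _ "(gap y0)\<^sup>2 / c"]) (use forced_solution_time_bound[OF _ v] in \<open>auto simp: \<T>_def\<close>)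
  have g: "gap y0 / 2 > 0" using gap0_pos by simp
  obtain x where x: "x 0 = y0" "lip_primitive 0 1 x (\<lambda>t. f2_cut \<sigma> (gap y0 / 2) (x t) + v t)"
    using cutoff_solution[OF v g, of 1] by auto
  obtain T0 where T0: "T0 > 0" "forced_solution v y0 T0 x"
    by (rule cutoff_solution_extends[OF x g, of 0]) (use x in auto)
  hence ne: "\<T> \<noteq> {}" by (auto simp: \<T>_def)
  have le: "T' \<le> T" if "forced_solution v y0 T' y'" for T' y'
    unfolding T_def by (rule cSup_upper[OF _ bdd]) (use that in \<open>auto simp: \<T>_def\<close>)
  have Tpos: "T > 0" using le[OF T0(2)] T0(1) by simp
  define y where "y t = (SOME z. \<exists>T'>t. forced_solution v y0 T' z) t" for t
  have y_eq: "y t = z t" if z: "forced_solution v y0 T' z" and t: "t \<in> {0..<T'}" for t z T'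
  proof -
    have "\<exists>z. \<exists>T'>t. forced_solution v y0 T' z" using z t by auto
    from someI_ex[OF this] obtain T'' where "T'' > t" "forced_solution v y0 T'' (SOME z. \<exists>T'>t. forced_solution v y0 T' z)" by blast
    from forced_solution_unique[OF this(2) z v] this(1) t show ?thesis by (simp add: y_def)
  qed
  have ex: "\<exists>T' z. b < T' \<and> forced_solution v y0 T' z" if "b < T" for b
    using that less_cSup_iff[OF ne bdd] unfolding T_def \<T>_def by blast
  have sol: "forced_solution v y0 T y"
    unfolding forced_solution_def
  proof (intro conjI ballI)
    show "y 0 = y0" using y_eq[OF T0(2), of 0] T0 x(1) by simp
    show "norm (y t) \<noteq> 1" if t: "t \<in> {0..<T}" for t
    proof -
      obtain T' z where z: "t < T'" "forced_solution v y0 T' z" using ex[of t] t by auto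
      have "y t = z t" by (rule y_eq[OF z(2)]) (use z t in auto)
      thus ?thesis using z t by (auto simp: forced_solution_def)
    qed
    fix b assume b: "b \<in> {0<..<T}"
    obtain T' z where z: "b < T'" "forced_solution v y0 T' z" using ex[of b] b by auto
    have yz: "y t = z t" if "t \<in> {0..b}" for t by (rule y_eq[OF z(2)]) (use z that in auto)
    show "lip_primitive 0 b y (\<lambda>t. f2 (y t) + v t)"
      by (rule lip_primitive_cong[OF forced_solution_lip[OF z(2)]]) (use z yz in auto)
  qed (rule Tpos)
  have "\<exists>t\<in>{0..<T}. gap (y t) < \<epsilon>" if \<epsilon>: "\<epsilon> > 0" for \<epsilon>
  proof (rule ccontr)
    assume "\<not> ?thesis"
    hence far: "2 * (\<epsilon> / 2) \<le> gap (y t)" if "t \<in> {0..<T}" for t using that by force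
    obtain T' z where "T' > T" "forced_solution v y0 T' z"
      using forced_solution_continuation[OF sol v _ far] \<epsilon> by auto
    thus False using le by force
  qed
  thus ?thesis using that sol le by blast
qed

end

section \<open>Quenching times of admissible controls\<close>

lemma solution_times_measurable: "{t. 0 < t \<and> ereal t < T} \<in> sets lebesgue"
proof (cases T)
  case (real r)
  hence "{t. 0 < t \<and> ereal t < T} = {0<..<r}" by auto
  thus ?thesis by simp
next
  case PInf
  hence "{t. 0 < t \<and> ereal t < T} = {0<..}" by auto
  thus ?thesis by simp
qed simp

text \<open>Absolute continuity gives the integral equation, and the integral equation with a bounded integrand gives the Lipschitz property.\<close>
lemma solves_imp_forced_solution:
  assumes y: "solves B y0 u T y" and T': "0 < T'" "ereal T' \<le> T"
    and v: "bounded_forcing K v" and eq: "AE t in lebesgue. 0 \<le> t \<longrightarrow> B t *v u t = v t"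
  shows "forced_solution v y0 T' y"
  unfolding forced_solution_def
proof (intro conjI ballI)
  have lt: "ereal t < T" if "t < T'" for t using that T'(2) by (meson less_ereal.simps(1) less_le_trans)
  show "0 < T'" "y 0 = y0" using y T' by (auto simp: solves_def)
  show "norm (y t) \<noteq> 1" if "t \<in> {0..<T'}" for t using y that lt by (auto simp: solves_def)
  fix b assume b: "b \<in> {0<..<T'}"
  have "AE t in lebesgue_on {t. 0 < t \<and> ereal t < T}. (y has_vector_derivative (f2 (y t) + B t *v u t)) (at t)"
    using y by (simp add: solves_def)
  hence "AE t in lebesgue. t \<in> {t. 0 < t \<and> ereal t < T} \<longrightarrow> (y has_vector_derivative (f2 (y t) + B t *v u t)) (at t)"
    by (subst (asm) AE_restrict_space_iff) (use solution_times_measurable in auto)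
  moreover have "AE t in lebesgue. t \<noteq> (0::real)" by (rule AE_lebesgue_I[of "{0}"]) auto
  ultimately have der: "AE t in lebesgue. t \<in> {0..b} \<longrightarrow> (y has_vector_derivative (f2 (y t) + v t)) (at t)"
    using eq
  proof eventually_elim
    case (elim t)
    show ?case
    proof
      assume t: "t \<in> {0..b}"
      hence "0 < t" "ereal t < T" using elim(2) b lt[of t] by auto
      thus "(y has_vector_derivative (f2 (y t) + v t)) (at t)" using elim by auto
    qed
  qed
  have I: "((\<lambda>t. f2 (y t) + v t) has_integral (y t - y 0)) {0..t}" if t: "t \<in> {0..b}" for t
  proof (rule abs_continuous_primitive)
    have "\<forall>b\<ge>0. ereal b < T \<longrightarrow> abs_continuous_on {0..b} y" using y unfolding solves_def by blast
    moreover have "0 \<le> t" "ereal t < T" using t b lt[of t] by auto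
    ultimately show "abs_continuous_on {0..t} y" by blast
    show "AE s in lebesgue. s \<in> {0..t} \<longrightarrow> (y has_vector_derivative f2 (y s) + v s) (at s within {0..t})"
      using der
    proof eventually_elim
      case (elim s)
      show ?case
      proof
        assume "s \<in> {0..t}"
        hence "s \<in> {0..b}" using t by auto
        thus "(y has_vector_derivative f2 (y s) + v s) (at s within {0..t})"
          using elim has_vector_derivative_at_within by blast
      qed
    qed
  qed (use t in auto)
  have int: "(\<lambda>t. f2 (y t) + v t) integrable_on {0..b}" using I[of b] b by auto
  have yI: "y t = y 0 + integral {0..t} (\<lambda>t. f2 (y t) + v t)" if "t \<in> {0..b}" for t
    using integral_unique[OF I[OF that]] by simp
  have "continuous_on {0..b} (\<lambda>t. y 0 + integral {0..t} (\<lambda>t. f2 (y t) + v t))"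
    by (intro continuous_intros indefinite_integral_continuous_1 int)
  hence cont: "continuous_on {0..b} y"
    by (rule continuous_on_eq) (rule yI[symmetric])
  have "continuous_on {0..b} (\<lambda>t. f2 (y t))"
    by (rule f2_continuous_on[OF cont]) (use y b lt in \<open>auto simp: solves_def\<close>)
  then obtain P where P: "P > 0" "\<And>t. t \<in> {0..b} \<Longrightarrow> norm (f2 (y t)) \<le> P"
    using continuous_on_Icc_bounded by blast
  show "lip_primitive 0 b y (\<lambda>t. f2 (y t) + v t)"
  proof (rule lip_primitive_indefinite_integral[OF int])
    show "norm (f2 (y t) + v t) \<le> P + K" if "t \<in> {0..b}" for t
      using P(2)[OF that] v that by (intro norm_triangle_le add_mono) (auto simp: bounded_forcing_def)
  qed (rule yI)
qed

text \<open>The exceptional null sets of the intervals \<open>[0, b]\<close> with \<open>b < T\<close> are joined along a sequence that tends to \<open>T\<close>.\<close>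
lemma forced_solution_imp_solves:
  assumes y: "forced_solution v y0 T y" and eq: "AE t in lebesgue. 0 \<le> t \<longrightarrow> B t *v u t = v t"
  shows "solves B y0 u (ereal T) y"
  unfolding solves_def
proof (intro conjI allI impI)
  note A = y[unfolded forced_solution_def]
  have T: "T > 0" using A by simp
  show "0 < ereal T" "y 0 = y0" using A by auto
  show "norm (y t) \<noteq> 1" if "0 \<le> t" "ereal t < ereal T" for t using A that by auto
  show "abs_continuous_on {0..b} y" if b: "0 \<le> b" "ereal b < ereal T" for b
  proof -
    have "lip_primitive 0 b y (\<lambda>t. f2 (y t) + v t)" by (rule forced_solution_lip[OF y]) (use b in auto)
    thus ?thesis using lipschitz_on_imp_abs_continuous_on unfolding lip_primitive_def by blast
  qed
  have S: "{t. 0 < t \<and> ereal t < ereal T} = {0<..<T}" by auto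
  define b where "b n = T - T / (real n + 2)" for n :: nat
  have b: "b n < T" for n using T by (simp add: b_def)
  have "AE t in lebesgue. t \<in> {0..b n} \<longrightarrow> (y has_vector_derivative f2 (y t) + v t) (at t within {0..b n})" for n
    using forced_solution_lip[OF y, of 0 "b n"] b[of n] unfolding lip_primitive_def by simp
  hence "AE t in lebesgue. \<forall>n. t \<in> {0..b n} \<longrightarrow> (y has_vector_derivative f2 (y t) + v t) (at t within {0..b n})"
    by (simp add: AE_all_countable)
  with eq have "AE t in lebesgue. t \<in> {0<..<T} \<longrightarrow> (y has_vector_derivative (f2 (y t) + B t *v u t)) (at t)"
  proof eventually_elim
    case (elim t)
    show ?case
    proof
      assume t: "t \<in> {0<..<T}"
      obtain n where n: "T / (T - t) < real n" using reals_Archimedean2 by blast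
      have "T / (T - t) < real n + 2" using n by simp
      hence "T / (real n + 2) < T - t" using t T by (simp add: field_simps)
      hence tb: "t \<in> {0<..<b n}" using t by (simp add: b_def)
      hence "(y has_vector_derivative f2 (y t) + v t) (at t within {0..b n})" using elim(2) by auto
      hence "(y has_vector_derivative f2 (y t) + v t) (at t)"
        using tb by (simp add: at_within_Icc_at)
      thus "(y has_vector_derivative (f2 (y t) + B t *v u t)) (at t)" using elim(1) t by simp
    qed
  qed
  thus "AE t in lebesgue_on {t. 0 < t \<and> ereal t < ereal T}. (y has_vector_derivative (f2 (y t) + B t *v u t)) (at t)"
    unfolding S by (subst AE_restrict_space_iff) auto
qed

text \<open>The quenching time is the maximal time of existence: at any earlier time the trajectory has a positive gap, so the
field is bounded there, and at the maximal time the gap tends to zero.\<close>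
lemma (in quench_data) quenching_time_state:
  assumes v: "bounded_forcing K v" and eq: "AE t in lebesgue. 0 \<le> t \<longrightarrow> B t *v u t = v t"
  shows "forced_solution v y0 (T_q B y0 u) (state B y0 u)"
    "\<And>\<epsilon>. \<epsilon> > 0 \<Longrightarrow> \<exists>t\<in>{0..<T_q B y0 u}. gap (state B y0 u t) < \<epsilon>"
proof -
  obtain T y where y: "forced_solution v y0 T y" "\<And>\<epsilon>. \<epsilon> > 0 \<Longrightarrow> \<exists>t\<in>{0..<T}. gap (y t) < \<epsilon>"
    and max: "\<And>T' y'. forced_solution v y0 T' y' \<Longrightarrow> T' \<le> T"
    using maximal_solution[OF v] by blast
  have T: "T > 0" using y(1) by (simp add: forced_solution_def)
  have Tmax: "T_max B y0 u = ereal T"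
    unfolding T_max_def
  proof (rule antisym)
    show "Sup {T. \<exists>y. solves B y0 u T y} \<le> ereal T"
    proof (rule Sup_least, safe)
      fix S z assume z: "solves B y0 u S z"
      show "S \<le> ereal T"
      proof (rule ccontr)
        assume "\<not> S \<le> ereal T"
        hence "ereal T < S" by simp
        then obtain r where r: "ereal T < ereal r" "ereal r < S" using ereal_dense2 by blast
        have "forced_solution v y0 r z"
          by (rule solves_imp_forced_solution[OF z _ _ v eq]) (use r T in auto)
        thus False using max r by force
      qed
    qed
    show "ereal T \<le> Sup {T. \<exists>y. solves B y0 u T y}"
      by (rule Sup_upper) (use forced_solution_imp_solves[OF y(1) eq] in blast)
  qed
  have "solves B y0 u (T_max B y0 u) (state B y0 u)"
    unfolding state_def by (rule someI[of _ y]) (use forced_solution_imp_solves[OF y(1) eq] Tmax in simp)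
  hence st: "forced_solution v y0 T (state B y0 u)"
    by (rule solves_imp_forced_solution[OF _ T _ v eq]) (simp add: Tmax)
  define z where "z = state B y0 u"
  note st = st[folded z_def]
  have zy: "z t = y t" if "t \<in> {0..<T}" for t
    by (rule forced_solution_unique[OF st y(1) v]) (use that in auto)
  have zgap: "\<exists>t\<in>{0..<T}. gap (z t) < \<epsilon>" if "\<epsilon> > 0" for \<epsilon>
    using y(2)[OF that] zy by auto
  note bnd = forced_solution_bounds[OF st v]
  have nf: "norm (f2 (z t)) = norm (z t) / gap (z t)" if t: "t \<in> {0..<T}" for t
    using bnd(1)[OF t] by (simp add: f2_eq abs_gap)
  have Q: "is_quenching_time B y0 u T"
    unfolding is_quenching_time_def z_def[symmetric]
  proof (intro conjI ballI)
    show "ereal T \<le> T_max B y0 u" by (simp add: Tmax)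
    show "norm (z t) \<noteq> 1" if "t \<in> {0..<T}" for t using st that by (auto simp: forced_solution_def)
    show "filterlim (\<lambda>t. norm (f2 (z t))) at_top (at_left T)"
      unfolding filterlim_at_top
    proof
      fix Z :: real
      define \<epsilon> where "\<epsilon> = c / (\<bar>Z\<bar> + 1)"
      have \<epsilon>: "\<epsilon> > 0" using c_pos by (simp add: \<epsilon>_def)
      obtain s where s: "s \<in> {0..<T}" "gap (z s) < \<epsilon>" using zgap[OF \<epsilon>] by blast
      have "\<forall>\<^sub>F t in at_left T. t \<in> {s<..<T}" using s by (intro eventually_at_left_real) auto
      thus "\<forall>\<^sub>F t in at_left T. Z \<le> norm (f2 (z t))"
      proof eventually_elim
        case (elim t)
        hence t: "t \<in> {0..<T}" using s by auto
        have g: "gap (z t) < \<epsilon>" "0 < gap (z t)" using gap_antimono[OF st v, of s t] s elim bnd(1)[OF t] by auto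
        have "Z \<le> c / \<epsilon>" using c_pos by (simp add: \<epsilon>_def)
        also have "\<dots> \<le> norm (z t) / gap (z t)" using g bnd(3)[OF t] c_pos by (intro frac_le) auto
        finally show ?case using nf[OF t] by simp
      qed
    qed
  qed (rule T)
  have uniq: "T' = T" if Q': "is_quenching_time B y0 u T'" for T'
  proof (rule ccontr)
    assume "T' \<noteq> T"
    moreover have "T' \<le> T" "0 < T'" using Q' by (auto simp: is_quenching_time_def Tmax)
    ultimately have T': "T' \<in> {0<..<T}" by auto
    define C where "C = (1 + gap y0) / gap (z T')"
    have "filterlim (\<lambda>t. norm (f2 (z t))) at_top (at_left T')" using Q' by (simp add: is_quenching_time_def z_def)
    hence "\<forall>\<^sub>F t in at_left T'. C + 1 \<le> norm (f2 (z t))" by (simp add: filterlim_at_top)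
    moreover have "\<forall>\<^sub>F t in at_left T'. t \<in> {0<..<T'}" using T' by (intro eventually_at_left_real) auto
    ultimately have "\<forall>\<^sub>F t in at_left T'. False"
    proof eventually_elim
      case (elim t)
      have t: "t \<in> {0..<T}" using elim T' by auto
      have "norm (z t) / gap (z t) \<le> C"
        unfolding C_def using gap_antimono[OF st v, of t T'] elim T' bnd(1)[of T'] bnd(4)[OF t] gap0_pos
        by (intro frac_le) auto
      thus ?case using elim nf[OF t] by simp
    qed
    thus False by simp
  qed
  have "T_q B y0 u = T" unfolding T_q_def using Q uniq by (rule the_equality)
  thus "forced_solution v y0 (T_q B y0 u) (state B y0 u)"
    "\<And>\<epsilon>. \<epsilon> > 0 \<Longrightarrow> \<exists>t\<in>{0..<T_q B y0 u}. gap (state B y0 u t) < \<epsilon>"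
    using st zgap by (auto simp: z_def)
qed

lemma matrix_vector_measurable:
  assumes "A \<in> borel_measurable M" "x \<in> borel_measurable M"
  shows "(\<lambda>t. (A t :: real^'n^'m) *v x t) \<in> borel_measurable M"
proof (rule borel_measurable_continuous_Pair[OF assms])
  have "continuous_on UNIV (\<lambda>p :: (real^'n^'m) \<times> (real^'n). \<chi> i. \<Sum>j\<in>UNIV. fst p $ i $ j * snd p $ j)"
    by (intro continuous_intros)
  thus "continuous_on UNIV (\<lambda>p. (fst p :: real^'n^'m) *v snd p)"
    by (simp add: matrix_vector_mult_def)
qed

text \<open>The hypotheses of the theorem. They yield an instance of \<open>quench_data\<close> with \<open>\<sigma> = sgn (1 - norm y0)\<close>.\<close>
locale control_problem =
  fixes B :: "real \<Rightarrow> real^2^2" and \<rho>\<^sub>0 :: real and y0 :: "real^2"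
  assumes BL: "B \<in> L_infinity" and B0: "\<not> (AE s in half_line. B s = 0)"
    and \<rho>: "\<rho>\<^sub>0 > 0" and y0: "y0 \<in> S_f2 B \<rho>\<^sub>0"
begin

abbreviation "K \<equiv> K0 B \<rho>\<^sub>0"

lemma onorm_matrix_bound: "norm (A *v x) \<le> onorm ((*v) A) * norm x" for A :: "real^2^2"
  by (rule onorm) (rule matrix_vector_mul_bounded_linear)

text \<open>A vanishing essential supremum would make almost every \<open>B s\<close> the zero matrix.\<close>
lemma ess_norm_real: "ess_norm B = ereal (real_of_ereal (ess_norm B))" "0 < real_of_ereal (ess_norm B)"
proof -
  have AE: "AE s in half_line. ereal (onorm ((*v) (B s))) \<le> ess_norm B"
    unfolding ess_norm_def by (rule esssup_AE)
  have pos: "0 < ess_norm B"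
  proof (rule ccontr)
    assume "\<not> 0 < ess_norm B"
    hence le: "ess_norm B \<le> 0" by simp
    have "AE s in half_line. B s = 0"
      using AE
    proof eventually_elim
      case (elim s)
      have "ereal (onorm ((*v) (B s))) \<le> 0" using elim le by (rule order_trans)
      hence "onorm ((*v) (B s)) \<le> 0" by simp
      hence "norm (B s *v x) \<le> 0" for x
        using onorm_matrix_bound[of "B s" x] mult_nonpos_nonneg[of "onorm ((*v) (B s))" "norm x"] norm_ge_zero[of x] by linarith
      thus ?case by (simp add: matrix_eq)
    qed
    thus False using B0 by simp
  qed
  have "ess_norm B < \<infinity>" using BL by (simp add: L_infinity_def)
  with pos show "ess_norm B = ereal (real_of_ereal (ess_norm B))" "0 < real_of_ereal (ess_norm B)"
    by (cases "ess_norm B"; simp)+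
qed

lemma K_pos: "K > 0"
  using ess_norm_real \<rho> by (simp add: K0_def)

sublocale quench_data K "sgn (1 - norm y0)" y0
proof
  have K2: "2 * K + 1 > 0" using K_pos by simp
  consider (inside) "1 - 1 / (2 * K + 1) < norm y0" "norm y0 < 1" | (outside) "1 < norm y0" "norm y0 < 1 + 1 / (2 * K)"
    using y0 unfolding S_f2_def by auto
  hence "sgn (1 - norm y0) \<in> {-1, 1} \<and> 0 < sgn (1 - norm y0) * (1 - norm y0)
      \<and> 2 * K * (sgn (1 - norm y0) * (1 - norm y0)) < norm y0"
  proof cases
    case inside
    have "(1 - norm y0) * (2 * K + 1) < 1" using inside K2 by (simp add: field_simps)
    thus ?thesis using inside by (simp add: algebra_simps)
  next
    case outside
    have "(norm y0 - 1) * (2 * K) < 1" using outside K_pos by (simp add: field_simps)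
    thus ?thesis using outside by (simp add: algebra_simps)
  qed
  thus "sgn (1 - norm y0) \<in> {-1, 1}" "0 < sgn (1 - norm y0) * (1 - norm y0)"
    "2 * K * (sgn (1 - norm y0) * (1 - norm y0)) < norm y0" by auto
qed (rule K_pos)

text \<open>The product \<open>B u\<close> with the exceptional values, which form a null set of times, replaced by zero.\<close>
definition forcing :: "(real \<Rightarrow> real^2) \<Rightarrow> real \<Rightarrow> real^2" where
  "forcing u t = (if norm (B t *v u t) \<le> K then B t *v u t else 0)"

lemma bounded_forcing_forcing:
  assumes "u \<in> U_ad \<rho>\<^sub>0"
  shows "bounded_forcing K (forcing u)"
  unfolding bounded_forcing_def
proof (intro conjI allI impI)
  have [measurable]: "(\<lambda>t. B t *v u t) \<in> borel_measurable half_line"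
    using BL assms by (intro matrix_vector_measurable) (auto simp: L_infinity_def U_ad_def)
  show "forcing u \<in> borel_measurable half_line" unfolding forcing_def by measurable
  show "norm (forcing u t) \<le> K" for t using K_pos by (simp add: forcing_def)
qed

lemma AE_half_line: "(AE t in half_line. P t) \<longleftrightarrow> (AE t in lebesgue. 0 \<le> t \<longrightarrow> P t)"
  by (subst AE_restrict_space_iff) auto

lemma forcing_AE:
  assumes "u \<in> U_ad \<rho>\<^sub>0"
  shows "AE t in lebesgue. 0 \<le> t \<longrightarrow> B t *v u t = forcing u t"
proof -
  have "AE s in half_line. ereal (onorm ((*v) (B s))) \<le> ess_norm B"
    unfolding ess_norm_def by (rule esssup_AE)
  moreover have "AE t in half_line. norm (u t) \<le> \<rho>\<^sub>0" using assms by (simp add: U_ad_def)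
  ultimately have "AE t in half_line. B t *v u t = forcing u t"
  proof eventually_elim
    case (elim t)
    have "onorm ((*v) (B t)) \<le> real_of_ereal (ess_norm B)"
      using elim(1) by (subst (asm) ess_norm_real(1)) simp
    hence "onorm ((*v) (B t)) * norm (u t) \<le> real_of_ereal (ess_norm B) * \<rho>\<^sub>0"
      using elim(2) ess_norm_real(2) by (intro mult_mono) auto
    hence "norm (B t *v u t) \<le> K" using onorm_matrix_bound[of "B t" "u t"] unfolding K0_def by linarith
    thus ?case by (simp add: forcing_def)
  qed
  thus ?thesis by (simp add: AE_half_line)
qed

lemma quenching_state:
  assumes "u \<in> U_ad \<rho>\<^sub>0"
  shows "forced_solution (forcing u) y0 (T_q B y0 u) (state B y0 u)"
    "\<And>\<epsilon>. \<epsilon> > 0 \<Longrightarrow> \<exists>t\<in>{0..<T_q B y0 u}. gap (state B y0 u t) < \<epsilon>"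
  using quenching_time_state[OF bounded_forcing_forcing[OF assms] forcing_AE[OF assms]] by blast+

lemma T_q_bounds:
  assumes "u \<in> U_ad \<rho>\<^sub>0"
  shows "0 < T_q B y0 u" "T_q B y0 u \<le> (2 * K + 1) * (norm y0 - 1)\<^sup>2 / (2 * K)"
proof -
  show "0 < T_q B y0 u" using quenching_state(1)[OF assms] by (simp add: forced_solution_def)
  have "T_q B y0 u \<le> (gap y0)\<^sup>2 / c"
    by (rule forced_solution_time_bound[OF quenching_state(1)[OF assms] bounded_forcing_forcing[OF assms]])
  moreover have "(gap y0)\<^sup>2 = (norm y0 - 1)\<^sup>2"
    by (subst power2_abs[symmetric], subst abs_gap[symmetric]) (simp add: power2_commute)
  ultimately show "T_q B y0 u \<le> (2 * K + 1) * (norm y0 - 1)\<^sup>2 / (2 * K)"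
    by (simp add: c_def mult.commute)
qed

lemma optimal_time_le:
  assumes "u \<in> U_ad \<rho>\<^sub>0"
  shows "optimal_time B \<rho>\<^sub>0 y0 \<le> T_q B y0 u"
  unfolding optimal_time_def
  by (rule cINF_lower[OF _ assms]) (use T_q_bounds(1) in \<open>auto intro!: bdd_belowI[of _ 0] less_imp_le\<close>)

lemma optimal_time_bound: "optimal_time B \<rho>\<^sub>0 y0 \<le> (2 * K + 1) * (norm y0 - 1)\<^sup>2 / (2 * K)"
proof -
  have "(\<lambda>_. 0) \<in> U_ad \<rho>\<^sub>0" using \<rho> by (simp add: U_ad_def)
  thus ?thesis using optimal_time_le T_q_bounds(2) order_trans by blast
qed

end

section \<open>Time reversal, rotations and quenching trajectories\<close>

lemma continuous_on_interval_upto: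
  fixes f :: "real \<Rightarrow> 'a::topological_space"
  assumes "\<And>b. b \<in> {a..<T} \<Longrightarrow> continuous_on {a..b} f"
  shows "continuous_on {a..<T} f"
  unfolding continuous_on_eq_continuous_within
proof
  fix t assume t: "t \<in> {a..<T}"
  define b where "b = (t + T) / 2"
  have b: "b \<in> {a..<T}" "t < b" using t by (auto simp: b_def)
  have "continuous (at t within {a..b}) f" using assms[OF b(1)] t b by (simp add: continuous_on_eq_continuous_within)
  moreover have "at t within {a..<T} = at t within {a..b}"
    by (rule at_within_nhd[of _ "{..<b}"]) (use b t in auto)
  ultimately show "continuous (at t within {a..<T}) f" by (simp add: continuous_within)
qed

lemma has_integral_time_reversal:
  fixes f :: "real \<Rightarrow> 'a::euclidean_space"
  assumes "(f has_integral i) {a..b}"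
  shows "((\<lambda>s. f (T - s)) has_integral i) {T - b..T - a}"
proof -
  have "((\<lambda>x. f ((-1) *\<^sub>R x + T)) has_integral (1 / (\<bar>-1\<bar> ^ DIM(real))) *\<^sub>R i)
      ((\<lambda>x. (1 / (-1)) *\<^sub>R x + - ((1 / (-1)) *\<^sub>R T)) ` cbox a b)"
    by (rule has_integral_affinity) (use assms in auto)
  moreover have "(\<lambda>x. (1 / (-1)) *\<^sub>R x + - ((1 / (-1)) *\<^sub>R T)) ` cbox a b = {T - b..T - a}"
  proof -
    have "(\<lambda>x. (1 / (-1)) *\<^sub>R x + - ((1 / (-1)) *\<^sub>R T)) = (\<lambda>x. T - x)" by auto
    thus ?thesis by simp
  qed
  ultimately show ?thesis by (simp add: algebra_simps)
qed

lemma has_integral_inverse_sqrt: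
  assumes "0 \<le> b"
  shows "((\<lambda>s. C / sqrt s) has_integral 2 * C * sqrt b) {0..b}"
proof -
  have "((\<lambda>s. C / sqrt s) has_integral 2 * C * sqrt b - 2 * C * sqrt 0) {0..b}"
  proof (rule fundamental_theorem_of_calculus_interior[OF assms])
    show "((\<lambda>s. 2 * C * sqrt s) has_vector_derivative C / sqrt x) (at x)" if "x \<in> {0<..<b}" for x
      unfolding has_real_derivative_iff_has_vector_derivative[symmetric] using that
      by (auto intro!: derivative_eq_intros simp: field_simps)
  qed (auto intro!: continuous_intros)
  thus ?thesis by simp
qed

lemma has_integral_inverse_sqrt_left:
  assumes "t \<le> T"
  shows "((\<lambda>s. C / sqrt (T - s)) has_integral 2 * C * sqrt (T - t)) {t..T}"
proof -
  have "((\<lambda>s. C / sqrt (T - s)) has_integral 2 * C * sqrt (T - t)) {T - (T - t)..T - 0}"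
    by (rule has_integral_time_reversal[OF has_integral_inverse_sqrt]) (use assms in auto)
  thus ?thesis by simp
qed

text \<open>Rotation by a right angle. Together with the position vector it forms a moving orthogonal frame. Both vectors have the
same length, and the Jacobian of \<open>f2\<close> is diagonal in this frame.\<close>
definition rot :: "real^2 \<Rightarrow> real^2" where
  "rot y = (\<chi> i. if i = 1 then - y $ 2 else y $ 1)"

lemma rot_nth [simp]: "rot y $ 1 = - y $ 2" "rot y $ 2 = y $ 1"
  by (simp_all add: rot_def)

lemma inner_vec2: "(x :: real^2) \<bullet> y = x $ 1 * y $ 1 + x $ 2 * y $ 2"
  by (simp add: inner_vec_def UNIV_2)

lemma rot_simps [simp]: "y \<bullet> rot y = 0" "rot y \<bullet> y = 0" "norm (rot y) = norm y" "rot (rot y) = - y"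
  by (simp_all add: inner_vec2 norm_eq_sqrt_inner vec_eq_iff forall_2 add.commute)

lemma bounded_linear_rot: "bounded_linear rot"
  by (rule linear_conv_bounded_linear[THEN iffD1], rule linearI) (simp_all add: vec_eq_iff forall_2)

lemma rot_add: "rot (x + y) = rot x + rot y" and rot_scaleR: "rot (a *\<^sub>R x) = a *\<^sub>R rot x"
  by (simp_all add: vec_eq_iff forall_2)

lemma rot_decomposition:
  assumes "y \<noteq> 0"
  shows "v = ((y \<bullet> v) / (norm y)\<^sup>2) *\<^sub>R y + ((rot y \<bullet> v) / (norm y)\<^sup>2) *\<^sub>R rot y"
proof -
  have n: "(norm y)\<^sup>2 = y $ 1 * y $ 1 + y $ 2 * y $ 2" by (simp add: power2_norm_eq_inner inner_vec2)
  have "(norm y)\<^sup>2 *\<^sub>R v = (y \<bullet> v) *\<^sub>R y + (rot y \<bullet> v) *\<^sub>R rot y"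
    by (simp add: n vec_eq_iff forall_2 inner_vec2 algebra_simps)
  hence "(1 / (norm y)\<^sup>2) *\<^sub>R ((norm y)\<^sup>2 *\<^sub>R v) = (1 / (norm y)\<^sup>2) *\<^sub>R ((y \<bullet> v) *\<^sub>R y + (rot y \<bullet> v) *\<^sub>R rot y)"
    by simp
  thus ?thesis using assms by (simp add: scaleR_add_right)
qed

text \<open>A trajectory followed up to its quenching time \<open>T\<close>.\<close>
locale quenching_trajectory = quench_data +
  fixes v :: "real \<Rightarrow> real^2" and T :: real and y :: "real \<Rightarrow> real^2"
  assumes v: "bounded_forcing K v" and y: "forced_solution v y0 T y"
    and quench: "\<And>\<epsilon>. \<epsilon> > 0 \<Longrightarrow> \<exists>t\<in>{0..<T}. gap (y t) < \<epsilon>"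
begin

lemmas bounds = forced_solution_bounds[OF y v]

lemma T_pos: "T > 0" using y by (simp add: forced_solution_def)

text \<open>The decay of the squared gap, read backwards from the quenching time. It makes \<open>1 / gap\<close> integrable in time.\<close>
lemma gap_ge_sqrt:
  assumes t: "t \<in> {0..<T}"
  shows "c * (T - t) \<le> (gap (y t))\<^sup>2" "sqrt c * sqrt (T - t) \<le> gap (y t)"
proof -
  have "T - t \<le> (gap (y t))\<^sup>2 / c"
  proof (rule dense_le)
    fix h assume h: "h < T - t"
    show "h \<le> (gap (y t))\<^sup>2 / c"
    proof (cases "h \<ge> 0")
      case True
      have "(gap (y (t + h)))\<^sup>2 + c * (t + h - t) \<le> (gap (y t))\<^sup>2"
        by (rule gap_square_decay[OF y v]) (use True h t in auto)
      moreover have "t + h - t = h" by simp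
      ultimately have "(gap (y (t + h)))\<^sup>2 + c * h \<le> (gap (y t))\<^sup>2" by simp
      hence "c * h \<le> (gap (y t))\<^sup>2" using zero_le_power2[of "gap (y (t + h))"] by linarith
      thus ?thesis using c_pos by (simp add: le_divide_eq mult.commute)
    next
      case False
      have "0 \<le> (gap (y t))\<^sup>2 / c" using c_pos by simp
      thus ?thesis using False by linarith
    qed
  qed
  thus 1: "c * (T - t) \<le> (gap (y t))\<^sup>2" using c_pos by (simp add: le_divide_eq mult.commute)
  have "sqrt (c * (T - t)) \<le> gap (y t)"
    using 1 bounds(1)[OF t] by (intro real_le_lsqrt) auto
  thus "sqrt c * sqrt (T - t) \<le> gap (y t)" by (simp add: real_sqrt_mult)
qed

lemma inverse_gap_le:
  assumes t: "t \<in> {0..<T}"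
  shows "1 / gap (y t) \<le> (1 / sqrt c) / sqrt (T - t)"
proof -
  have "1 / gap (y t) \<le> 1 / (sqrt c * sqrt (T - t))"
    using gap_ge_sqrt(2)[OF t] c_pos t by (intro frac_le) auto
  thus ?thesis by simp
qed

lemma gap_tendsto_0: "((\<lambda>t. gap (y t)) \<longlongrightarrow> 0) (at_left T)"
proof (rule tendstoI)
  fix \<epsilon> :: real assume "\<epsilon> > 0"
  then obtain s where s: "s \<in> {0..<T}" "gap (y s) < \<epsilon>" using quench by blast
  have "\<forall>\<^sub>F t in at_left T. t \<in> {s<..<T}" using s by (intro eventually_at_left_real) auto
  thus "\<forall>\<^sub>F t in at_left T. dist (gap (y t)) 0 < \<epsilon>"
  proof eventually_elim
    case (elim t)
    have "gap (y t) \<le> gap (y s)" by (rule gap_antimono[OF y v]) (use s elim in auto)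
    thus ?case using s elim bounds(1)[of t] by auto
  qed
qed

lemma continuous_y: "continuous_on {0..<T} y"
proof (rule continuous_on_interval_upto)
  show "continuous_on {0..b} y" if "b \<in> {0..<T}" for b
    by (rule lip_primitive_continuous[OF forced_solution_lip[OF y]]) (use that in auto)
qed

end

section \<open>The adjoint state in moving coordinates\<close>

context quenching_trajectory
begin

definition radial_rate :: "real \<Rightarrow> real" where "radial_rate t = (y t \<bullet> v t) / (norm (y t))\<^sup>2"
definition turning_rate :: "real \<Rightarrow> real" where "turning_rate t = (rot (y t) \<bullet> v t) / (norm (y t))\<^sup>2"

text \<open>The adjoint equation for \<open>\<psi> = (1 - norm y) * a * y + q * rot y\<close>, written as a linear system for the pair \<open>(a, q)\<close>. The factor
\<open>1 - norm y\<close> removes the terms of order \<open>1 / gap\<^sup>2\<close>; all coefficients are bounded by a multiple of \<open>1 / gap\<close>.\<close>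
definition polar_coeff :: "real \<Rightarrow> real \<times> real \<Rightarrow> real \<times> real" where
  "polar_coeff t x =
    (1 / (1 - norm (y t)) * (fst x * ((2 * norm (y t) - 1) * radial_rate t - 2) + snd x * turning_rate t),
     - snd x * (2 * (1 / (1 - norm (y t))) + radial_rate t) - (1 - norm (y t)) * fst x * turning_rate t)"

definition polar_const where
  "polar_const = (3 + 2 * gap y0) * (K / c) + K / c + 4 + gap y0 * (K / c) + (gap y0)\<^sup>2 * (K / c)"

lemma polar_const_pos: "polar_const > 0"
  unfolding polar_const_def using gap0_pos K c_pos by (intro add_pos_nonneg add_nonneg_pos) auto

lemma rate_bounds:
  assumes t: "t \<in> {0..<T}"
  shows "\<bar>radial_rate t\<bar> \<le> K / c" "\<bar>turning_rate t\<bar> \<le> K / c"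
proof -
  have n: "norm (y t) > 0" using bounds(6)[OF t] by simp
  have vK: "norm (v t) \<le> K" using v t by (auto simp: bounded_forcing_def)
  have gen: "\<bar>(w \<bullet> v t) / (norm (y t))\<^sup>2\<bar> \<le> K / c" if "norm w = norm (y t)" for w
  proof -
    have "\<bar>w \<bullet> v t\<bar> \<le> norm (y t) * K"
      using Cauchy_Schwarz_ineq2[of w "v t"] mult_left_mono[OF vK norm_ge_zero[of "y t"]] that by simp
    hence "\<bar>w \<bullet> v t\<bar> / (norm (y t))\<^sup>2 \<le> (norm (y t) * K) / (norm (y t))\<^sup>2"
      by (intro divide_right_mono) auto
    also have "\<dots> = K / norm (y t)" using n by (simp add: power2_eq_square)
    also have "\<dots> \<le> K / c" using bounds(3)[OF t] c_pos K by (intro frac_le) auto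
    finally show ?thesis by (simp add: abs_div_pos)
  qed
  show "\<bar>radial_rate t\<bar> \<le> K / c" "\<bar>turning_rate t\<bar> \<le> K / c"
    unfolding radial_rate_def turning_rate_def by (rule gen; simp)+
qed

lemma snd_polar_coeff_bound:
  assumes t: "t \<in> {0..<T}"
  shows "\<bar>snd (polar_coeff t x)\<bar> \<le> \<bar>snd x\<bar> * ((2 + gap y0 * (K / c)) / gap (y t)) + gap (y t) * \<bar>fst x\<bar> * (K / c)"
proof -
  define G \<kappa> where "G = gap (y t)" and "\<kappa> = K / c"
  have G: "0 < G" "G \<le> gap y0" and \<kappa>: "\<kappa> > 0" using bounds(1,2)[OF t] K c_pos by (auto simp: G_def \<kappa>_def)
  have ag: "\<bar>1 / (1 - norm (y t))\<bar> = 1 / G" "\<bar>1 - norm (y t)\<bar> = G"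
    using abs_gap[of "y t"] G by (auto simp: G_def)
  note rates = rate_bounds[OF t, folded \<kappa>_def]
  have "\<bar>2 * (1 / (1 - norm (y t))) + radial_rate t\<bar> \<le> 2 * \<bar>1 / (1 - norm (y t))\<bar> + \<kappa>"
    using rates(1) by linarith
  also have "\<dots> \<le> (2 + gap y0 * \<kappa>) / G" unfolding ag using G \<kappa> by (simp add: field_simps)
  finally have 1: "\<bar>snd x\<bar> * \<bar>2 * (1 / (1 - norm (y t))) + radial_rate t\<bar> \<le> \<bar>snd x\<bar> * ((2 + gap y0 * \<kappa>) / G)"
    by (intro mult_left_mono) auto
  have 2: "G * \<bar>fst x\<bar> * \<bar>turning_rate t\<bar> \<le> G * \<bar>fst x\<bar> * \<kappa>"
    using rates(2) G by (intro mult_left_mono) auto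
  have "\<bar>snd (polar_coeff t x)\<bar> \<le> \<bar>snd x\<bar> * \<bar>2 * (1 / (1 - norm (y t))) + radial_rate t\<bar> + G * \<bar>fst x\<bar> * \<bar>turning_rate t\<bar>"
    unfolding polar_coeff_def snd_conv ag(2)[symmetric] abs_mult[symmetric] abs_minus_cancel
    by (rule order_trans[OF abs_triangle_ineq4]) (simp add: abs_mult)
  thus ?thesis using 1 2 unfolding G_def \<kappa>_def by linarith
qed

lemma polar_coeff_bound:
  assumes t: "t \<in> {0..<T}"
  shows "norm (polar_coeff t x) \<le> polar_const / gap (y t) * norm x"
proof -
  define G \<kappa> N where "G = gap (y t)" and "\<kappa> = K / c" and "N = norm x"
  have G: "0 < G" "G \<le> gap y0" and \<kappa>: "\<kappa> > 0" and N: "N \<ge> 0"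
    using bounds(1,2)[OF t] K c_pos by (auto simp: G_def \<kappa>_def N_def)
  have ag: "\<bar>1 / (1 - norm (y t))\<bar> = 1 / G" using abs_gap[of "y t"] G by (auto simp: G_def)
  note rates = rate_bounds[OF t, folded \<kappa>_def]
  have comp: "\<bar>fst x\<bar> \<le> N" "\<bar>snd x\<bar> \<le> N"
    using norm_fst_le[of "fst x" "snd x"] norm_snd_le[of "snd x" "fst x"] by (auto simp: N_def)
  have A1: "\<bar>fst (polar_coeff t x)\<bar> \<le> 1 / G * (N * ((3 + 2 * gap y0) * \<kappa> + 2) + N * \<kappa>)"
  proof -
    have "2 * norm (y t) - 1 \<le> 3 + 2 * gap y0" "- (2 * norm (y t) - 1) \<le> 3 + 2 * gap y0"
      using bounds(4)[OF t] gap0_pos norm_ge_zero[of "y t"] by linarith+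
    hence "\<bar>2 * norm (y t) - 1\<bar> \<le> 3 + 2 * gap y0" by (rule abs_leI)
    hence "\<bar>(2 * norm (y t) - 1) * radial_rate t\<bar> \<le> (3 + 2 * gap y0) * \<kappa>"
      unfolding abs_mult using rates gap0_pos by (intro mult_mono) auto
    hence i: "\<bar>(2 * norm (y t) - 1) * radial_rate t - 2\<bar> \<le> (3 + 2 * gap y0) * \<kappa> + 2" by linarith
    have "\<bar>fst x * ((2 * norm (y t) - 1) * radial_rate t - 2) + snd x * turning_rate t\<bar>
        \<le> N * ((3 + 2 * gap y0) * \<kappa> + 2) + N * \<kappa>"
      by (rule order_trans[OF abs_triangle_ineq add_mono]; unfold abs_mult)
        (use comp i rates N in \<open>auto intro!: mult_mono\<close>)
    thus ?thesis unfolding polar_coeff_def fst_conv abs_mult ag using G by (intro mult_left_mono) auto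
  qed
  have A2: "\<bar>snd (polar_coeff t x)\<bar> \<le> N * ((2 + gap y0 * \<kappa>) / G) + N * ((gap y0)\<^sup>2 * \<kappa> / G)"
  proof -
    have "G * G \<le> gap y0 * gap y0" using G gap0_pos by (intro mult_mono) auto
    hence "G * \<kappa> \<le> (gap y0)\<^sup>2 * \<kappa> / G" using G \<kappa> by (simp add: field_simps power2_eq_square)
    hence "\<bar>fst x\<bar> * (G * \<kappa>) \<le> N * ((gap y0)\<^sup>2 * \<kappa> / G)" using comp N G \<kappa> by (intro mult_mono) auto
    moreover have "\<bar>snd x\<bar> * ((2 + gap y0 * \<kappa>) / G) \<le> N * ((2 + gap y0 * \<kappa>) / G)"
      using comp G \<kappa> gap0_pos by (intro mult_right_mono) auto
    ultimately show ?thesis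
      using snd_polar_coeff_bound[OF t, of x] unfolding G_def[symmetric] \<kappa>_def[symmetric] by (simp add: mult_ac)
  qed
  have "norm (polar_coeff t x) \<le> \<bar>fst (polar_coeff t x)\<bar> + \<bar>snd (polar_coeff t x)\<bar>"
    using norm_Pair_le[of "fst (polar_coeff t x)" "snd (polar_coeff t x)"] by simp
  also have "\<dots> \<le> 1 / G * (N * ((3 + 2 * gap y0) * \<kappa> + 2) + N * \<kappa>) + (N * ((2 + gap y0 * \<kappa>) / G) + N * ((gap y0)\<^sup>2 * \<kappa> / G))"
    using A1 A2 by (rule add_mono)
  also have "\<dots> = polar_const / G * N"
    unfolding polar_const_def \<kappa>_def[symmetric] using G by (simp add: field_simps)
  finally show ?thesis by (simp add: G_def N_def)
qed

lemma polar_coeff_diff: "polar_coeff t x - polar_coeff t x' = polar_coeff t (x - x')"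
  by (simp add: polar_coeff_def prod_eq_iff algebra_simps diff_divide_distrib)

definition polar_mass where "polar_mass = polar_const / sqrt c"

lemma polar_mass_pos: "polar_mass > 0"
  using polar_const_pos c_pos by (simp add: polar_mass_def)

lemma polar_coeff_rate:
  assumes t: "t \<in> {0..<T}"
  shows "polar_const / gap (y t) \<le> polar_mass / sqrt (T - t)"
  using mult_left_mono[OF inverse_gap_le[OF t] less_imp_le[OF polar_const_pos]] by (simp add: polar_mass_def)

lemma polar_coeff_integrable:
  assumes z: "continuous_on {0..T} z"
  shows "(\<lambda>t. polar_coeff t (z t)) absolutely_integrable_on {0..<T}"
proof -
  have sub: "{0..<T} \<subseteq> {0..}" by auto
  have [measurable]: "v \<in> borel_measurable (lebesgue_on {0..<T})"
    using v measurable_restrict_mono[OF _ sub] unfolding bounded_forcing_def by blast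
  have [measurable]: "y \<in> borel_measurable (lebesgue_on {0..<T})"
    by (rule continuous_imp_measurable_on_sets_lebesgue[OF continuous_y]) simp
  have [measurable]: "(\<lambda>t. rot (y t)) \<in> borel_measurable (lebesgue_on {0..<T})"
    by (rule continuous_imp_measurable_on_sets_lebesgue)
      (auto intro!: bounded_linear.continuous_on[OF bounded_linear_rot] continuous_y)
  have zc: "continuous_on {0..<T} z" by (rule continuous_on_subset[OF z]) auto
  have [measurable]: "(\<lambda>t. fst (z t)) \<in> borel_measurable (lebesgue_on {0..<T})" "(\<lambda>t. snd (z t)) \<in> borel_measurable (lebesgue_on {0..<T})"
    by (rule continuous_imp_measurable_on_sets_lebesgue; auto intro!: continuous_intros zc)+
  obtain P where P: "P > 0" "\<And>t. t \<in> {0..T} \<Longrightarrow> norm (z t) \<le> P"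
    using continuous_on_Icc_bounded[OF z] by blast
  show ?thesis
  proof (rule measurable_bounded_by_integrable_imp_absolutely_integrable)
    show "(\<lambda>t. polar_coeff t (z t)) \<in> borel_measurable (lebesgue_on {0..<T})"
      unfolding polar_coeff_def radial_rate_def turning_rate_def by (intro borel_measurable_Pair) measurable
    have "(\<lambda>t. (polar_mass * P) / sqrt (T - t)) integrable_on {0..T}"
      using has_integral_inverse_sqrt_left[of 0 T "polar_mass * P"] T_pos by auto
    thus "(\<lambda>t. (polar_mass * P) / sqrt (T - t)) integrable_on {0..<T}"
      by (rule integrable_spike_set) (auto intro: negligible_subset[of "{T}"])
    fix t assume t: "t \<in> {0..<T}"
    have "norm (polar_coeff t (z t)) \<le> polar_const / gap (y t) * norm (z t)" by (rule polar_coeff_bound[OF t])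
    also have "\<dots> \<le> (polar_mass / sqrt (T - t)) * P"
      using polar_coeff_rate[OF t] P(2)[of t] t polar_mass_pos P(1) by (intro mult_mono) auto
    finally show "norm (polar_coeff t (z t)) \<le> (polar_mass * P) / sqrt (T - t)" by simp
  qed simp
qed

text \<open>The system is solved backwards from the quenching time with \<open>a = 1\<close> and \<open>q = 0\<close>, that is, with a radial
terminal direction. Time is reversed to reduce this to an initial value problem.\<close>
lemma polar_solution:
  obtains x where "continuous_on {0..T} x" "x T = (1, 0)"
    "\<And>b. b < T \<Longrightarrow> lip_primitive 0 b x (\<lambda>t. polar_coeff t (x t))"
    "\<And>t. t \<in> {0..T} \<Longrightarrow> ((\<lambda>s. if s < T then polar_coeff s (x s) else 0) has_integral ((1, 0) - x t)) {t..T}"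
proof -
  define F where "F s z = (if 0 < s then - polar_coeff (T - s) z else 0)" for s z
  have Fint: "(\<lambda>s. F s (z s)) integrable_on {0..T}" if z: "continuous_on {0..T} z" for z
  proof -
    have "continuous_on {0..T} (\<lambda>t. z (T - t))"
      by (rule continuous_on_compose2[OF z]) (auto intro!: continuous_intros)
    hence "(\<lambda>t. polar_coeff t (z (T - t))) integrable_on {0..<T}"
      using polar_coeff_integrable set_lebesgue_integral_eq_integral(1) by blast
    hence "(\<lambda>t. polar_coeff t (z (T - t))) integrable_on {0..T}"
      by (rule integrable_spike_set) (auto intro: negligible_subset[of "{T}"])
    hence "(\<lambda>s. - polar_coeff (T - s) (z (T - (T - s)))) integrable_on {T - T..T - 0}"
      using has_integral_time_reversal integrable_neg unfolding integrable_on_def by blast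
    hence "(\<lambda>s. - polar_coeff (T - s) (z s)) integrable_on {0..T}" by simp
    thus ?thesis
      by (rule integrable_spike[of _ _ "{0}"]) (auto simp: F_def)
  qed
  obtain X where X: "continuous_on {0..T} X"
    "\<And>t. t \<in> {0..T} \<Longrightarrow> X t = (1, 0) + integral {0..t} (\<lambda>s. F s (X s))"
  proof (rule caratheodory_existence[of T "\<lambda>_. (1, 0)" F "\<lambda>s. polar_mass / sqrt s" "\<lambda>s. 2 * polar_mass * sqrt s"])
    show "norm (F s a - F s b) \<le> polar_mass / sqrt s * norm (a - b)" if s: "s \<in> {0..T}" for s a b
    proof (cases "0 < s")
      case True
      hence t: "T - s \<in> {0..<T}" using s by auto
      have "norm (F s a - F s b) = norm (polar_coeff (T - s) (a - b))"
        using True by (simp add: F_def norm_minus_commute flip: polar_coeff_diff)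
      also have "\<dots> \<le> polar_const / gap (y (T - s)) * norm (a - b)" by (rule polar_coeff_bound[OF t])
      also have "\<dots> \<le> polar_mass / sqrt s * norm (a - b)"
        using polar_coeff_rate[OF t] by (intro mult_right_mono) auto
      finally show ?thesis .
    qed (use polar_mass_pos s in \<open>auto simp: F_def\<close>)
    show "((\<lambda>s. 2 * polar_mass * sqrt s) has_real_derivative polar_mass / sqrt s) (at s)" if "s \<in> {0<..<T}" for s
      using that by (auto intro!: derivative_eq_intros simp: field_simps)
  qed (use T_pos polar_mass_pos Fint in \<open>auto intro!: continuous_intros\<close>)
  define x where "x t = X (T - t)" for t
  have xc: "continuous_on {0..T} x"
    unfolding x_def by (rule continuous_on_compose2[OF X(1)]) (auto intro!: continuous_intros)
  have xT: "x T = (1, 0)" using X(2)[of 0] T_pos by (simp add: x_def)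
  define h where "h s = (if s < T then polar_coeff s (x s) else 0)" for s
  have hx: "(h has_integral ((1, 0) - x t)) {t..T}" if t: "t \<in> {0..T}" for t
  proof -
    have "((\<lambda>s. F s (X s)) has_integral integral {0..T - t} (\<lambda>s. F s (X s))) {0..T - t}"
      using t by (intro integrable_integral integrable_on_subinterval[OF Fint[OF X(1)]]) auto
    hence "((\<lambda>s. F s (X s)) has_integral (x t - (1, 0))) {0..T - t}"
      using X(2)[of "T - t"] t by (simp add: x_def)
    from has_integral_neg[OF has_integral_time_reversal[OF this, of T]]
    have "((\<lambda>s. - F (T - s) (X (T - s))) has_integral ((1, 0) - x t)) {t..T}" by simp
    moreover have "(\<lambda>s. - F (T - s) (X (T - s))) = h"
      by (auto simp: F_def h_def x_def fun_eq_iff)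
    ultimately show ?thesis by simp
  qed
  have "lip_primitive 0 b x (\<lambda>t. polar_coeff t (x t))" if b: "b < T" for b
  proof (cases "b \<ge> 0")
    case True
    obtain P where P: "P > 0" "\<And>t. t \<in> {0..T} \<Longrightarrow> norm (x t) \<le> P"
      using continuous_on_Icc_bounded[OF xc] by blast
    have hI: "h integrable_on {0..T}" using hx[of 0] T_pos by auto
    have "lip_primitive 0 b x h"
    proof (rule lip_primitive_indefinite_integral)
      show "h integrable_on {0..b}" by (rule integrable_on_subinterval[OF hI]) (use b in auto)
      show "norm (h t) \<le> polar_const / gap (y b) * P" if t: "t \<in> {0..b}" for t
      proof -
        have t': "t \<in> {0..<T}" using t b by auto
        have "gap (y b) \<le> gap (y t)" by (rule gap_antimono[OF y v]) (use t b in auto)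
        hence "polar_const / gap (y t) \<le> polar_const / gap (y b)"
          using polar_const_pos bounds(1)[of b] True b by (intro frac_le) auto
        hence "polar_const / gap (y t) * norm (x t) \<le> polar_const / gap (y b) * P"
          using P t t' bounds(1)[OF t'] bounds(1)[of b] True b polar_const_pos by (intro mult_mono) auto
        thus ?thesis using polar_coeff_bound[OF t', of "x t"] t' by (simp add: h_def)
      qed
      fix t assume t: "t \<in> {0..b}"
      have "integral {0..t} h + integral {t..T} h = integral {0..T} h"
        by (rule Henstock_Kurzweil_Integration.integral_combine[OF _ _ hI]) (use t b in auto)
      moreover have "integral {t..T} h = (1, 0) - x t" "integral {0..T} h = (1, 0) - x 0"
        using hx[of t] hx[of 0] t b T_pos by (auto intro!: integral_unique)
      ultimately show "x t = x 0 + integral {0..t} h" by (simp add: algebra_simps)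
    qed
    thus ?thesis by (rule lip_primitive_cong) (use b in \<open>auto simp: h_def\<close>)
  next
    case False
    thus ?thesis by (auto simp: lip_primitive_def intro!: exI[of _ 0] lipschitz_onI)
  qed
  thus ?thesis using that[of x] xc xT hx unfolding h_def by blast
qed

text \<open>The value at \<open>T\<close> has to be set separately, since a trajectory is not determined at its quenching time.\<close>
definition adjoint_of :: "(real \<Rightarrow> real \<times> real) \<Rightarrow> real \<Rightarrow> real^2" where
  "adjoint_of x t = (if t < T then ((1 - norm (y t)) * fst (x t)) *\<^sub>R y t + snd (x t) *\<^sub>R rot (y t) else 0)"

text \<open>On the left stands the derivative of \<open>adjoint_of x\<close> by the product rule. Both sides are expanded in the frame
\<open>y\<close>, \<open>rot y\<close>; there the Jacobian is diagonal.\<close>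
lemma adjoint_derivative:
  assumes t: "t \<in> {0..<T}"
  shows "((1 - norm (y t)) * fst (polar_coeff t (x t)) - (y t \<bullet> (f2 (y t) + v t)) / norm (y t) * fst (x t)) *\<^sub>R y t
     + ((1 - norm (y t)) * fst (x t)) *\<^sub>R (f2 (y t) + v t)
     + (snd (polar_coeff t (x t)) *\<^sub>R rot (y t) + snd (x t) *\<^sub>R rot (f2 (y t) + v t))
     = - f2_jac (y t) (adjoint_of x t)"
proof -
  define r a q where "r = norm (y t)" and "a = fst (x t)" and "q = snd (x t)"
  define \<nu> \<omega> g where "\<nu> = radial_rate t" and "\<omega> = turning_rate t" and "g = 1 / (1 - r)"
  have nz: "y t \<noteq> 0" using bounds(6)[OF t] .
  have r: "r \<noteq> 0" "1 - r \<noteq> 0" using nz bounds(1)[OF t] by (auto simp: r_def gap_def)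
  have g: "(1 - r) * g = 1" using r by (simp add: g_def)
  have vd: "v t = \<nu> *\<^sub>R y t + \<omega> *\<^sub>R rot (y t)"
    unfolding \<nu>_def \<omega>_def radial_rate_def turning_rate_def by (rule rot_decomposition[OF nz])
  have yy: "y t \<bullet> y t = r * r" by (simp add: r_def dot_square_norm power2_eq_square)
  have fy: "f2 (y t) = g *\<^sub>R y t" by (simp add: f2_eq g_def r_def)
  have A: "fst (polar_coeff t (x t)) = g * (a * ((2 * r - 1) * \<nu> - 2) + q * \<omega>)"
    "snd (polar_coeff t (x t)) = - q * (2 * g + \<nu>) - (1 - r) * a * \<omega>"
    by (simp_all add: polar_coeff_def a_def q_def r_def g_def \<nu>_def \<omega>_def)
  have rd: "(y t \<bullet> (f2 (y t) + v t)) / norm (y t) = r * (g + \<nu>)"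
    unfolding fy vd r_def[symmetric] using r by (simp add: inner_add_right yy field_simps)
  have L: "((1 - r) * (g * (a * ((2 * r - 1) * \<nu> - 2) + q * \<omega>)) - r * (g + \<nu>) * a) *\<^sub>R y t
     + ((1 - r) * a) *\<^sub>R (g *\<^sub>R y t + v t)
     + ((- q * (2 * g + \<nu>) - (1 - r) * a * \<omega>) *\<^sub>R rot (y t) + q *\<^sub>R rot (g *\<^sub>R y t + v t))
    = ((1 - r) * (g * (a * ((2 * r - 1) * \<nu> - 2) + q * \<omega>)) - r * (g + \<nu>) * a + (1 - r) * a * (g + \<nu>) - q * \<omega>) *\<^sub>R y t
      + ((1 - r) * a * \<omega> + (- q * (2 * g + \<nu>) - (1 - r) * a * \<omega>) + q * (g + \<nu>)) *\<^sub>R rot (y t)"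
    unfolding vd rot_add rot_scaleR rot_simps by (simp add: vec_eq_iff forall_2 algebra_simps)
  have X1: "(1 - r) * (g * (a * ((2 * r - 1) * \<nu> - 2) + q * \<omega>)) - r * (g + \<nu>) * a + (1 - r) * a * (g + \<nu>) - q * \<omega> = - (a * g)"
    using g by algebra
  have X2: "(1 - r) * a * \<omega> + (- q * (2 * g + \<nu>) - (1 - r) * a * \<omega>) + q * (g + \<nu>) = - (q * g)"
    by (simp add: algebra_simps)
  have psi: "adjoint_of x t = ((1 - r) * a) *\<^sub>R y t + q *\<^sub>R rot (y t)"
    using t by (simp add: adjoint_of_def r_def a_def q_def)
  have ip: "y t \<bullet> adjoint_of x t = (1 - r) * a * (r * r)"
    unfolding psi by (simp add: inner_add_right yy)
  have J: "f2_jac (y t) (adjoint_of x t) = (a * g) *\<^sub>R y t + (q * g) *\<^sub>R rot (y t)"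
  proof -
    have "f2_jac (y t) (adjoint_of x t) = g *\<^sub>R adjoint_of x t + ((1 - r) * a * (r * r) / (r * (1 - r)\<^sup>2)) *\<^sub>R y t"
      unfolding f2_jac_def ip by (simp add: g_def r_def)
    also have "(1 - r) * a * (r * r) / (r * (1 - r)\<^sup>2) = a * r * g"
    proof -
      have "s * a * (r * r) / (r * s\<^sup>2) = a * r * (1 / s)" if "s \<noteq> 0" for s
        using r(1) that by (simp add: field_simps power2_eq_square)
      thus ?thesis unfolding g_def using r(2) .
    qed
    also have "g *\<^sub>R adjoint_of x t + (a * r * g) *\<^sub>R y t = (((1 - r) * g) * a + a * r * g) *\<^sub>R y t + (q * g) *\<^sub>R rot (y t)"
      unfolding psi by (simp add: algebra_simps scaleR_add_left scaleR_diff_left)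
    also have "((1 - r) * g) * a + a * r * g = a * g" by (simp add: algebra_simps)
    finally show ?thesis .
  qed
  show ?thesis
    unfolding A rd unfolding r_def[symmetric] a_def[symmetric] q_def[symmetric] unfolding fy L X1 X2 J by simp
qed

lemma adjoint_lip_primitive:
  assumes x: "\<And>b. b < T \<Longrightarrow> lip_primitive 0 b x (\<lambda>t. polar_coeff t (x t))" and b: "b < T"
  shows "lip_primitive 0 b (adjoint_of x) (\<lambda>t. - f2_jac (y t) (adjoint_of x t))"
proof -
  note Y = forced_solution_lip[OF y order_refl b]
  have nz: "y t \<noteq> 0" if "t \<in> {0..b}" for t using bounds(6)[of t] that b by auto
  note r = lip_primitive_norm[OF Y nz]
  have one: "lip_primitive 0 b (\<lambda>t. 1 - norm (y t)) (\<lambda>t. 0 - (y t \<bullet> (f2 (y t) + v t)) / norm (y t))"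
    by (rule lip_primitive_diff[OF lip_primitive_const r])
  note a = lip_primitive_linear[OF x[OF b] bounded_linear_fst] and q = lip_primitive_linear[OF x[OF b] bounded_linear_snd]
  note R = lip_primitive_linear[OF Y bounded_linear_rot]
  show ?thesis
  proof (rule lip_primitive_cong[OF lip_primitive_add[OF lip_primitive_scaleR[OF lip_primitive_mult[OF one a] Y] lip_primitive_scaleR[OF q R]]], goal_cases)
    case (1 t)
    thus ?case using b by (simp add: adjoint_of_def)
  next
    case (2 t)
    hence "t \<in> {0..<T}" using b by auto
    from adjoint_derivative[OF this, of x, symmetric] show ?case by (simp add: algebra_simps)
  qed
qed

text \<open>The equation for \<open>q\<close> has a source bounded by the gap, a homogeneous part with integrable coefficients, and
terminal value zero. At a maximum of \<open>\<bar>q\<bar>\<close> on \<open>[t, T]\<close> the homogeneous part accounts for at most one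
half, so \<open>q\<close> is of the order of the gap.\<close>
lemma tangential_part_small:
  assumes xc: "continuous_on {0..T} x" and xT: "x T = (1, 0)"
    and hx: "\<And>t. t \<in> {0..T} \<Longrightarrow> ((\<lambda>s. if s < T then polar_coeff s (x s) else 0) has_integral ((1, 0) - x t)) {t..T}"
  obtains \<kappa> \<tau> where "\<kappa> > 0" "\<tau> \<in> {0..<T}" "\<And>t. t \<in> {\<tau>..<T} \<Longrightarrow> \<bar>snd (x t)\<bar> \<le> \<kappa> * gap (y t)"
proof -
  obtain P where P: "P > 0" "\<And>t. t \<in> {0..T} \<Longrightarrow> norm (x t) \<le> P"
    using continuous_on_Icc_bounded[OF xc] by blast
  define m where "m = polar_mass"
  have m: "m > 0" using polar_mass_pos by (simp add: m_def)
  define \<kappa> where "\<kappa> = 2 * P * (K / c) * T"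
  have \<kappa>: "\<kappa> > 0" using P K c_pos T_pos by (simp add: \<kappa>_def)
  \<comment> \<open>From this time on the primitive \<open>2 * m * sqrt (T - t)\<close> of the coefficient bound is at most one half.\<close>
  define \<tau> where "\<tau> = max 0 (T - (1 / (4 * m))\<^sup>2)"
  have \<tau>: "\<tau> \<in> {0..<T}" using T_pos m by (auto simp: \<tau>_def)
  have "\<bar>snd (x t)\<bar> \<le> \<kappa> * gap (y t)" if t: "t \<in> {\<tau>..<T}" for t
  proof -
    have t0: "t \<in> {0..<T}" using t \<tau> by auto
    define G where "G = gap (y t)"
    have G: "G > 0" using bounds(1)[OF t0] by (simp add: G_def)
    have "continuous_on {t..T} (\<lambda>s. \<bar>snd (x s)\<bar>)"
      using t0 by (intro continuous_intros continuous_on_subset[OF xc]) auto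
    from continuous_attains_sup[OF compact_Icc _ this] t0
    obtain s where s: "s \<in> {t..T}" and smax: "\<And>r. r \<in> {t..T} \<Longrightarrow> \<bar>snd (x r)\<bar> \<le> \<bar>snd (x s)\<bar>" by auto
    define S where "S = \<bar>snd (x s)\<bar>"
    have S0: "S \<ge> 0" by (simp add: S_def)
    have small: "2 * m * sqrt (T - s) \<le> 1 / 2"
    proof -
      have "T - s \<le> (1 / (4 * m))\<^sup>2" using s t by (auto simp: \<tau>_def)
      hence "sqrt (T - s) \<le> 1 / (4 * m)" using m by (intro real_le_lsqrt) auto
      thus ?thesis using m by (simp add: field_simps)
    qed
    have "((\<lambda>r. snd (if r < T then polar_coeff r (x r) else 0)) has_integral snd ((1, 0) - x s)) {s..T}"
      using has_integral_linear[OF hx[of s] bounded_linear_snd] s t0 by (simp add: o_def)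
    hence I: "((\<lambda>r. snd (if r < T then polar_coeff r (x r) else 0)) has_integral (- snd (x s))) {s..T}" by simp
    have J: "((\<lambda>r. (S * m) / sqrt (T - r) + G * P * (K / c)) has_integral (2 * (S * m) * sqrt (T - s) + G * P * (K / c) * (T - s))) {s..T}"
      using has_integral_add[OF has_integral_inverse_sqrt_left[of s T "S * m"] has_integral_const_real[of "G * P * (K / c)" s T]] s
      by (simp add: mult.commute)
    have "norm (integral {s..T} (\<lambda>r. snd (if r < T then polar_coeff r (x r) else 0)))
        \<le> integral {s..T} (\<lambda>r. (S * m) / sqrt (T - r) + G * P * (K / c))"
    proof (rule integral_norm_bound_integral)
      fix r assume r: "r \<in> {s..T}"
      show "norm (snd (if r < T then polar_coeff r (x r) else 0)) \<le> (S * m) / sqrt (T - r) + G * P * (K / c)"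
      proof (cases "r < T")
        case True
        hence r0: "r \<in> {0..<T}" using r s t0 by auto
        have "(2 + gap y0 * (K / c)) / gap (y r) \<le> polar_const / gap (y r)"
          using bounds(1)[OF r0] gap0_pos K c_pos unfolding polar_const_def by (intro divide_right_mono) auto
        also have "\<dots> \<le> m / sqrt (T - r)" unfolding m_def by (rule polar_coeff_rate[OF r0])
        finally have rate: "(2 + gap y0 * (K / c)) / gap (y r) \<le> m / sqrt (T - r)" .
        have "\<bar>snd (polar_coeff r (x r))\<bar> \<le> \<bar>snd (x r)\<bar> * ((2 + gap y0 * (K / c)) / gap (y r)) + gap (y r) * \<bar>fst (x r)\<bar> * (K / c)"
          by (rule snd_polar_coeff_bound[OF r0])
        also have "\<dots> \<le> S * (m / sqrt (T - r)) + G * P * (K / c)"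
        proof (intro add_mono mult_mono)
          show "\<bar>snd (x r)\<bar> \<le> S" unfolding S_def by (rule smax) (use r s in auto)
          show "(2 + gap y0 * (K / c)) / gap (y r) \<le> m / sqrt (T - r)" by (rule rate)
          show "gap (y r) \<le> G" unfolding G_def by (rule gap_antimono[OF y v]) (use r s r0 t0 in auto)
          have "\<bar>fst (x r)\<bar> \<le> norm (x r)" using norm_fst_le[of "fst (x r)" "snd (x r)"] by simp
          thus "\<bar>fst (x r)\<bar> \<le> P" using P(2)[of r] r0 by auto
        qed (use S0 G P K c_pos gap0_pos bounds(1)[OF r0] in auto)
        finally show ?thesis using True by simp
      next
        case False
        thus ?thesis using r G P K c_pos by simp
      qed
    qed (use I J in blast)+
    hence "S \<le> 2 * (S * m) * sqrt (T - s) + G * P * (K / c) * (T - s)"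
      unfolding integral_unique[OF I] integral_unique[OF J] by (simp add: S_def)
    also have "\<dots> = S * (2 * m * sqrt (T - s)) + G * P * (K / c) * (T - s)" by simp
    also have "\<dots> \<le> S * (1 / 2) + G * P * (K / c) * T"
      using small S0 G P K c_pos s t0 by (intro add_mono mult_left_mono) auto
    finally have "S \<le> 2 * (G * P * (K / c) * T)" by linarith
    also have "\<dots> = \<kappa> * G" by (simp add: \<kappa>_def)
    finally have "S \<le> \<kappa> * G" .
    thus ?thesis using smax[of t] t0 by (auto simp: S_def G_def)
  qed
  thus ?thesis using that \<kappa> \<tau> by blast
qed

text \<open>Besides solving the adjoint equation up to the quenching time, \<open>\<psi>\<close> is of the exact order of the gap and points
at the circle there. The last two estimates determine the sign of the remainder in the first variation.\<close>
lemma adjoint_exists: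
  obtains \<psi> c1 c2 \<tau> where "continuous_on {0..T} \<psi>" "\<psi> T = 0"
    "\<And>b. b < T \<Longrightarrow> lip_primitive 0 b \<psi> (\<lambda>t. - f2_jac (y t) (\<psi> t))"
    "\<And>t. t \<in> {0..<T} \<Longrightarrow> (\<lambda>s. f2_jac (y s) (\<psi> s)) absolutely_integrable_on {t..T}"
    "\<And>t. t \<in> {0..<T} \<Longrightarrow> \<psi> t = integral {t..T} (\<lambda>s. f2_jac (y s) (\<psi> s))"
    "c1 > 0" "c2 > 0" "\<tau> \<in> {0..<T}"
    "\<And>t. t \<in> {\<tau>..<T} \<Longrightarrow> norm (\<psi> t) \<le> c2 * gap (y t)"
    "\<And>t. t \<in> {\<tau>..<T} \<Longrightarrow> c1 * gap (y t) \<le> \<sigma> * (\<psi> t \<bullet> sgn (y t))"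
proof -
  obtain x where xc: "continuous_on {0..T} x" and xT: "x T = (1, 0)"
    and xl: "\<And>b. b < T \<Longrightarrow> lip_primitive 0 b x (\<lambda>t. polar_coeff t (x t))"
    and hx: "\<And>t. t \<in> {0..T} \<Longrightarrow> ((\<lambda>s. if s < T then polar_coeff s (x s) else 0) has_integral ((1, 0) - x t)) {t..T}"
    using polar_solution by blast
  obtain \<kappa> \<tau>1 where \<kappa>: "\<kappa> > 0" and \<tau>1: "\<tau>1 \<in> {0..<T}"
    and tang: "\<And>t. t \<in> {\<tau>1..<T} \<Longrightarrow> \<bar>snd (x t)\<bar> \<le> \<kappa> * gap (y t)"
    using tangential_part_small[OF xc xT hx] by blast
  obtain P where P: "P > 0" "\<And>t. t \<in> {0..T} \<Longrightarrow> norm (x t) \<le> P"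
    using continuous_on_Icc_bounded[OF xc] by blast
  have comp: "\<bar>fst (x t)\<bar> \<le> P" "\<bar>snd (x t)\<bar> \<le> P" if "t \<in> {0..T}" for t
    using norm_fst_le[of "fst (x t)" "snd (x t)"] norm_snd_le[of "snd (x t)" "fst (x t)"] P(2)[OF that] by auto
  define \<psi> where "\<psi> = adjoint_of x"
  have \<psi>_eq: "\<psi> t = ((1 - norm (y t)) * fst (x t)) *\<^sub>R y t + snd (x t) *\<^sub>R rot (y t)" if "t < T" for t
    using that by (simp add: \<psi>_def adjoint_of_def)
  have \<psi>T: "\<psi> T = 0" by (simp add: \<psi>_def adjoint_of_def)
  have \<psi>l: "lip_primitive 0 b \<psi> (\<lambda>t. - f2_jac (y t) (\<psi> t))" if "b < T" for b
    unfolding \<psi>_def by (rule adjoint_lip_primitive[OF xl that])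
  define R where "R = 1 + gap y0"
  have R: "R > 0" using gap0_pos by (simp add: R_def)
  have n\<psi>: "norm (\<psi> t) \<le> R * (P * gap (y t) + \<bar>snd (x t)\<bar>)" if t: "t \<in> {0..<T}" for t
  proof -
    have "norm (\<psi> t) \<le> \<bar>1 - norm (y t)\<bar> * \<bar>fst (x t)\<bar> * norm (y t) + \<bar>snd (x t)\<bar> * norm (y t)"
      using t \<psi>_eq[of t] by (auto intro!: norm_triangle_le simp: abs_mult)
    also have "\<dots> \<le> gap (y t) * P * R + \<bar>snd (x t)\<bar> * R"
      using bounds(1,4)[OF t] comp[of t] t P R unfolding abs_gap
      by (intro add_mono mult_mono) (auto simp: R_def)
    finally show ?thesis by (simp add: algebra_simps)
  qed
  define c2 where "c2 = R * (P + \<kappa>)"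
  have c2: "c2 > 0" using R P \<kappa> by (simp add: c2_def)
  have up: "norm (\<psi> t) \<le> c2 * gap (y t)" if t: "t \<in> {\<tau>1..<T}" for t
  proof -
    have "norm (\<psi> t) \<le> R * (P * gap (y t) + \<kappa> * gap (y t))"
    proof (rule order_trans[OF n\<psi>])
      show "R * (P * gap (y t) + \<bar>snd (x t)\<bar>) \<le> R * (P * gap (y t) + \<kappa> * gap (y t))"
        using tang[OF t] R by (intro mult_left_mono add_left_mono) auto
    qed (use t \<tau>1 in auto)
    thus ?thesis by (simp add: c2_def algebra_simps)
  qed
  have "continuous (at T within {0..T}) (\<lambda>t. fst (x t))"
    using continuous_on_fst[OF xc] T_pos by (simp add: continuous_on_eq_continuous_within)
  hence lim: "((\<lambda>t. fst (x t)) \<longlongrightarrow> 1) (at_left T)"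
    using T_pos xT by (simp add: continuous_within at_within_Icc_at_left)
  hence "\<forall>\<^sub>F t in at_left T. 1 / 2 < fst (x t)" by (rule order_tendstoD) simp
  then obtain \<tau>2 where \<tau>2: "\<tau>2 < T" "\<And>t. \<tau>2 < t \<Longrightarrow> t < T \<Longrightarrow> 1 / 2 < fst (x t)"
    unfolding eventually_at_left_field by blast
  define \<tau> where "\<tau> = max \<tau>1 ((max \<tau>2 0 + T) / 2)"
  have \<tau>: "\<tau> \<in> {0..<T}" "\<tau>1 \<le> \<tau>" "\<tau>2 < \<tau>" using \<tau>1 \<tau>2(1) T_pos by (auto simp: \<tau>_def max_def)
  define c1 where "c1 = c / 2"
  have low: "c1 * gap (y t) \<le> \<sigma> * (\<psi> t \<bullet> sgn (y t))" if t: "t \<in> {\<tau>..<T}" for t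
  proof -
    have t0: "t \<in> {0..<T}" using t \<tau> by auto
    have a: "1 / 2 \<le> fst (x t)" using \<tau>2(2)[of t] t \<tau> by auto
    have "\<psi> t \<bullet> sgn (y t) = (1 - norm (y t)) * fst (x t) * norm (y t)"
      using \<psi>_eq[of t] t0 bounds(6)[OF t0]
      by (simp add: inner_add_left sgn_div_norm dot_square_norm power2_eq_square)
    hence "\<sigma> * (\<psi> t \<bullet> sgn (y t)) = gap (y t) * fst (x t) * norm (y t)" by (simp add: gap_def)
    moreover have "gap (y t) * (1 / 2) * c \<le> gap (y t) * fst (x t) * norm (y t)"
      using a bounds(1,3)[OF t0] c_pos by (intro mult_mono) auto
    moreover have "c1 * gap (y t) = gap (y t) * (1 / 2) * c" by (simp add: c1_def)
    ultimately show ?thesis by (simp only:)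
  qed
  have Jb: "norm (f2_jac (y t) (\<psi> t)) \<le> (R * (P * gap y0 + P) + P * R\<^sup>2) / gap (y t)" if t: "t \<in> {0..<T}" for t
  proof -
    define G where "G = gap (y t)"
    have G: "0 < G" "G \<le> gap y0" using bounds(1,2)[OF t] by (auto simp: G_def)
    have n: "norm (y t) > 0" "norm (y t) \<le> R" using bounds(4,6)[OF t] by (auto simp: R_def)
    have ip: "y t \<bullet> \<psi> t = (1 - norm (y t)) * fst (x t) * (norm (y t))\<^sup>2"
      using \<psi>_eq[of t] t by (simp add: inner_add_right dot_square_norm)
    have s: "1 - norm (y t) \<noteq> 0" using G by (auto simp: G_def gap_def)
    have co: "(y t \<bullet> \<psi> t) / (norm (y t) * (1 - norm (y t))\<^sup>2) = fst (x t) * norm (y t) / (1 - norm (y t))"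
    proof -
      have "s * a * r\<^sup>2 / (r * s\<^sup>2) = a * r / s" if "s \<noteq> 0" "r \<noteq> 0" for s a r :: real
        using that by (simp add: field_simps power2_eq_square)
      thus ?thesis unfolding ip using s n by auto
    qed
    have "norm (f2_jac (y t) (\<psi> t)) \<le> 1 / G * norm (\<psi> t) + \<bar>fst (x t)\<bar> * norm (y t) / G * norm (y t)"
      unfolding f2_jac_def co
      by (rule norm_triangle_le) (simp add: abs_mult abs_gap abs_of_pos[OF G(1), unfolded G_def] G_def)
    also have "\<dots> \<le> 1 / G * (R * (P * gap y0 + P)) + P * R / G * R"
    proof (intro add_mono mult_left_mono)
      have "norm (\<psi> t) \<le> R * (P * G + \<bar>snd (x t)\<bar>)" using n\<psi>[OF t] by (simp add: G_def)
      also have "\<dots> \<le> R * (P * gap y0 + P)"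
        using R P G comp[of t] t by (intro mult_left_mono add_mono) auto
      finally show "norm (\<psi> t) \<le> R * (P * gap y0 + P)" .
      show "\<bar>fst (x t)\<bar> * norm (y t) / G * norm (y t) \<le> P * R / G * R"
        using comp[of t] t n R P G by (intro mult_mono divide_right_mono) auto
    qed (use G in auto)
    also have "\<dots> = (R * (P * gap y0 + P) + P * R\<^sup>2) / G" using G by (simp add: field_simps power2_eq_square)
    finally show ?thesis by (simp add: G_def)
  qed
  define Q where "Q = (R * (P * gap y0 + P) + P * R\<^sup>2) * (1 / sqrt c)"
  have Jb': "norm (f2_jac (y t) (\<psi> t)) \<le> Q / sqrt (T - t)" if t: "t \<in> {0..<T}" for t
  proof -
    have "(R * (P * gap y0 + P) + P * R\<^sup>2) * (1 / gap (y t)) \<le> (R * (P * gap y0 + P) + P * R\<^sup>2) * ((1 / sqrt c) / sqrt (T - t))"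
      using R P gap0_pos inverse_gap_le[OF t] by (intro mult_left_mono) auto
    thus ?thesis using Jb[OF t] by (simp add: Q_def)
  qed
  have \<psi>c0: "continuous_on {0..<T} \<psi>"
    by (rule continuous_on_interval_upto, rule lip_primitive_continuous, rule \<psi>l) auto
  have Jc: "continuous_on {0..<T} (\<lambda>t. f2_jac (y t) (\<psi> t))"
    unfolding f2_jac_def using bounds(6) bounds(1)
    by (intro continuous_intros continuous_y \<psi>c0) (force simp: gap_def)+
  have Jabs: "(\<lambda>s. f2_jac (y s) (\<psi> s)) absolutely_integrable_on {t..T}" if t: "t \<in> {0..<T}" for t
  proof -
    have "(\<lambda>s. f2_jac (y s) (\<psi> s)) absolutely_integrable_on {t..<T}"
    proof (rule measurable_bounded_by_integrable_imp_absolutely_integrable)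
      show "(\<lambda>s. f2_jac (y s) (\<psi> s)) \<in> borel_measurable (lebesgue_on {t..<T})"
        by (rule continuous_imp_measurable_on_sets_lebesgue[OF continuous_on_subset[OF Jc]]) (use t in auto)
      have "(\<lambda>s. Q / sqrt (T - s)) integrable_on {t..T}"
        using has_integral_inverse_sqrt_left[of t T Q] t by auto
      thus "(\<lambda>s. Q / sqrt (T - s)) integrable_on {t..<T}"
        by (rule integrable_spike_set) (auto intro: negligible_subset[of "{T}"])
      show "norm (f2_jac (y s) (\<psi> s)) \<le> Q / sqrt (T - s)" if "s \<in> {t..<T}" for s
        by (rule Jb') (use t that in auto)
    qed simp
    moreover have "negligible {s \<in> {t..<T} - {t..T}. f2_jac (y s) (\<psi> s) \<noteq> 0}"
      by (rule negligible_subset[of "{}"]) auto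
    moreover have "negligible {s \<in> {t..T} - {t..<T}. f2_jac (y s) (\<psi> s) \<noteq> 0}"
      by (rule negligible_subset[of "{T}"]) auto
    ultimately show ?thesis by (subst absolutely_integrable_spike_set_eq[of "{t..T}" "{t..<T}"])
  qed
  have \<psi>lim: "(\<psi> \<longlongrightarrow> 0) (at_left T)"
  proof (rule Lim_null_comparison)
    show "\<forall>\<^sub>F t in at_left T. norm (\<psi> t) \<le> c2 * gap (y t)"
      using eventually_at_left_real[of \<tau>1 T] \<tau>1 by (auto elim!: eventually_mono intro: up)
    show "((\<lambda>t. c2 * gap (y t)) \<longlongrightarrow> 0) (at_left T)"
      using tendsto_mult_left[OF gap_tendsto_0, of c2] by simp
  qed
  have \<psi>c: "continuous_on {0..T} \<psi>"
    unfolding continuous_on_eq_continuous_within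
  proof
    fix t assume t: "t \<in> {0..T}"
    show "continuous (at t within {0..T}) \<psi>"
    proof (cases "t = T")
      case True
      thus ?thesis using \<psi>lim \<psi>T T_pos by (simp add: continuous_within at_within_Icc_at_left)
    next
      case False
      hence "continuous (at t within {0..<T}) \<psi>" using \<psi>c0 t by (simp add: continuous_on_eq_continuous_within)
      moreover have "at t within {0..T} = at t within {0..<T}"
        by (rule at_within_nhd[of _ "{..<T}"]) (use False t in auto)
      ultimately show ?thesis by (simp add: continuous_within)
    qed
  qed
  have \<psi>I: "\<psi> t = integral {t..T} (\<lambda>s. f2_jac (y s) (\<psi> s))" if t: "t \<in> {0..<T}" for t
  proof -
    have int: "(\<lambda>s. f2_jac (y s) (\<psi> s)) integrable_on {t..T}"
      using Jabs[OF t] by (rule set_lebesgue_integral_eq_integral(1))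
    have "continuous_on {t..T} (\<lambda>b. integral {t..b} (\<lambda>s. f2_jac (y s) (\<psi> s)))"
      by (rule indefinite_integral_continuous_1[OF int])
    hence "((\<lambda>b. integral {t..b} (\<lambda>s. f2_jac (y s) (\<psi> s))) \<longlongrightarrow> integral {t..T} (\<lambda>s. f2_jac (y s) (\<psi> s))) (at_left T)"
      by (rule continuous_on_Icc_at_leftD) (use t in auto)
    moreover have "\<forall>\<^sub>F b in at_left T. integral {t..b} (\<lambda>s. f2_jac (y s) (\<psi> s)) = \<psi> t - \<psi> b"
    proof -
      have "\<forall>\<^sub>F b in at_left T. b \<in> {t<..<T}" using t by (intro eventually_at_left_real) auto
      thus ?thesis
      proof eventually_elim
        case (elim b)
        have "lip_primitive t b \<psi> (\<lambda>t. - f2_jac (y t) (\<psi> t))"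
          by (rule lip_primitive_subset[OF \<psi>l[of b]]) (use elim t in auto)
        from has_integral_neg[OF lip_primitive_integral[OF this]] elim
        have "((\<lambda>s. f2_jac (y s) (\<psi> s)) has_integral (\<psi> t - \<psi> b)) {t..b}" by simp
        thus ?case by (rule integral_unique)
      qed
    qed
    ultimately have "((\<lambda>b. \<psi> t - \<psi> b) \<longlongrightarrow> integral {t..T} (\<lambda>s. f2_jac (y s) (\<psi> s))) (at_left T)"
      by (rule Lim_transform_eventually)
    moreover have "((\<lambda>b. \<psi> t - \<psi> b) \<longlongrightarrow> \<psi> t - 0) (at_left T)"
      by (intro tendsto_diff tendsto_const \<psi>lim)
    ultimately show ?thesis using tendsto_unique trivial_limit_at_left_real by fastforce
  qed
  show ?thesis
  proof (rule that[OF \<psi>c \<psi>T \<psi>l Jabs \<psi>I _ c2 \<tau>(1) up low])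
    show "c1 > 0" using c_pos by (simp add: c1_def)
  qed (use \<tau> in auto)
qed

end

section \<open>The first variation of an optimal trajectory\<close>

lemma f2_jac_symmetric: "f2_jac y a \<bullet> b = a \<bullet> f2_jac y b"
  by (simp add: f2_jac_def inner_add_left inner_add_right inner_commute)

lemma angle_defect_le:
  assumes "0 < c" "c \<le> norm y" "c \<le> norm z"
  shows "angle_defect y z \<le> (norm (z - y))\<^sup>2 / (2 * c\<^sup>2)"
proof -
  have n: "norm y > 0" "norm z > 0" using assms by auto
  have "(norm (z - y))\<^sup>2 = (norm z)\<^sup>2 + (norm y)\<^sup>2 - 2 * (y \<bullet> z)"
    unfolding power2_norm_eq_inner by (simp add: inner_diff_left inner_diff_right inner_commute)
  moreover have "0 \<le> (norm z - norm y)\<^sup>2" by simp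
  ultimately have "norm y * norm z - y \<bullet> z \<le> (norm (z - y))\<^sup>2 / 2"
    by (simp add: power2_diff algebra_simps)
  hence "(norm y * norm z - y \<bullet> z) / (norm y * norm z) \<le> ((norm (z - y))\<^sup>2 / 2) / (norm y * norm z)"
    using n by (intro divide_right_mono) auto
  also have "\<dots> \<le> ((norm (z - y))\<^sup>2 / 2) / (c * c)"
    using assms n by (intro divide_left_mono mult_mono mult_pos_pos) auto
  finally show ?thesis using n by (simp add: angle_defect_def diff_divide_distrib power2_eq_square)
qed

lemma bounded_forcing_convex:
  assumes v: "bounded_forcing K v" and w: "bounded_forcing K w" and \<epsilon>: "0 \<le> \<epsilon>" "\<epsilon> \<le> 1"
  shows "bounded_forcing K (\<lambda>t. v t + \<epsilon> *\<^sub>R (w t - v t))"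
  unfolding bounded_forcing_def
proof (intro conjI allI impI)
  have [measurable]: "v \<in> borel_measurable half_line" "w \<in> borel_measurable half_line"
    using v w by (auto simp: bounded_forcing_def)
  show "(\<lambda>t. v t + \<epsilon> *\<^sub>R (w t - v t)) \<in> borel_measurable half_line" by measurable
  fix t :: real assume t: "0 \<le> t"
  have "v t + \<epsilon> *\<^sub>R (w t - v t) = (1 - \<epsilon>) *\<^sub>R v t + \<epsilon> *\<^sub>R w t" by (simp add: algebra_simps)
  also have "norm \<dots> \<le> (1 - \<epsilon>) * norm (v t) + \<epsilon> * norm (w t)"
    using \<epsilon> by (intro norm_triangle_le) auto
  also have "\<dots> \<le> (1 - \<epsilon>) * K + \<epsilon> * K"
    using v w t \<epsilon> by (intro add_mono mult_left_mono) (auto simp: bounded_forcing_def)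
  finally show "norm (v t + \<epsilon> *\<^sub>R (w t - v t)) \<le> K" by (simp add: algebra_simps)
qed

text \<open>A trajectory with an adjoint state as in \<open>adjoint_exists\<close>, and a competing forcing term \<open>w\<close>.\<close>
locale adjoint_trajectory = quenching_trajectory +
  fixes \<psi> :: "real \<Rightarrow> real^2" and c1 c2 \<tau>0 :: real and w :: "real \<Rightarrow> real^2"
  assumes \<psi>_cont: "continuous_on {0..T} \<psi>" and \<psi>_T: "\<psi> T = 0"
    and \<psi>_lip: "\<And>b. b < T \<Longrightarrow> lip_primitive 0 b \<psi> (\<lambda>t. - f2_jac (y t) (\<psi> t))"
    and c12: "c1 > 0" "c2 > 0" and \<tau>0: "\<tau>0 \<in> {0..<T}"
    and \<psi>_upper: "\<And>t. t \<in> {\<tau>0..<T} \<Longrightarrow> norm (\<psi> t) \<le> c2 * gap (y t)"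
    and \<psi>_lower: "\<And>t. t \<in> {\<tau>0..<T} \<Longrightarrow> c1 * gap (y t) \<le> \<sigma> * (\<psi> t \<bullet> sgn (y t))"
    and w: "bounded_forcing K w"
begin

definition perturbed :: "real \<Rightarrow> real \<Rightarrow> real^2" where
  "perturbed \<epsilon> t = v t + \<epsilon> *\<^sub>R (w t - v t)"

lemma perturbed_bounded: "0 \<le> \<epsilon> \<Longrightarrow> \<epsilon> \<le> 1 \<Longrightarrow> bounded_forcing K (perturbed \<epsilon>)"
  unfolding perturbed_def using bounded_forcing_convex[OF v w] by blast

lemma perturbed_close:
  assumes "0 \<le> \<epsilon>" "0 \<le> t"
  shows "norm (perturbed \<epsilon> t - v t) \<le> 2 * K * \<epsilon>"
proof -
  have "norm (w t - v t) \<le> K + K"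
    using v w assms by (intro norm_triangle_le_diff add_mono) (auto simp: bounded_forcing_def)
  thus ?thesis using assms mult_left_mono[of "norm (w t - v t)" "2 * K" \<epsilon>] by (simp add: perturbed_def mult.commute)
qed

abbreviation pairing :: "real \<Rightarrow> real" where
  "pairing \<equiv> \<lambda>t. \<psi> t \<bullet> (w t - v t)"

lemma pairing_absolutely_integrable: "pairing absolutely_integrable_on {0..T}"
proof -
  have sub: "{0..T} \<subseteq> {0..}" by auto
  have [measurable]: "v \<in> borel_measurable (lebesgue_on {0..T})" "w \<in> borel_measurable (lebesgue_on {0..T})"
    using v w measurable_restrict_mono[OF _ sub] unfolding bounded_forcing_def by blast+
  have [measurable]: "\<psi> \<in> borel_measurable (lebesgue_on {0..T})"
    by (rule continuous_imp_measurable_on_sets_lebesgue[OF \<psi>_cont]) simp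
  obtain P where P: "P > 0" "\<And>t. t \<in> {0..T} \<Longrightarrow> norm (\<psi> t) \<le> P"
    using continuous_on_Icc_bounded[OF \<psi>_cont] by blast
  show ?thesis
  proof (rule measurable_bounded_by_integrable_imp_absolutely_integrable[where g = "\<lambda>_. P * (2 * K)"])
    show "pairing \<in> borel_measurable (lebesgue_on {0..T})" by measurable
    fix t assume t: "t \<in> {0..T}"
    have "\<bar>\<psi> t \<bullet> (w t - v t)\<bar> \<le> norm (\<psi> t) * norm (w t - v t)" by (rule Cauchy_Schwarz_ineq2)
    also have "\<dots> \<le> P * (2 * K)"
      using P t perturbed_close[of 1 t] by (intro mult_mono) (auto simp: perturbed_def)
    finally show "norm (pairing t) \<le> P * (2 * K)" by simp
  qed auto
qed

lemma pairing_integrable: "pairing integrable_on {0..T}"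
  using pairing_absolutely_integrable by (rule set_lebesgue_integral_eq_integral(1))

text \<open>On a time interval that ends before quenching the perturbed trajectories keep a definite gap, by \<open>continuous_bootstrap\<close>; there the field
is Lipschitz and Gronwall's inequality applies.\<close>
lemma perturbation_small:
  assumes \<tau>: "\<tau> \<in> {0..<T}"
  obtains C \<epsilon>0 where "C > 0" "\<epsilon>0 > 0"
    "\<And>\<epsilon> z t. 0 < \<epsilon> \<Longrightarrow> \<epsilon> < \<epsilon>0 \<Longrightarrow> forced_solution (perturbed \<epsilon>) y0 T z \<Longrightarrow> t \<in> {0..\<tau>} \<Longrightarrow>
      norm (z t - y t) \<le> C * \<epsilon> \<and> gap (y \<tau>) / 2 \<le> gap (z t)"
proof -
  define \<delta> where "\<delta> = gap (y \<tau>) / 2"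
  have \<delta>: "\<delta> > 0" using bounds(1)[OF \<tau>] by (simp add: \<delta>_def)
  define L where "L = 1 / \<delta> + (1 + gap y0) / \<delta>\<^sup>2"
  have L: "L \<ge> 0" using \<delta> gap0_pos by (simp add: L_def)
  define C where "C = sqrt (exp ((2 * L + 1) * T) * (2 * K)\<^sup>2 * T)"
  have C: "C > 0" using K T_pos by (simp add: C_def)
  have C2: "C\<^sup>2 = exp ((2 * L + 1) * T) * (2 * K)\<^sup>2 * T" using T_pos by (simp add: C_def)
  define \<epsilon>0 where "\<epsilon>0 = \<delta> / C"
  have "norm (z t - y t) \<le> C * \<epsilon> \<and> \<delta> \<le> gap (z t)"
    if \<epsilon>: "0 < \<epsilon>" "\<epsilon> < \<epsilon>0" and z: "forced_solution (perturbed \<epsilon>) y0 T z" and t: "t \<in> {0..\<tau>}" for \<epsilon> z t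
  proof -
    have C\<epsilon>: "C * \<epsilon> < \<delta>" using \<epsilon> C by (simp add: \<epsilon>0_def field_simps)
    have close: "\<delta> \<le> gap (z r)" if r: "r \<in> {0..\<tau>}" "norm (z r - y r) \<le> \<delta>" for r
    proof -
      have "2 * \<delta> \<le> gap (y r)" using gap_antimono[OF y v, of r \<tau>] r \<tau> by (simp add: \<delta>_def)
      moreover have "\<bar>gap (z r) - gap (y r)\<bar> \<le> norm (z r - y r)"
        using norm_triangle_ineq3[of "z r" "y r"] \<sigma> by (auto simp: gap_def)
      ultimately show ?thesis using r(2) by linarith
    qed
    have est: "norm (z r - y r) \<le> C * \<epsilon>" if r: "r \<in> {0..\<tau>}" and small: "\<And>s. s \<in> {0..r} \<Longrightarrow> norm (z s - y s) \<le> \<delta>" for r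
    proof -
      have P: "lip_primitive 0 r (\<lambda>s. z s - y s) (\<lambda>s. (f2 (z s) + perturbed \<epsilon> s) - (f2 (y s) + v s))"
        by (intro lip_primitive_diff forced_solution_lip[OF y] forced_solution_lip[OF z]) (use r \<tau> in auto)
      have "(norm (z r - y r))\<^sup>2 \<le> exp ((2 * L + 1) * (r - 0)) * ((norm (z 0 - y 0))\<^sup>2 + (2 * K * \<epsilon>)\<^sup>2 * (r - 0))"
      proof (rule gronwall[OF P L])
        fix s assume s: "s \<in> {0..r}"
        hence s': "s \<in> {0..\<tau>}" "s \<in> {0..<T}" using r \<tau> by auto
        have "2 * \<delta> \<le> gap (y s)" using gap_antimono[OF y v, of s \<tau>] s' \<tau> by (simp add: \<delta>_def)
        hence "norm (f2 (z s) - f2 (y s)) \<le> L * norm (z s - y s)"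
          unfolding L_def using close[OF s'(1) small[OF s]] bounds(4)[OF s'(2)] \<delta>
          by (intro f2_lipschitz \<delta>) (auto simp: abs_gap)
        moreover have "norm (perturbed \<epsilon> s - v s) \<le> 2 * K * \<epsilon>" using perturbed_close[of \<epsilon> s] \<epsilon> s by auto
        moreover have "(f2 (z s) + perturbed \<epsilon> s) - (f2 (y s) + v s) = (f2 (z s) - f2 (y s)) + (perturbed \<epsilon> s - v s)"
          by simp
        ultimately show "norm ((f2 (z s) + perturbed \<epsilon> s) - (f2 (y s) + v s)) \<le> L * norm (z s - y s) + 2 * K * \<epsilon>"
          using norm_triangle_mono by metis
      qed (use K \<epsilon> r in auto)
      also have "norm (z 0 - y 0) = 0" using y z by (simp add: forced_solution_def)
      also have "exp ((2 * L + 1) * (r - 0)) * (0\<^sup>2 + (2 * K * \<epsilon>)\<^sup>2 * (r - 0)) \<le> exp ((2 * L + 1) * T) * ((2 * K * \<epsilon>)\<^sup>2 * T)"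
        using r \<tau> L by (intro mult_mono) (auto intro!: mult_left_mono)
      also have "\<dots> = (C * \<epsilon>)\<^sup>2" unfolding power_mult_distrib[of C] C2 by (simp add: power_mult_distrib)
      finally show ?thesis using C \<epsilon> by (auto intro: power2_le_imp_le)
    qed
    have small: "norm (z r - y r) < \<delta>" if r: "r \<in> {0..\<tau>}" for r
    proof (rule continuous_bootstrap[OF _ _ _ r])
      show "continuous_on {0..\<tau>} (\<lambda>t. norm (z t - y t))"
        using \<tau> by (intro continuous_intros lip_primitive_continuous[OF forced_solution_lip[OF y]]
            lip_primitive_continuous[OF forced_solution_lip[OF z]]) auto
      show "norm (z 0 - y 0) < \<delta>" using y z \<delta> by (simp add: forced_solution_def)
      show "norm (z t - y t) < \<delta>" if "t \<in> {0..\<tau>}" "\<And>s. s \<in> {0..t} \<Longrightarrow> norm (z s - y s) \<le> \<delta>" for t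
        using est[OF that] C\<epsilon> by linarith
    qed
    have "norm (z t - y t) \<le> C * \<epsilon>" by (rule est[OF t]) (use small t in \<open>auto intro: less_imp_le\<close>)
    moreover have "\<delta> \<le> gap (z t)" by (rule close[OF t less_imp_le[OF small[OF t]]])
    ultimately show ?thesis ..
  qed
  thus ?thesis using that[of C \<epsilon>0] C \<delta> unfolding \<delta>_def \<epsilon>0_def by auto
qed

text \<open>The linear parts cancel because the Jacobian is symmetric and \<open>\<psi>\<close> solves the adjoint equation.\<close>
lemma duality_pairing:
  assumes z: "forced_solution (perturbed \<epsilon>) y0 T z" and ab: "0 \<le> a" "b < T"
  shows "lip_primitive a b (\<lambda>t. \<psi> t \<bullet> (z t - y t)) (\<lambda>t. \<psi> t \<bullet> f2_rem (y t) (z t) + \<epsilon> * pairing t)"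
proof -
  have e: "lip_primitive a b (\<lambda>t. z t - y t) (\<lambda>t. (f2 (z t) + perturbed \<epsilon> t) - (f2 (y t) + v t))"
    by (intro lip_primitive_diff forced_solution_lip[OF y] forced_solution_lip[OF z] ab)
  have p: "lip_primitive a b \<psi> (\<lambda>t. - f2_jac (y t) (\<psi> t))"
    by (rule lip_primitive_subset[OF \<psi>_lip[OF ab(2)]]) (use ab in auto)
  show ?thesis
  proof (rule lip_primitive_cong[OF lip_primitive_inner[OF p e]], goal_cases)
    case (2 t)
    have "- f2_jac (y t) (\<psi> t) \<bullet> (z t - y t) = - (\<psi> t \<bullet> f2_jac (y t) (z t - y t))"
      by (simp add: f2_jac_symmetric)
    thus ?case by (simp add: f2_rem_def perturbed_def inner_diff_right inner_add_right algebra_simps)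
  qed simp
qed

lemma pairing_integral_split:
  assumes "0 \<le> s" "s \<le> t" "t \<le> T"
  shows "integral {0..s} pairing + integral {s..t} pairing = integral {0..t} pairing"
  by (rule Henstock_Kurzweil_Integration.integral_combine) (use assms integrable_on_subinterval[OF pairing_integrable, of 0 t] in auto)

lemma early_growth:
  assumes \<tau>: "\<tau> \<in> {0..<T}"
  obtains C \<epsilon>0 where "C > 0" "\<epsilon>0 > 0"
    "\<And>\<epsilon> z. 0 < \<epsilon> \<Longrightarrow> \<epsilon> < \<epsilon>0 \<Longrightarrow> forced_solution (perturbed \<epsilon>) y0 T z \<Longrightarrow>
      \<epsilon> * integral {0..\<tau>} pairing - C * \<epsilon>\<^sup>2 \<le> \<psi> \<tau> \<bullet> (z \<tau> - y \<tau>)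
      \<and> angle_defect (y \<tau>) (z \<tau>) \<le> C * \<epsilon>\<^sup>2"
proof -
  obtain C \<epsilon>0 where C: "C > 0" "\<epsilon>0 > 0"
    and close: "\<And>\<epsilon> z t. 0 < \<epsilon> \<Longrightarrow> \<epsilon> < \<epsilon>0 \<Longrightarrow> forced_solution (perturbed \<epsilon>) y0 T z \<Longrightarrow> t \<in> {0..\<tau>} \<Longrightarrow>
      norm (z t - y t) \<le> C * \<epsilon> \<and> gap (y \<tau>) / 2 \<le> gap (z t)"
    using perturbation_small[OF \<tau>] by blast
  obtain P where P: "P > 0" "\<And>t. t \<in> {0..T} \<Longrightarrow> norm (\<psi> t) \<le> P"
    using continuous_on_Icc_bounded[OF \<psi>_cont] by blast
  define \<delta> where "\<delta> = gap (y \<tau>) / 2"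
  have \<delta>: "\<delta> > 0" using bounds(1)[OF \<tau>] by (simp add: \<delta>_def)
  define A where "A = ((1 + gap y0) / \<delta> + 2) / \<delta>\<^sup>2"
  have A: "A > 0" using \<delta> gap0_pos by (auto simp: A_def intro!: divide_pos_pos add_pos_pos)
  define C' where "C' = A * P * C\<^sup>2 * T + C\<^sup>2 / (2 * c\<^sup>2)"
  have C'1: "A * P * C\<^sup>2 * T \<le> C'" "C\<^sup>2 / (2 * c\<^sup>2) \<le> C'" using A P T_pos by (auto simp: C'_def)
  have C': "C' > 0" using A P C T_pos c_pos by (auto simp: C'_def intro!: add_pos_nonneg)
  show ?thesis
  proof (rule that[of C' "min \<epsilon>0 1"])
    fix \<epsilon> z assume \<epsilon>: "0 < \<epsilon>" "\<epsilon> < min \<epsilon>0 1" and z: "forced_solution (perturbed \<epsilon>) y0 T z"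
    have vb: "bounded_forcing K (perturbed \<epsilon>)" using perturbed_bounded[of \<epsilon>] \<epsilon> by simp
    note zb = forced_solution_bounds[OF z vb]
    have rem: "- (A * P * C\<^sup>2 * \<epsilon>\<^sup>2) \<le> \<psi> t \<bullet> f2_rem (y t) (z t)" if t: "t \<in> {0..\<tau>}" for t
    proof -
      have t0: "t \<in> {0..<T}" using t \<tau> by auto
      have gz: "\<delta> \<le> gap (z t)" and e: "norm (z t - y t) \<le> C * \<epsilon>" using close[of \<epsilon> z t] \<epsilon> z t by (auto simp: \<delta>_def)
      have gy: "\<delta> \<le> gap (y t)" using gap_antimono[OF y v, of t \<tau>] t \<tau> \<delta> by (simp add: \<delta>_def)
      have "\<bar>\<psi> t \<bullet> f2_rem (y t) (z t)\<bar> \<le> A * norm (\<psi> t) * (norm (z t - y t))\<^sup>2"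
        unfolding A_def using gz gy zb(4)[OF t0] bounds(6)[OF t0] \<delta>
        by (intro f2_rem_quadratic) (auto simp: abs_gap)
      also have "\<dots> \<le> A * P * (C * \<epsilon>)\<^sup>2"
        using A P t0 e by (intro mult_mono power_mono) auto
      finally show ?thesis by (simp add: power_mult_distrib)
    qed
    have D: "lip_primitive 0 \<tau> (\<lambda>t. \<psi> t \<bullet> (z t - y t)) (\<lambda>t. \<psi> t \<bullet> f2_rem (y t) (z t) + \<epsilon> * pairing t)"
      by (rule duality_pairing[OF z]) (use \<tau> in auto)
    have pI: "pairing integrable_on {0..\<tau>}"
      by (rule integrable_on_subinterval[OF pairing_integrable]) (use \<tau> in auto)
    have pe: "(\<lambda>t. \<epsilon> * pairing t) integrable_on {0..\<tau>}"
      using integrable_cmul[OF pI, of \<epsilon>] by simp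
    have "integral {0..\<tau>} (\<lambda>t. \<epsilon> * pairing t + - (A * P * C\<^sup>2 * \<epsilon>\<^sup>2)) \<le> \<psi> \<tau> \<bullet> (z \<tau> - y \<tau>) - \<psi> 0 \<bullet> (z 0 - y 0)"
    proof (rule lip_primitive_integral_le[OF D])
      show "(\<lambda>t. \<epsilon> * pairing t + - (A * P * C\<^sup>2 * \<epsilon>\<^sup>2)) integrable_on {0..\<tau>}"
        by (intro integrable_add pe) auto
      show "\<epsilon> * pairing t + - (A * P * C\<^sup>2 * \<epsilon>\<^sup>2) \<le> \<psi> t \<bullet> f2_rem (y t) (z t) + \<epsilon> * pairing t"
        if "t \<in> {0..\<tau>}" for t using rem[OF that] by linarith
    qed (use \<tau> in auto)
    moreover have "integral {0..\<tau>} (\<lambda>t. \<epsilon> * pairing t + - (A * P * C\<^sup>2 * \<epsilon>\<^sup>2))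
        = \<epsilon> * integral {0..\<tau>} pairing + - (A * P * C\<^sup>2 * \<epsilon>\<^sup>2) * \<tau>"
      by (subst integral_add) (use pe \<tau> in auto)
    moreover have "A * P * C\<^sup>2 * \<epsilon>\<^sup>2 * \<tau> \<le> C' * \<epsilon>\<^sup>2"
    proof -
      have "A * P * C\<^sup>2 * \<tau> \<le> A * P * C\<^sup>2 * T" using A P \<tau> by (intro mult_left_mono) auto
      hence "A * P * C\<^sup>2 * \<tau> \<le> C'" using C'1 by linarith
      hence "A * P * C\<^sup>2 * \<tau> * \<epsilon>\<^sup>2 \<le> C' * \<epsilon>\<^sup>2" by (intro mult_right_mono) auto
      thus ?thesis by (simp add: mult.commute mult.left_commute)
    qed
    moreover have "\<psi> 0 \<bullet> (z 0 - y 0) = 0" using y z by (simp add: forced_solution_def)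
    ultimately have 1: "\<epsilon> * integral {0..\<tau>} pairing - C' * \<epsilon>\<^sup>2 \<le> \<psi> \<tau> \<bullet> (z \<tau> - y \<tau>)" by simp
    have "angle_defect (y \<tau>) (z \<tau>) \<le> (norm (z \<tau> - y \<tau>))\<^sup>2 / (2 * c\<^sup>2)"
      by (rule angle_defect_le[OF c_pos(1) bounds(3)[OF \<tau>] zb(3)[OF \<tau>]])
    also have "\<dots> \<le> (C * \<epsilon>)\<^sup>2 / (2 * c\<^sup>2)"
      using close[of \<epsilon> z \<tau>] \<epsilon> z \<tau> by (intro divide_right_mono power_mono) auto
    also have "\<dots> = C\<^sup>2 / (2 * c\<^sup>2) * \<epsilon>\<^sup>2" by (simp add: power_mult_distrib)
    also have "\<dots> \<le> C' * \<epsilon>\<^sup>2" using C'1 by (intro mult_right_mono) auto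
    finally have 2: "angle_defect (y \<tau>) (z \<tau>) \<le> C' * \<epsilon>\<^sup>2" .
    show "\<epsilon> * integral {0..\<tau>} pairing - C' * \<epsilon>\<^sup>2 \<le> \<psi> \<tau> \<bullet> (z \<tau> - y \<tau>)
      \<and> angle_defect (y \<tau>) (z \<tau>) \<le> C' * \<epsilon>\<^sup>2"
      using 1 2 ..
  qed (use C' C in auto)
qed

lemma angle_defect_lip:
  assumes z: "forced_solution (perturbed \<epsilon>) y0 T z" and \<epsilon>: "0 \<le> \<epsilon>" "\<epsilon> \<le> 1" and ab: "0 \<le> a" "b < T"
  obtains q' where "lip_primitive a b (\<lambda>t. angle_defect (y t) (z t)) q'"
    "\<And>t. t \<in> {a..b} \<Longrightarrow> \<bar>q' t\<bar> \<le> (K / c\<^sup>2 + 4 * K / c) * ((norm (z t) - norm (y t))\<^sup>2 + angle_defect (y t) (z t) + \<epsilon>\<^sup>2)"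
proof -
  have vb: "bounded_forcing K (perturbed \<epsilon>)" by (rule perturbed_bounded[OF \<epsilon>])
  note zb = forced_solution_bounds[OF z vb]
  have nz: "y t \<noteq> 0" "z t \<noteq> 0" if "t \<in> {a..b}" for t using bounds(6)[of t] zb(6)[of t] that ab by auto
  note L = lip_primitive_angle_defect[OF forced_solution_lip[OF y ab, unfolded f2_eq] forced_solution_lip[OF z ab, unfolded f2_eq] nz]
  show ?thesis
  proof (rule that[OF L])
    fix t assume t: "t \<in> {a..b}"
    hence t0: "t \<in> {0..<T}" using ab by auto
    have "norm (v t) \<le> K" "norm (perturbed \<epsilon> t) \<le> K" using v vb t0 by (auto simp: bounded_forcing_def)
    from angle_defect_rate[OF nz[OF t] c_pos(1) bounds(3)[OF t0] zb(3)[OF t0] this perturbed_close[OF \<epsilon>(1)] \<epsilon>(1)] t0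
    show "\<bar>- ((y t \<bullet> perturbed \<epsilon> t + v t \<bullet> z t -
          (y t \<bullet> z t) * ((z t \<bullet> perturbed \<epsilon> t) / (norm (z t))\<^sup>2 + (y t \<bullet> v t) / (norm (y t))\<^sup>2)) /
         (norm (y t) * norm (z t)))\<bar>
        \<le> (K / c\<^sup>2 + 4 * K / c) * ((norm (z t) - norm (y t))\<^sup>2 + angle_defect (y t) (z t) + \<epsilon>\<^sup>2)"
      unfolding abs_minus_cancel by simp
  qed
qed

text \<open>Near the quenching time the perturbed trajectory need not be close to the optimal one to first order in the radial direction. The pairing
\<open>\<psi> \<bullet> (z - y)\<close>, diminished by \<open>\<mu> * q\<close> with the angular deviation \<open>q\<close> and \<open>\<mu> = lam * sqrt (T - t)\<close>, is used as a
Lyapunov function. By \<open>f2_rem_lower\<close> the remainder is at least \<open>c5 * X\<^sup>2 - const * q / sqrt (T - t)\<close> with the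
radial deviation \<open>X\<close>; the derivative of \<open>\<mu>\<close> compensates the second term twice, which leaves enough for the
growth of \<open>q\<close>, and for \<open>\<mu>\<close> small enough the term \<open>c5 * X\<^sup>2\<close> covers the rest of that growth up to \<open>c5 * \<epsilon>\<^sup>2\<close>.\<close>
lemma late_growth:
  obtains \<tau> \<eta> C where "\<tau> \<in> {0..<T}" "\<eta> > 0" "C > 0"
    "\<And>\<epsilon> z t. 0 < \<epsilon> \<Longrightarrow> \<epsilon> \<le> 1 \<Longrightarrow> forced_solution (perturbed \<epsilon>) y0 T z \<Longrightarrow>
      angle_defect (y \<tau>) (z \<tau>) \<le> \<eta> \<Longrightarrow> t \<in> {\<tau>..<T} \<Longrightarrow>
      \<psi> \<tau> \<bullet> (z \<tau> - y \<tau>) - C * angle_defect (y \<tau>) (z \<tau>)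
        + \<epsilon> * integral {\<tau>..t} pairing - C * \<epsilon>\<^sup>2 \<le> \<psi> t \<bullet> (z t - y t)"
proof -
  define D R where "D = gap y0" and "R = 1 + gap y0"
  have D: "D > 0" and R: "R > 0" using gap0_pos by (auto simp: D_def R_def)
  define C7 where "C7 = K / c\<^sup>2 + 4 * K / c"
  have C7: "C7 > 0" using K c_pos by (auto simp: C7_def intro!: add_pos_pos divide_pos_pos)
  define C8 where "C8 = C7 * (R\<^sup>2 + 3)"
  have C8: "C8 > 0" using C7 by (auto simp: C8_def intro!: mult_pos_pos add_nonneg_pos)
  define \<eta> where "\<eta> = (c1 / (2 * c2))\<^sup>2 / 4"
  have \<eta>: "\<eta> > 0" using c12 by (simp add: \<eta>_def)
  define C4 where "C4 = R\<^sup>2 * c2\<^sup>2 * D / (c1 / 2) + R\<^sup>2 * c2"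
  have C4: "C4 > 0" using R c12 D by (auto simp: C4_def intro!: add_pos_pos)
  define c5 where "c5 = (c1 / 2) / (2 * D) / D"
  have c5: "c5 > 0" using c12 D by (simp add: c5_def)
  define lam where "lam = 4 * (C4 / sqrt c)"
  have lam: "lam > 0" using C4 c_pos by (simp add: lam_def)
  \<comment> \<open>The three bounds keep the perturbed direction aligned with \<open>\<psi>\<close>, make the derivative of the weight absorb the growth of \<open>q\<close>, and make the weight small against \<open>c5\<close>.\<close>
  define h where "h = min (\<eta> / C8) (min (1 / (4 * C7)) ((c5 / (lam * C7))\<^sup>2))"
  have h: "h > 0" using \<eta> C8 C7 c5 lam by (simp add: h_def)
  have hC8: "C8 * h \<le> \<eta>"
  proof -
    have "h \<le> \<eta> / C8" by (simp add: h_def)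
    thus ?thesis using C8 by (simp add: field_simps)
  qed
  have hC7: "4 * C7 * h \<le> 1"
  proof -
    have "h \<le> 1 / (4 * C7)" by (simp add: h_def)
    thus ?thesis using C7 by (simp add: field_simps)
  qed
  have hlam: "lam * sqrt h * C7 \<le> c5"
  proof -
    have "sqrt h \<le> c5 / (lam * C7)" using h c5 lam C7 by (intro real_le_lsqrt) (auto simp: h_def)
    thus ?thesis using lam C7 by (simp add: field_simps)
  qed
  define \<tau> where "\<tau> = max \<tau>0 (T - h)"
  have \<tau>: "\<tau> \<in> {0..<T}" "\<tau>0 \<le> \<tau>" "T - \<tau> \<le> h" using \<tau>0 h by (auto simp: \<tau>_def)
  define C where "C = lam * sqrt T + c5 * T"
  have C: "C > 0" "lam * sqrt T \<le> C" "c5 * T \<le> C" using lam c5 T_pos by (auto simp: C_def intro!: add_pos_pos)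
  have "\<psi> \<tau> \<bullet> (z \<tau> - y \<tau>) - C * angle_defect (y \<tau>) (z \<tau>)
        + \<epsilon> * integral {\<tau>..t} pairing - C * \<epsilon>\<^sup>2 \<le> \<psi> t \<bullet> (z t - y t)"
    if \<epsilon>: "0 < \<epsilon>" "\<epsilon> \<le> 1" and z: "forced_solution (perturbed \<epsilon>) y0 T z"
      and start: "angle_defect (y \<tau>) (z \<tau>) \<le> \<eta>" and t: "t \<in> {\<tau>..<T}" for \<epsilon> z t
  proof -
    have vb: "bounded_forcing K (perturbed \<epsilon>)" by (rule perturbed_bounded) (use \<epsilon> in auto)
    note zb = forced_solution_bounds[OF z vb]
    define q where "q s = angle_defect (y s) (z s)" for s
    define X where "X s = norm (z s) - norm (y s)" for s
    have q0: "0 \<le> q s" "q s \<le> 2" if "s \<in> {0..<T}" for s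
      unfolding q_def using angle_defect_nonneg[OF bounds(6)[OF that] zb(6)[OF that]] by auto
    have X2: "(X s)\<^sup>2 \<le> R\<^sup>2" if "s \<in> {0..<T}" for s
    proof -
      have "\<bar>X s\<bar> \<le> R"
        using bounds(4)[OF that] zb(4)[OF that] norm_ge_zero[of "y s"] norm_ge_zero[of "z s"] unfolding X_def R_def by linarith
      thus ?thesis using R by (simp add: abs_le_square_iff[symmetric])
    qed
    obtain q' where qlip: "lip_primitive \<tau> t q q'"
      and q'b: "\<And>s. s \<in> {\<tau>..t} \<Longrightarrow> \<bar>q' s\<bar> \<le> C7 * ((X s)\<^sup>2 + q s + \<epsilon>\<^sup>2)"
      using angle_defect_lip[OF z, of \<tau> t] \<epsilon> t \<tau> unfolding q_def X_def C7_def by auto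
    have dom: "s \<in> {0..<T}" "s \<in> {\<tau>0..<T}" if "s \<in> {\<tau>..t}" for s using that t \<tau> by auto
    have \<epsilon>2: "\<epsilon>\<^sup>2 \<le> 1" using \<epsilon> by (simp add: power_le_one)
    have q_small: "q s \<le> 2 * \<eta>" if s: "s \<in> {\<tau>..t}" for s
    proof -
      have "q s \<le> q \<tau> + C8 * (s - \<tau>)"
      proof (rule lip_primitive_le[OF lip_primitive_subset[OF qlip]])
        fix r assume r: "r \<in> {\<tau>..s}"
        hence r': "r \<in> {\<tau>..t}" using s by auto
        have "q' r \<le> C7 * ((X r)\<^sup>2 + q r + \<epsilon>\<^sup>2)" using q'b[OF r'] by linarith
        also have "\<dots> \<le> C8" unfolding C8_def
          using C7 X2[OF dom(1)[OF r']] q0(2)[OF dom(1)[OF r']] \<epsilon>2 by (intro mult_left_mono) auto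
        finally show "q' r \<le> C8" .
      qed (use s in auto)
      also have "\<dots> \<le> \<eta> + C8 * h" using start \<tau> s t C8 by (intro add_mono mult_left_mono) (auto simp: q_def)
      also have "\<dots> \<le> 2 * \<eta>" using hC8 by simp
      finally show ?thesis .
    qed
    have aligned: "c1 / 2 * gap (y s) \<le> \<sigma> * (\<psi> s \<bullet> sgn (z s))" if s: "s \<in> {\<tau>..t}" for s
    proof -
      define Y where "Y = norm (sgn (z s) - sgn (y s))"
      have "Y\<^sup>2 = 2 * q s" unfolding Y_def q_def by (rule norm_sgn_diff[OF bounds(6) zb(6)]) (use dom s in auto)
      also have "\<dots> \<le> (c1 / (2 * c2))\<^sup>2" using q_small[OF s] by (simp add: \<eta>_def)
      finally have Y: "Y \<le> c1 / (2 * c2)" using c12 by (auto intro: power2_le_imp_le)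
      have g: "gap (y s) > 0" using bounds(1)[OF dom(1)[OF s]] .
      have "\<bar>\<sigma> * (\<psi> s \<bullet> (sgn (z s) - sgn (y s)))\<bar> = \<bar>\<psi> s \<bullet> (sgn (z s) - sgn (y s))\<bar>" using \<sigma> by auto
      also have "\<dots> \<le> norm (\<psi> s) * Y" unfolding Y_def by (rule Cauchy_Schwarz_ineq2)
      also have "\<dots> \<le> (c2 * gap (y s)) * (c1 / (2 * c2))"
        using \<psi>_upper[OF dom(2)[OF s]] Y c12 g by (intro mult_mono) (auto simp: Y_def)
      also have "\<dots> = c1 / 2 * gap (y s)" using c12 by (simp add: field_simps)
      finally have "\<bar>\<sigma> * (\<psi> s \<bullet> sgn (z s)) - \<sigma> * (\<psi> s \<bullet> sgn (y s))\<bar> \<le> c1 / 2 * gap (y s)"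
        by (simp add: inner_diff_right right_diff_distrib)
      moreover have "c1 * gap (y s) = c1 / 2 * gap (y s) + c1 / 2 * gap (y s)" by simp
      ultimately show ?thesis using \<psi>_lower[OF dom(2)[OF s]] by linarith
    qed
    define b where "b s = (C4 / sqrt c) * q s / sqrt (T - s)" for s
    have rem: "c5 * (X s)\<^sup>2 - b s \<le> \<psi> s \<bullet> f2_rem (y s) (z s)" if s: "s \<in> {\<tau>..t}" for s
    proof -
      have s0: "s \<in> {0..<T}" by (rule dom(1)[OF s])
      define d where "d = gap (y s)"
      have d: "0 < d" "d \<le> D" using bounds(1,2)[OF s0] by (auto simp: d_def D_def)
      have main: "((c1 / 2) / (2 * D) * (X s)\<^sup>2 - C4 * q s) / d \<le> \<psi> s \<bullet> f2_rem (y s) (z s)"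
        unfolding X_def q_def C4_def
      proof (rule f2_rem_lower[OF \<sigma> bounds(6)[OF s0] zb(6)[OF s0] _ d(1)])
        show "d = \<sigma> * (1 - norm (y s))" by (simp add: d_def gap_def)
        show "0 < \<sigma> * (1 - norm (z s))" "\<sigma> * (1 - norm (z s)) \<le> D"
          using zb(1,2)[OF s0] by (auto simp: gap_def D_def)
        show "norm (y s) \<le> R" "norm (z s) \<le> R" using bounds(4)[OF s0] zb(4)[OF s0] by (auto simp: R_def)
        show "norm (\<psi> s) \<le> c2 * d" using \<psi>_upper[OF dom(2)[OF s]] by (simp add: d_def)
        show "c1 / 2 * d \<le> \<sigma> * (\<psi> s \<bullet> sgn (z s))" using aligned[OF s] by (simp add: d_def)
      qed (use c12 in simp)
      have "(c1 / 2) / (2 * D) * (X s)\<^sup>2 / D \<le> (c1 / 2) / (2 * D) * (X s)\<^sup>2 / d"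
        using d D c12 by (intro divide_left_mono) auto
      hence 1: "c5 * (X s)\<^sup>2 \<le> (c1 / 2) / (2 * D) * (X s)\<^sup>2 / d" by (simp add: c5_def)
      have "C4 * q s * (1 / d) \<le> C4 * q s * ((1 / sqrt c) / sqrt (T - s))"
        using inverse_gap_le[OF s0] C4 q0[OF s0] by (intro mult_left_mono) (auto simp: d_def)
      hence 2: "C4 * q s / d \<le> b s" by (simp add: b_def)
      have "((c1 / 2) / (2 * D) * (X s)\<^sup>2 - C4 * q s) / d = (c1 / 2) / (2 * D) * (X s)\<^sup>2 / d - C4 * q s / d"
        by (rule diff_divide_distrib)
      thus ?thesis using main 1 2 by linarith
    qed
    define \<mu> where "\<mu> s = lam * sqrt (T - s)" for s
    have \<mu>lip: "lip_primitive \<tau> t \<mu> (\<lambda>s. - lam / (2 * sqrt (T - s)))"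
    proof (rule lip_primitive_C1)
      show "(\<mu> has_vector_derivative - lam / (2 * sqrt (T - s))) (at s within {\<tau>..t})" if "s \<in> {\<tau>..t}" for s
        unfolding \<mu>_def has_real_derivative_iff_has_vector_derivative[symmetric] using that t
        by (auto intro!: derivative_eq_intros simp: field_simps)
      show "continuous_on {\<tau>..t} (\<lambda>s. - lam / (2 * sqrt (T - s)))"
        using t by (intro continuous_intros) auto
    qed
    have dual: "lip_primitive \<tau> t (\<lambda>s. \<psi> s \<bullet> (z s - y s)) (\<lambda>s. \<psi> s \<bullet> f2_rem (y s) (z s) + \<epsilon> * pairing s)"
      by (rule duality_pairing[OF z]) (use \<tau> t in auto)
    have Glip: "lip_primitive \<tau> t (\<lambda>s. \<psi> s \<bullet> (z s - y s) - \<mu> s * q s)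
        (\<lambda>s. (\<psi> s \<bullet> f2_rem (y s) (z s) + \<epsilon> * pairing s) - (\<mu> s * q' s + (- lam / (2 * sqrt (T - s))) * q s))"
      by (rule lip_primitive_diff[OF dual lip_primitive_mult[OF \<mu>lip qlip]])
    have pI: "pairing integrable_on {\<tau>..t}"
      by (rule integrable_on_subinterval[OF pairing_integrable]) (use \<tau> t in auto)
    have pe: "(\<lambda>s. \<epsilon> * pairing s) integrable_on {\<tau>..t}"
      using integrable_cmul[OF pI, of \<epsilon>] by simp
    have grow: "integral {\<tau>..t} (\<lambda>s. \<epsilon> * pairing s + - (c5 * \<epsilon>\<^sup>2))
        \<le> (\<psi> t \<bullet> (z t - y t) - \<mu> t * q t) - (\<psi> \<tau> \<bullet> (z \<tau> - y \<tau>) - \<mu> \<tau> * q \<tau>)"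
    proof (rule lip_primitive_integral_le[OF Glip])
      show "(\<lambda>s. \<epsilon> * pairing s + - (c5 * \<epsilon>\<^sup>2)) integrable_on {\<tau>..t}"
        by (intro integrable_add pe) auto
      fix s assume s: "s \<in> {\<tau>..t}"
      have s0: "s \<in> {0..<T}" by (rule dom(1)[OF s])
      define S where "S = sqrt (T - s)"
      have S: "S > 0" "S * S = T - s" using s0 by (auto simp: S_def)
      have Sh: "T - s \<le> h" "S \<le> sqrt h" using s \<tau> by (auto simp: S_def)
      have \<mu>0: "\<mu> s \<ge> 0" using lam S by (simp add: \<mu>_def S_def)
      have \<mu>C7: "\<mu> s * C7 \<le> c5"
      proof -
        have "lam * S * C7 \<le> lam * sqrt h * C7" using Sh lam C7 by (intro mult_right_mono mult_left_mono) auto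
        thus ?thesis using hlam by (simp add: \<mu>_def S_def)
      qed
      have qterm: "\<mu> s * C7 * q s \<le> b s"
      proof -
        have "\<mu> s = lam * S" by (simp add: \<mu>_def S_def)
        hence "\<mu> s * C7 = (C4 / sqrt c) * (4 * C7 * (S * S)) / S" using S(1) by (simp add: lam_def)
        also have "\<dots> \<le> (C4 / sqrt c) * 1 / S"
        proof (intro divide_right_mono mult_left_mono)
          have "4 * C7 * (S * S) \<le> 4 * C7 * h" unfolding S(2) using Sh C7 by (intro mult_left_mono) auto
          thus "4 * C7 * (S * S) \<le> 1" using hC7 by linarith
        qed (use C4 c_pos S in auto)
        finally have "\<mu> s * C7 * q s \<le> ((C4 / sqrt c) * 1 / S) * q s" using q0(1)[OF s0] by (rule mult_right_mono)
        thus ?thesis by (simp add: b_def S_def)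
      qed
      have m': "(- lam / (2 * S)) * q s = - (2 * b s)" using S by (simp add: lam_def b_def S_def)
      have "\<mu> s * q' s \<le> \<mu> s * (C7 * ((X s)\<^sup>2 + q s + \<epsilon>\<^sup>2))"
        using q'b[OF s] \<mu>0 by (intro mult_left_mono) auto
      also have "\<dots> = (\<mu> s * C7) * (X s)\<^sup>2 + \<mu> s * C7 * q s + (\<mu> s * C7) * \<epsilon>\<^sup>2" by (simp add: algebra_simps)
      also have "\<dots> \<le> c5 * (X s)\<^sup>2 + b s + c5 * \<epsilon>\<^sup>2"
        using \<mu>C7 qterm by (intro add_mono mult_right_mono) auto
      finally have "\<mu> s * q' s \<le> c5 * (X s)\<^sup>2 + b s + c5 * \<epsilon>\<^sup>2" .
      thus "\<epsilon> * pairing s + - (c5 * \<epsilon>\<^sup>2)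
        \<le> (\<psi> s \<bullet> f2_rem (y s) (z s) + \<epsilon> * pairing s) - (\<mu> s * q' s + (- lam / (2 * sqrt (T - s))) * q s)"
        using rem[OF s] m' unfolding S_def by linarith
    qed (use t in auto)
    have "integral {\<tau>..t} (\<lambda>s. \<epsilon> * pairing s + - (c5 * \<epsilon>\<^sup>2))
        = \<epsilon> * integral {\<tau>..t} pairing + - (c5 * \<epsilon>\<^sup>2) * (t - \<tau>)"
      by (subst integral_add) (use pe t in auto)
    moreover have "0 \<le> \<mu> t * q t" using lam t q0(1)[of t] \<tau> by (auto simp: \<mu>_def)
    moreover have "\<mu> \<tau> * q \<tau> \<le> C * q \<tau>"
    proof (rule mult_right_mono)
      have "\<mu> \<tau> \<le> lam * sqrt T" unfolding \<mu>_def using lam \<tau> by (intro mult_left_mono) auto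
      thus "\<mu> \<tau> \<le> C" using C(2) by linarith
    qed (use q0 \<tau> in auto)
    moreover have "c5 * \<epsilon>\<^sup>2 * (t - \<tau>) \<le> C * \<epsilon>\<^sup>2"
    proof -
      have "c5 * (t - \<tau>) \<le> c5 * T" using c5 t \<tau> by (intro mult_left_mono) auto
      hence "c5 * (t - \<tau>) * \<epsilon>\<^sup>2 \<le> C * \<epsilon>\<^sup>2" using C(3) by (intro mult_right_mono) auto
      thus ?thesis by (simp add: mult.commute mult.left_commute)
    qed
    ultimately show ?thesis using grow unfolding q_def[symmetric] by simp
  qed
  thus ?thesis using that[OF \<tau>(1) \<eta> C(1)] by blast
qed

text \<open>The estimates before and near the quenching time are added, \<open>t\<close> tends to \<open>T\<close>, where the pairing vanishes, and the result is
divided by \<open>\<epsilon>\<close>.\<close>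
lemma first_variation:
  assumes pert: "\<And>\<epsilon>. 0 < \<epsilon> \<Longrightarrow> \<epsilon> \<le> 1 \<Longrightarrow> \<exists>z. forced_solution (perturbed \<epsilon>) y0 T z"
  shows "integral {0..T} pairing \<le> 0"
proof -
  define J where "J t = integral {0..t} pairing" for t
  obtain \<tau> \<eta> C where \<tau>: "\<tau> \<in> {0..<T}" and \<eta>: "\<eta> > 0" and C: "C > 0"
    and late: "\<And>\<epsilon> z t. 0 < \<epsilon> \<Longrightarrow> \<epsilon> \<le> 1 \<Longrightarrow> forced_solution (perturbed \<epsilon>) y0 T z \<Longrightarrow>
      angle_defect (y \<tau>) (z \<tau>) \<le> \<eta> \<Longrightarrow> t \<in> {\<tau>..<T} \<Longrightarrow>
      \<psi> \<tau> \<bullet> (z \<tau> - y \<tau>) - C * angle_defect (y \<tau>) (z \<tau>)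
        + \<epsilon> * integral {\<tau>..t} pairing - C * \<epsilon>\<^sup>2 \<le> \<psi> t \<bullet> (z t - y t)"
    using late_growth by blast
  obtain C' \<epsilon>0 where C': "C' > 0" "\<epsilon>0 > 0"
    and early: "\<And>\<epsilon> z. 0 < \<epsilon> \<Longrightarrow> \<epsilon> < \<epsilon>0 \<Longrightarrow> forced_solution (perturbed \<epsilon>) y0 T z \<Longrightarrow>
      \<epsilon> * integral {0..\<tau>} pairing - C' * \<epsilon>\<^sup>2 \<le> \<psi> \<tau> \<bullet> (z \<tau> - y \<tau>)
      \<and> angle_defect (y \<tau>) (z \<tau>) \<le> C' * \<epsilon>\<^sup>2"
    using early_growth[OF \<tau>] by blast
  define A where "A = C' + C * C' + C"
  have A: "A > 0" using C C' by (auto simp: A_def intro!: add_pos_pos)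
  have bound: "J T \<le> A * \<epsilon>" if \<epsilon>: "0 < \<epsilon>" "\<epsilon> < min (min \<epsilon>0 1) (\<eta> / C')" for \<epsilon>
  proof -
    obtain z where z: "forced_solution (perturbed \<epsilon>) y0 T z" using pert[of \<epsilon>] \<epsilon> by auto
    have vb: "bounded_forcing K (perturbed \<epsilon>)" by (rule perturbed_bounded) (use \<epsilon> in auto)
    note zb = forced_solution_bounds[OF z vb]
    have e1: "\<epsilon> * J \<tau> - C' * \<epsilon>\<^sup>2 \<le> \<psi> \<tau> \<bullet> (z \<tau> - y \<tau>)" and e2: "angle_defect (y \<tau>) (z \<tau>) \<le> C' * \<epsilon>\<^sup>2"
      using early[OF \<epsilon>(1) _ z] \<epsilon>(2) unfolding J_def by auto
    have "C' * \<epsilon>\<^sup>2 \<le> C' * \<epsilon>" using C' \<epsilon> by (simp add: power2_eq_square mult_left_le_one_le)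
    also have "\<dots> \<le> \<eta>" using \<epsilon> C' by (simp add: less_divide_eq mult.commute)
    finally have e3: "angle_defect (y \<tau>) (z \<tau>) \<le> \<eta>" using e2 by linarith
    have key: "\<epsilon> * J t - A * \<epsilon>\<^sup>2 \<le> \<psi> t \<bullet> (z t - y t)" if t: "t \<in> {\<tau>..<T}" for t
    proof -
      have "J \<tau> + integral {\<tau>..t} pairing = J t"
        unfolding J_def by (rule pairing_integral_split) (use t \<tau> in auto)
      hence "\<epsilon> * J t = \<epsilon> * J \<tau> + \<epsilon> * integral {\<tau>..t} pairing"
        by (simp flip: distrib_left)
      moreover have "C * angle_defect (y \<tau>) (z \<tau>) \<le> C * C' * \<epsilon>\<^sup>2"
        using mult_left_mono[OF e2 less_imp_le[OF C]] by (simp add: mult.assoc)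
      moreover have "A * \<epsilon>\<^sup>2 = C' * \<epsilon>\<^sup>2 + C * C' * \<epsilon>\<^sup>2 + C * \<epsilon>\<^sup>2" by (simp add: A_def distrib_right)
      ultimately show ?thesis using late[OF \<epsilon>(1) _ z e3 t] e1 \<epsilon>(2) by simp
    qed
    have "(\<psi> \<longlongrightarrow> \<psi> T) (at_left T)" by (rule continuous_on_Icc_at_leftD[OF \<psi>_cont T_pos])
    hence n0: "((\<lambda>t. norm (\<psi> t) * (2 * (1 + gap y0))) \<longlongrightarrow> 0) (at_left T)"
      unfolding \<psi>_T by (intro tendsto_eq_intros) auto
    have near: "\<forall>\<^sub>F t in at_left T. t \<in> {\<tau><..<T}" using \<tau> by (intro eventually_at_left_real) auto
    have "((\<lambda>t. \<psi> t \<bullet> (z t - y t)) \<longlongrightarrow> 0) (at_left T)"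
    proof (rule Lim_null_comparison[OF _ n0])
      show "\<forall>\<^sub>F t in at_left T. norm (\<psi> t \<bullet> (z t - y t)) \<le> norm (\<psi> t) * (2 * (1 + gap y0))"
        using near
      proof eventually_elim
        case (elim t)
        hence t: "t \<in> {0..<T}" using \<tau> by auto
        have "norm (z t - y t) \<le> norm (z t) + norm (y t)" by (rule norm_triangle_ineq4)
        also have "\<dots> \<le> 2 * (1 + gap y0)" using bounds(4)[OF t] zb(4)[OF t] by simp
        finally have "norm (\<psi> t) * norm (z t - y t) \<le> norm (\<psi> t) * (2 * (1 + gap y0))"
          by (intro mult_left_mono) auto
        thus ?case using Cauchy_Schwarz_ineq2[of "\<psi> t" "z t - y t"] by simp
      qed
    qed
    moreover have "((\<lambda>t. \<epsilon> * J t - A * \<epsilon>\<^sup>2) \<longlongrightarrow> \<epsilon> * J T - A * \<epsilon>\<^sup>2) (at_left T)"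
    proof -
      have "continuous_on {0..T} J" unfolding J_def by (rule indefinite_integral_continuous_1[OF pairing_integrable])
      hence "(J \<longlongrightarrow> J T) (at_left T)" by (rule continuous_on_Icc_at_leftD[OF _ T_pos])
      thus ?thesis by (intro tendsto_intros)
    qed
    moreover have "\<forall>\<^sub>F t in at_left T. \<epsilon> * J t - A * \<epsilon>\<^sup>2 \<le> \<psi> t \<bullet> (z t - y t)"
      using near by eventually_elim (rule key, auto)
    ultimately have "\<epsilon> * J T - A * \<epsilon>\<^sup>2 \<le> 0" by (intro tendsto_le[OF trivial_limit_at_left_real])
    hence "\<epsilon> * J T \<le> \<epsilon> * (A * \<epsilon>)" by (simp add: power2_eq_square algebra_simps)
    thus ?thesis using \<epsilon>(1) by (rule mult_left_le_imp_le)
  qed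
  have "J T \<le> 0"
  proof (rule ccontr)
    assume "\<not> J T \<le> 0"
    hence JT: "J T > 0" by simp
    define m where "m = min (min \<epsilon>0 1) (\<eta> / C')"
    have m: "m > 0" using C' \<eta> by (simp add: m_def)
    define \<epsilon> where "\<epsilon> = min (m / 2) (J T / (2 * A))"
    have \<epsilon>: "0 < \<epsilon>" "\<epsilon> < m" "\<epsilon> \<le> J T / (2 * A)" using m JT A by (auto simp: \<epsilon>_def)
    have "J T \<le> A * \<epsilon>" by (rule bound) (use \<epsilon> m_def in auto)
    also have "\<dots> \<le> A * (J T / (2 * A))" using \<epsilon> A by (intro mult_left_mono) auto
    also have "\<dots> = J T / 2" using A by simp
    finally show False using JT by simp
  qed
  thus ?thesis by (simp add: J_def)
qed

end

section \<open>The maximum principle\<close>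

context control_problem
begin

lemma U_ad_convex:
  assumes u: "u \<in> U_ad \<rho>\<^sub>0" "u' \<in> U_ad \<rho>\<^sub>0" and \<epsilon>: "0 \<le> \<epsilon>" "\<epsilon> \<le> 1"
  shows "(\<lambda>t. u t + \<epsilon> *\<^sub>R (u' t - u t)) \<in> U_ad \<rho>\<^sub>0"
proof -
  have [measurable]: "u \<in> borel_measurable half_line" "u' \<in> borel_measurable half_line"
    using u by (auto simp: U_ad_def)
  have "AE t in half_line. norm (u t) \<le> \<rho>\<^sub>0" "AE t in half_line. norm (u' t) \<le> \<rho>\<^sub>0" using u by (auto simp: U_ad_def)
  hence "AE t in half_line. norm (u t + \<epsilon> *\<^sub>R (u' t - u t)) \<le> \<rho>\<^sub>0"
  proof eventually_elim
    case (elim t)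
    have "u t + \<epsilon> *\<^sub>R (u' t - u t) = (1 - \<epsilon>) *\<^sub>R u t + \<epsilon> *\<^sub>R u' t" by (simp add: algebra_simps)
    also have "norm \<dots> \<le> (1 - \<epsilon>) * norm (u t) + \<epsilon> * norm (u' t)" using \<epsilon> by (intro norm_triangle_le) auto
    also have "\<dots> \<le> (1 - \<epsilon>) * \<rho>\<^sub>0 + \<epsilon> * \<rho>\<^sub>0" using elim \<epsilon> by (intro add_mono mult_left_mono) auto
    finally show ?case by (simp add: algebra_simps)
  qed
  thus ?thesis unfolding U_ad_def by simp
qed

text \<open>The control \<open>\<rho>\<^sub>0 * sgn (B\<^sup>T \<psi>)\<close>, which is zero where \<open>B\<^sup>T \<psi>\<close> vanishes, attains the maximum at every time; being
an explicit expression in \<open>B\<close> and \<open>\<psi>\<close>, it is measurable.\<close>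
lemma maximizing_control:
  assumes \<psi>: "continuous_on {0..T} (\<psi> :: real \<Rightarrow> real^2)"
  obtains u where "u \<in> U_ad \<rho>\<^sub>0"
    "\<And>t. t \<in> {0..T} \<Longrightarrow> \<psi> t \<bullet> (B t *v u t) = \<rho>\<^sub>0 * norm (transpose (B t) *v \<psi> t)"
proof -
  define \<psi>0 where "\<psi>0 t = (if t \<in> {0..T} then \<psi> t else 0)" for t
  have "\<psi> \<in> borel_measurable (lebesgue_on {0..T})"
    by (rule continuous_imp_measurable_on_sets_lebesgue[OF \<psi>]) simp
  hence "\<psi>0 \<in> borel_measurable lebesgue"
    unfolding \<psi>0_def by (rule borel_measurable_if_I) simp
  hence m\<psi>: "\<psi>0 \<in> borel_measurable half_line" by (rule measurable_restrict_space1)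
  have ct: "continuous_on UNIV (\<lambda>A :: real^2^2. transpose A)"
    unfolding transpose_def by (intro continuous_intros)
  have mB: "(\<lambda>t. transpose (B t)) \<in> borel_measurable half_line"
    using BL by (intro borel_measurable_continuous_on[OF ct]) (simp add: L_infinity_def)
  define p where "p t = transpose (B t) *v \<psi>0 t" for t
  have [measurable]: "p \<in> borel_measurable half_line"
    unfolding p_def by (rule matrix_vector_measurable[OF mB m\<psi>])
  define u where "u t = (\<rho>\<^sub>0 / norm (p t)) *\<^sub>R p t" for t
  have "u \<in> borel_measurable half_line" unfolding u_def by measurable
  moreover have "norm (u t) \<le> \<rho>\<^sub>0" for t using \<rho> by (simp add: u_def)
  ultimately have "u \<in> U_ad \<rho>\<^sub>0" by (simp add: U_ad_def)
  moreover have "\<psi> t \<bullet> (B t *v u t) = \<rho>\<^sub>0 * norm (transpose (B t) *v \<psi> t)" if t: "t \<in> {0..T}" for t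
  proof -
    have pt: "p t = transpose (B t) *v \<psi> t" using t by (simp add: p_def \<psi>0_def)
    have "\<psi> t \<bullet> (B t *v u t) = p t \<bullet> u t"
      unfolding pt transpose_matrix_vector by (rule dot_lmul_matrix[symmetric])
    also have "\<dots> = \<rho>\<^sub>0 * norm (p t)"
      by (cases "p t = 0") (simp_all add: u_def dot_square_norm power2_eq_square)
    finally show ?thesis by (simp add: pt)
  qed
  ultimately show ?thesis using that by blast
qed

text \<open>For the maximizing control the integrand of the first variation is pointwise nonnegative while its integral is not
positive, so it vanishes almost everywhere.\<close>
lemma pontryagin_principle:
  assumes opt: "optimal_control B \<rho>\<^sub>0 y0 ustar"
  defines "T \<equiv> optimal_time B \<rho>\<^sub>0 y0" and "y \<equiv> state B y0 ustar"
  shows "\<exists>\<psi>. continuous_on {0..T} \<psi> \<and> (\<exists>t\<in>{0..T}. \<psi> t \<noteq> 0) \<and>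
    (\<forall>t\<in>{0..<T}. (\<lambda>s. deriv_matrix f2 (y s) *v \<psi> s) absolutely_integrable_on {t..T} \<and>
       \<psi> t = integral {t..T} (\<lambda>s. deriv_matrix f2 (y s) *v \<psi> s)) \<and>
    \<psi> T = 0 \<and>
    (AE t in lebesgue_on {0..T}. is_arg_max (\<lambda>a. \<psi> t \<bullet> (B t *v a)) (\<lambda>a. norm a \<le> \<rho>\<^sub>0) (ustar t))"
proof -
  have u: "ustar \<in> U_ad \<rho>\<^sub>0" and Tq: "T_q B y0 ustar = T"
    using opt by (auto simp: optimal_control_def T_def)
  have Tle: "T \<le> T_q B y0 u" if "u \<in> U_ad \<rho>\<^sub>0" for u unfolding T_def by (rule optimal_time_le[OF that])
  define v where "v = forcing ustar"
  have vb: "bounded_forcing K v" unfolding v_def by (rule bounded_forcing_forcing[OF u])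
  interpret quenching_trajectory K "sgn (1 - norm y0)" y0 v T y
    by unfold_locales (use vb quenching_state[OF u] in \<open>auto simp: Tq y_def v_def\<close>)
  obtain \<psi> c1 c2 \<tau> where \<psi>: "continuous_on {0..T} \<psi>" "\<psi> T = 0"
    "\<And>b. b < T \<Longrightarrow> lip_primitive 0 b \<psi> (\<lambda>t. - f2_jac (y t) (\<psi> t))"
    and \<psi>I: "\<And>t. t \<in> {0..<T} \<Longrightarrow> (\<lambda>s. f2_jac (y s) (\<psi> s)) absolutely_integrable_on {t..T}"
      "\<And>t. t \<in> {0..<T} \<Longrightarrow> \<psi> t = integral {t..T} (\<lambda>s. f2_jac (y s) (\<psi> s))"
    and c12: "c1 > 0" "c2 > 0" "\<tau> \<in> {0..<T}"
      "\<And>t. t \<in> {\<tau>..<T} \<Longrightarrow> norm (\<psi> t) \<le> c2 * gap (y t)"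
      "\<And>t. t \<in> {\<tau>..<T} \<Longrightarrow> c1 * gap (y t) \<le> sgn (1 - norm y0) * (\<psi> t \<bullet> sgn (y t))"
    using adjoint_exists by blast
  have variation: "integral {0..T} (\<lambda>t. \<psi> t \<bullet> (forcing u t - v t)) \<le> 0"
    "(\<lambda>t. \<psi> t \<bullet> (forcing u t - v t)) absolutely_integrable_on {0..T}" if u': "u \<in> U_ad \<rho>\<^sub>0" for u
  proof -
    interpret adjoint_trajectory K "sgn (1 - norm y0)" y0 v T y \<psi> c1 c2 \<tau> "forcing u"
      by unfold_locales (use \<psi> c12 bounded_forcing_forcing[OF u'] in auto)
    show "(\<lambda>t. \<psi> t \<bullet> (forcing u t - v t)) absolutely_integrable_on {0..T}"
      by (rule pairing_absolutely_integrable)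
    show "integral {0..T} (\<lambda>t. \<psi> t \<bullet> (forcing u t - v t)) \<le> 0"
    proof (rule first_variation)
      fix \<epsilon> :: real assume \<epsilon>: "0 < \<epsilon>" "\<epsilon> \<le> 1"
      define u\<epsilon> where "u\<epsilon> t = ustar t + \<epsilon> *\<^sub>R (u t - ustar t)" for t
      have ue: "u\<epsilon> \<in> U_ad \<rho>\<^sub>0" unfolding u\<epsilon>_def by (rule U_ad_convex[OF u u']) (use \<epsilon> in auto)
      have eq: "AE t in lebesgue. 0 \<le> t \<longrightarrow> B t *v u\<epsilon> t = perturbed \<epsilon> t"
        using forcing_AE[OF u, folded v_def] forcing_AE[OF u']
        by eventually_elim (auto simp: u\<epsilon>_def perturbed_def matrix_vector_right_distrib
            matrix_vector_mult_diff_distrib matrix_vector_mult_scaleR)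
      have pb: "bounded_forcing K (perturbed \<epsilon>)" by (rule perturbed_bounded) (use \<epsilon> in auto)
      have "forced_solution (perturbed \<epsilon>) y0 T (state B y0 u\<epsilon>)"
        by (rule forced_solution_mono[OF quenching_time_state(1)[OF pb eq] T_pos Tle[OF ue]])
      thus "\<exists>z. forced_solution (perturbed \<epsilon>) y0 T z" by blast
    qed
  qed
  obtain um where um: "um \<in> U_ad \<rho>\<^sub>0"
    "\<And>t. t \<in> {0..T} \<Longrightarrow> \<psi> t \<bullet> (B t *v um t) = \<rho>\<^sub>0 * norm (transpose (B t) *v \<psi> t)"
    using maximizing_control[OF \<psi>(1)] by blast
  have dotle: "\<psi> t \<bullet> (B t *v a) \<le> \<rho>\<^sub>0 * norm (transpose (B t) *v \<psi> t)" if "norm a \<le> \<rho>\<^sub>0" for a t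
  proof -
    have "\<psi> t \<bullet> (B t *v a) = (transpose (B t) *v \<psi> t) \<bullet> a"
      unfolding transpose_matrix_vector by (rule dot_lmul_matrix[symmetric])
    also have "\<dots> \<le> norm (transpose (B t) *v \<psi> t) * norm a" by (rule norm_cauchy_schwarz)
    also have "\<dots> \<le> norm (transpose (B t) *v \<psi> t) * \<rho>\<^sub>0" using that by (intro mult_left_mono) auto
    finally show ?thesis by (simp add: mult.commute)
  qed
  have ubd: "AE t in lebesgue. 0 \<le> t \<longrightarrow> norm (ustar t) \<le> \<rho>\<^sub>0" using u by (simp add: U_ad_def AE_half_line)
  define f where "f t = \<psi> t \<bullet> (forcing um t - v t)" for t
  have f_eq: "AE t in lebesgue. t \<in> {0..T} \<longrightarrow> f t = \<rho>\<^sub>0 * norm (transpose (B t) *v \<psi> t) - \<psi> t \<bullet> (B t *v ustar t)"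
    using forcing_AE[OF u, folded v_def] forcing_AE[OF um(1)]
  proof eventually_elim
    case (elim t)
    show ?case
    proof
      assume t: "t \<in> {0..T}"
      hence "forcing um t = B t *v um t" "v t = B t *v ustar t" using elim by auto
      thus "f t = \<rho>\<^sub>0 * norm (transpose (B t) *v \<psi> t) - \<psi> t \<bullet> (B t *v ustar t)"
        using um(2)[OF t] by (simp add: f_def inner_diff_right)
    qed
  qed
  have "AE t in lebesgue. t \<in> {0..T} \<longrightarrow> 0 \<le> f t"
    using f_eq ubd by eventually_elim (use dotle in auto)
  hence f0: "AE t in lebesgue_on {0..T}. 0 \<le> f t" by (subst AE_restrict_space_iff) auto
  have fint: "integrable (lebesgue_on {0..T}) f"
    using variation(2)[OF um(1)] unfolding f_def by (rule absolutely_integrable_imp_integrable) simp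
  have "integral\<^sup>L (lebesgue_on {0..T}) f = integral {0..T} f"
    by (rule lebesgue_integral_eq_integral[OF fint]) simp
  moreover have "integral {0..T} f \<le> 0" using variation(1)[OF um(1)] unfolding f_def .
  moreover have "0 \<le> integral\<^sup>L (lebesgue_on {0..T}) f" by (rule integral_nonneg_AE[OF f0])
  ultimately have "integral\<^sup>L (lebesgue_on {0..T}) f = 0" by linarith
  hence "AE t in lebesgue_on {0..T}. f t = 0" using integral_nonneg_eq_0_iff_AE[OF fint f0] by simp
  moreover have "AE t in lebesgue_on {0..T}. f t = \<rho>\<^sub>0 * norm (transpose (B t) *v \<psi> t) - \<psi> t \<bullet> (B t *v ustar t)"
    using f_eq by (subst AE_restrict_space_iff) auto
  moreover have "AE t in lebesgue_on {0..T}. norm (ustar t) \<le> \<rho>\<^sub>0"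
    using ubd by (subst AE_restrict_space_iff) (auto elim: eventually_mono)
  ultimately have max: "AE t in lebesgue_on {0..T}. is_arg_max (\<lambda>a. \<psi> t \<bullet> (B t *v a)) (\<lambda>a. norm a \<le> \<rho>\<^sub>0) (ustar t)"
  proof eventually_elim
    case (elim t)
    thus ?case using dotle[of _ t] by (auto simp: is_arg_max_linorder)
  qed
  have J_eq: "deriv_matrix f2 (y s) *v \<psi> s = f2_jac (y s) (\<psi> s)" if "s \<in> {t..T} - {T}" "t \<in> {0..<T}" for s t
    using that bounds(1)[of s] bounds(6)[of s] by (intro deriv_matrix_f2) (auto simp: gap_def)
  have adj: "(\<lambda>s. deriv_matrix f2 (y s) *v \<psi> s) absolutely_integrable_on {t..T} \<and>
       \<psi> t = integral {t..T} (\<lambda>s. deriv_matrix f2 (y s) *v \<psi> s)" if t: "t \<in> {0..<T}" for t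
  proof
    show "(\<lambda>s. deriv_matrix f2 (y s) *v \<psi> s) absolutely_integrable_on {t..T}"
      by (rule absolutely_integrable_spike[OF \<psi>I(1)[OF t], of "{T}"]) (use J_eq t in auto)
    have "integral {t..T} (\<lambda>s. deriv_matrix f2 (y s) *v \<psi> s) = integral {t..T} (\<lambda>s. f2_jac (y s) (\<psi> s))"
      by (rule integral_spike[of "{T}"]) (use J_eq t in auto)
    thus "\<psi> t = integral {t..T} (\<lambda>s. deriv_matrix f2 (y s) *v \<psi> s)" using \<psi>I(2)[OF t] by simp
  qed
  have "\<psi> \<tau> \<noteq> 0"
  proof
    assume "\<psi> \<tau> = 0"
    hence "c1 * gap (y \<tau>) \<le> 0" using c12(5)[of \<tau>] c12(3) by simp
    moreover have "0 < c1 * gap (y \<tau>)" using c12(1) bounds(1)[OF c12(3)] by simp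
    ultimately show False by linarith
  qed
  hence "\<exists>t\<in>{0..T}. \<psi> t \<noteq> 0" using c12(3) by (intro bexI[of _ \<tau>]) auto
  thus ?thesis using \<psi>(1,2) adj max by blast
qed

end

theorem theorem1p3:
  fixes B :: "real \<Rightarrow> real^2^2" and \<rho>\<^sub>0 :: real and y0 :: "real^2"
  assumes "B \<in> L_infinity"
    and "\<not> (AE s in half_line. B s = 0)"
    and "\<rho>\<^sub>0 > 0"
    and "y0 \<in> S_f2 B \<rho>\<^sub>0"
  shows "(\<forall>tstar ustar ystar.
            tstar = optimal_time B \<rho>\<^sub>0 y0 \<and> optimal_control B \<rho>\<^sub>0 y0 ustar \<and> ystar = state B y0 ustar \<longrightarrow>
            (\<exists>\<psi> :: real \<Rightarrow> real^2.
               continuous_on {0..tstar} \<psi> \<and>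
               (\<exists>t\<in>{0..tstar}. \<psi> t \<noteq> 0) \<and>
               (\<forall>t\<in>{0..<tstar}.
                  (\<lambda>\<tau>. deriv_matrix f2 (ystar \<tau>) *v \<psi> \<tau>) absolutely_integrable_on {t..tstar} \<and>
                  \<psi> t = integral {t..tstar} (\<lambda>\<tau>. deriv_matrix f2 (ystar \<tau>) *v \<psi> \<tau>)) \<and>
               \<psi> tstar = 0 \<and>
               (AE t in lebesgue_on {0..tstar}.
                  is_arg_max (\<lambda>v. \<psi> t \<bullet> (B t *v v)) (\<lambda>v. norm v \<le> \<rho>\<^sub>0) (ustar t))))
         \<and> optimal_time B \<rho>\<^sub>0 y0 \<le> (2 * K0 B \<rho>\<^sub>0 + 1) * (norm y0 - 1)\<^sup>2 / (2 * K0 B \<rho>\<^sub>0)"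
proof -
  interpret control_problem B \<rho>\<^sub>0 y0 by unfold_locales (use assms in auto)
  show ?thesis using pontryagin_principle optimal_time_bound by blast
qed

end
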